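(* Let $0<p<1$. If $\mathcal{Y}=(\boldsymbol y_i)_{i\in\mathcal{M}}$ is a truncation quasi-greedy basis of an (infinite-dimensional) complemented subspace $\mathbb{Y}$ of the Hardy space $H_p(\mathbb{D})$, then $\mathcal{Y}$ is democratic, and its upper democracy function satisfies $$\varphi_u[\mathcal{Y},H_p(\mathbb{D})](m)\approx m^{1/p},\qquad m\in\mathbb{N}.$$ In particular, all quasi-greedy bases of $H_p(\mathbb{D})$ are almost greedy.
   Context: $H_p(\mathbb{D})$ is the quasi-Banach space of analytic functions $f$ on the open unit disc $\mathbb{D}\subset\mathbb{C}$ with $\|f\|=\sup_{0<r<1}\left(\frac1{2\pi}\int_0^{2\pi}|f(re^{i\theta})|^p\,d\theta\right)^{1/p}<\infty$. A subspace is complemented if it is the range of a bounded linear projection. A basis of a quasi-Banach space $\mathbb{X}$ over $\mathbb{F}\in\{\mathbb{R},\mathbb{C}\}$ is a norm-bounded countable family $\mathcal{X}=(\boldsymbol x_n)_{n\in\mathcal{N}}$ whose closed linear span is $\mathbb{X}$ and for which there is a norm-bounded family $(\boldsymbol x_n^* )_{n\in\mathcal{N}}$ in $\mathbb{X}^*$ (the dual basis) with $\boldsymbol x_n^*(\boldsymbol x_k)=\delta_{n,k}$. Identify $\mathcal{N}$ with $\mathbb{N}$ via a fixed enumeration. For $f\in\mathbb{X}$ and $m\in\mathbb{N}$, $A_m(f)$ is the unique set of cardinality $m$ such that whenever $i\in A_m(f)$ and $j\notin A_m(f)$, either $|\boldsymbol x_i^*(f)|>|\boldsymbol x_j^*(f)|$,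 or $|\boldsymbol x_i^*(f)|=|\boldsymbol x_j^*(f)|$ and $i<j$. Put $\mathcal{G}_m(f)=\sum_{n\in A_m(f)}\boldsymbol x_n^*(f)\,\boldsymbol x_n$ and $\mathcal{R}_m(f)=\min_{n\in A_m(f)}|\boldsymbol x_n^*(f)|\sum_{n\in A_m(f)}\operatorname{sign}(\boldsymbol x_n^*(f))\,\boldsymbol x_n$, where $\operatorname{sign}(0)=1$ and $\operatorname{sign}(a)=a/|a|$ otherwise. The basis is quasi-greedy if $\|\mathcal{G}_m(f)\|\le C\|f\|$ for some $C$ and all $f,m$; it is truncation quasi-greedy if $\|\mathcal{R}_m(f)\|\le C\|f\|$ for some $C$ and all $f,m$ (every quasi-greedy basis is known to be truncation quasi-greedy). For finite $A\subseteq\mathcal{N}$ let $\mathbf{1}_A=\sum_{n\in A}\boldsymbol x_n$. The basis is democratic if there is $D\ge1$ with $\|\mathbf{1}_A\|\le D\|\mathbf{1}_B\|$ for all finite $A,B$ with $|A|\le|B|$. Its upper democracy function is $\varphi_u[\mathcal{X},\mathbb{X}](m)=\sup_{|A|\le m}\|\mathbf{1}_A\|$. A basis is almost greedy if there is $C$ with $\|f-\mathcal{G}_m(f)\|\le C\inf\{\|f-\sum_{n\in A}\boldsymbol x_n^*(f)\boldsymbol x_n\|:|A|\le m\}$ for all $f,m$; this is known to be equivalent to being quasi-greedy and democratic. $\alpha_m\approx\beta_m$ means that there are constants $0<c\le C<\infty$ with $c\beta_m\le\alpha_m\le C\beta_m$ for all $m$. *)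

theory Defs
  imports "HOL-Analysis.Analysis" "HOL-Library.Function_Algebras"
begin

text \<open>
  All spaces in this theory are complex vector spaces of functions \<open>'a \<Rightarrow> complex\<close> with pointwise
  operations. Such a space is given by a carrier set \<open>X\<close> and a quasi-norm \<open>N\<close>, whose values
  outside \<open>X\<close> are irrelevant.
\<close>

definition fscale :: "complex \<Rightarrow> ('a \<Rightarrow> complex) \<Rightarrow> ('a \<Rightarrow> complex)" where
  "fscale c f = (\<lambda>z. c * f z)"

lemma vector_space_fscale: "vector_space fscale"
  by unfold_locales (auto simp: fscale_def algebra_simps fun_eq_iff)

definition linear_on ::
  "(complex \<Rightarrow> 'b \<Rightarrow> 'b) \<Rightarrow> ('a \<Rightarrow> complex) set \<Rightarrow> (('a \<Rightarrow> complex) \<Rightarrow> 'b::ab_group_add) \<Rightarrow> bool" where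
  "linear_on s X T \<longleftrightarrow>
     (\<forall>f\<in>X. \<forall>g\<in>X. T (f + g) = T f + T g) \<and> (\<forall>c. \<forall>f\<in>X. T (fscale c f) = s c (T f))"

definition complemented ::
  "(('a \<Rightarrow> complex) \<Rightarrow> real) \<Rightarrow> ('a \<Rightarrow> complex) set \<Rightarrow> ('a \<Rightarrow> complex) set \<Rightarrow> bool" where
  "complemented N X Y \<longleftrightarrow>
     (\<exists>P. linear_on fscale X P \<and> (\<exists>C. \<forall>f\<in>X. N (P f) \<le> C * N f) \<and>
          P ` X \<subseteq> X \<and> (\<forall>f\<in>X. P (P f) = P f) \<and> P ` X = Y)"

definition infinite_dimensional :: "('a \<Rightarrow> complex) set \<Rightarrow> bool" where
  "infinite_dimensional X \<longleftrightarrow> \<not> (\<exists>B. finite B \<and> X \<subseteq> module.span fscale B)"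

definition closed_span ::
  "(('a \<Rightarrow> complex) \<Rightarrow> real) \<Rightarrow> ('a \<Rightarrow> complex) set \<Rightarrow> ('a \<Rightarrow> complex) set \<Rightarrow> ('a \<Rightarrow> complex) set" where
  "closed_span N X S = {f \<in> X. \<forall>\<epsilon>>0. \<exists>g\<in>module.span fscale S. N (f - g) < \<epsilon>}"


text \<open>
  Bases are indexed by \<open>nat\<close>, which fixes the enumeration used to break ties. The dual basis \<open>xs\<close>
  is determined by \<open>x\<close> only on \<open>X\<close>, and is only ever applied there.
\<close>

definition basis_dual ::
  "(('a \<Rightarrow> complex) \<Rightarrow> real) \<Rightarrow> ('a \<Rightarrow> complex) set \<Rightarrow> (nat \<Rightarrow> 'a \<Rightarrow> complex) \<Rightarrow>
   (nat \<Rightarrow> ('a \<Rightarrow> complex) \<Rightarrow> complex) \<Rightarrow> bool" where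
  "basis_dual N X x xs \<longleftrightarrow>
     range x \<subseteq> X \<and> (\<exists>C. \<forall>n. N (x n) \<le> C) \<and> closed_span N X (range x) = X \<and>
     (\<forall>n. linear_on (*) X (xs n)) \<and> (\<exists>C. \<forall>n. \<forall>f\<in>X. cmod (xs n f) \<le> C * N f) \<and>
     (\<forall>n k. xs n (x k) = (if n = k then 1 else 0))"

definition greedy_set ::
  "(nat \<Rightarrow> ('a \<Rightarrow> complex) \<Rightarrow> complex) \<Rightarrow> nat \<Rightarrow> ('a \<Rightarrow> complex) \<Rightarrow> nat set" where
  "greedy_set xs m f =
     (THE A. finite A \<and> card A = m \<and>
        (\<forall>i\<in>A. \<forall>j. j \<notin> A \<longrightarrow>
           cmod (xs i f) > cmod (xs j f) \<or> (cmod (xs i f) = cmod (xs j f) \<and> i < j)))"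

definition coord_proj ::
  "(nat \<Rightarrow> 'a \<Rightarrow> complex) \<Rightarrow> (nat \<Rightarrow> ('a \<Rightarrow> complex) \<Rightarrow> complex) \<Rightarrow> nat set \<Rightarrow>
   ('a \<Rightarrow> complex) \<Rightarrow> ('a \<Rightarrow> complex)" where
  "coord_proj x xs A f = (\<Sum>n\<in>A. fscale (xs n f) (x n))"

definition greedy_op ::
  "(nat \<Rightarrow> 'a \<Rightarrow> complex) \<Rightarrow> (nat \<Rightarrow> ('a \<Rightarrow> complex) \<Rightarrow> complex) \<Rightarrow> nat \<Rightarrow>
   ('a \<Rightarrow> complex) \<Rightarrow> ('a \<Rightarrow> complex)" where
  "greedy_op x xs m f = coord_proj x xs (greedy_set xs m f) f"

text \<open>Unlike \<^const>\<open>sgn\<close>, this takes the value 1 at 0.\<close>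

definition sign1 :: "complex \<Rightarrow> complex" where
  "sign1 a = (if a = 0 then 1 else a / of_real (cmod a))"

text \<open>For \<open>m = 0\<close> the minimum is over the empty set, but the sum it multiplies is 0.\<close>

definition restricted_trunc_op ::
  "(nat \<Rightarrow> 'a \<Rightarrow> complex) \<Rightarrow> (nat \<Rightarrow> ('a \<Rightarrow> complex) \<Rightarrow> complex) \<Rightarrow> nat \<Rightarrow>
   ('a \<Rightarrow> complex) \<Rightarrow> ('a \<Rightarrow> complex)" where
  "restricted_trunc_op x xs m f =
     fscale (of_real (Min ((\<lambda>n. cmod (xs n f)) ` greedy_set xs m f)))
       (\<Sum>n\<in>greedy_set xs m f. fscale (sign1 (xs n f)) (x n))"

definition quasi_greedy ::
  "(('a \<Rightarrow> complex) \<Rightarrow> real) \<Rightarrow> ('a \<Rightarrow> complex) set \<Rightarrow> (nat \<Rightarrow> 'a \<Rightarrow> complex) \<Rightarrow>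
   (nat \<Rightarrow> ('a \<Rightarrow> complex) \<Rightarrow> complex) \<Rightarrow> bool" where
  "quasi_greedy N X x xs \<longleftrightarrow> (\<exists>C. \<forall>f\<in>X. \<forall>m. N (greedy_op x xs m f) \<le> C * N f)"

definition truncation_quasi_greedy ::
  "(('a \<Rightarrow> complex) \<Rightarrow> real) \<Rightarrow> ('a \<Rightarrow> complex) set \<Rightarrow> (nat \<Rightarrow> 'a \<Rightarrow> complex) \<Rightarrow>
   (nat \<Rightarrow> ('a \<Rightarrow> complex) \<Rightarrow> complex) \<Rightarrow> bool" where
  "truncation_quasi_greedy N X x xs \<longleftrightarrow>
     (\<exists>C. \<forall>f\<in>X. \<forall>m. N (restricted_trunc_op x xs m f) \<le> C * N f)"

definition democratic ::
  "(('a \<Rightarrow> complex) \<Rightarrow> real) \<Rightarrow> (nat \<Rightarrow> 'a \<Rightarrow> complex) \<Rightarrow> bool" where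
  "democratic N x \<longleftrightarrow>
     (\<exists>D\<ge>1. \<forall>A B. finite A \<and> finite B \<and> card A \<le> card B \<longrightarrow> N (\<Sum>n\<in>A. x n) \<le> D * N (\<Sum>n\<in>B. x n))"

definition upper_democracy ::
  "(('a \<Rightarrow> complex) \<Rightarrow> real) \<Rightarrow> (nat \<Rightarrow> 'a \<Rightarrow> complex) \<Rightarrow> nat \<Rightarrow> real" where
  "upper_democracy N x m = (SUP A\<in>{A. finite A \<and> card A \<le> m}. N (\<Sum>n\<in>A. x n))"

definition almost_greedy ::
  "(('a \<Rightarrow> complex) \<Rightarrow> real) \<Rightarrow> ('a \<Rightarrow> complex) set \<Rightarrow> (nat \<Rightarrow> 'a \<Rightarrow> complex) \<Rightarrow>
   (nat \<Rightarrow> ('a \<Rightarrow> complex) \<Rightarrow> complex) \<Rightarrow> bool" where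
  "almost_greedy N X x xs \<longleftrightarrow>
     (\<exists>C. \<forall>f\<in>X. \<forall>m. N (f - greedy_op x xs m f) \<le>
        C * (INF A\<in>{A. finite A \<and> card A \<le> m}. N (f - coord_proj x xs A f)))"

definition comparable :: "(nat \<Rightarrow> real) \<Rightarrow> (nat \<Rightarrow> real) \<Rightarrow> bool" where
  "comparable \<alpha> \<beta> \<longleftrightarrow>
     (\<exists>c C. 0 < c \<and> c \<le> C \<and> (\<forall>m. c * \<beta> m \<le> \<alpha> m \<and> \<alpha> m \<le> C * \<beta> m))"


definition hardy_mean :: "real \<Rightarrow> (complex \<Rightarrow> complex) \<Rightarrow> real \<Rightarrow> real" where
  "hardy_mean p f r =
     ((1 / (2 * pi)) * integral {0..2 * pi} (\<lambda>\<theta>. cmod (f (of_real r * cis \<theta>)) powr p)) powr (1 / p)"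

definition hardy_norm :: "real \<Rightarrow> (complex \<Rightarrow> complex) \<Rightarrow> real" where
  "hardy_norm p f = (SUP r\<in>{0<..<1}. hardy_mean p f r)"

text \<open>
  A function on the open unit disc is represented by its extension by 0 to the whole plane, so
  that equality of functions is equality on the disc.
\<close>

definition hardy :: "real \<Rightarrow> (complex \<Rightarrow> complex) set" where
  "hardy p = {f. f analytic_on ball 0 1 \<and> (\<forall>z. z \<notin> ball 0 1 \<longrightarrow> f z = 0) \<and>
                 bdd_above (hardy_mean p f ` {0<..<1})}"

end

theory Submission
  imports Defs "HOL-Complex_Analysis.Complex_Analysis"
begin

text \<open>
  The upper estimate is \<open>p\<close>-convexity. For the lower one, every bounded functional \<open>\<phi>\<close> on \<open>H_p\<close>
  satisfies \<open>|\<phi> f| \<le> C \<integral> |f z| |\<phi> k_z| (1 - |z|)^(1/p - 2) dA\<close>, where \<open>k_z\<close> is a reproducing kernel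
  normalised in \<open>H_p\<close>. The weak type bound for \<open>|f z| (1 - |z|)^(1/p)\<close> with respect to the hyperbolic
  area (Marcinkiewicz interpolation of \<open>|f|^(p/2) \<le> P[|f|^(p/2)]\<close>) shows that, since \<open>p < 1\<close>, the region where
  either factor is small contributes little. So \<open>y*_n (y_n) = 1\<close> forces the set \<open>E_n\<close> on which both
  \<open>|y_n z| (1 - |z|)^(1/p)\<close> and \<open>|y*_n (P k_z)|\<close> exceed a constant to have hyperbolic area bounded
  below. Truncation quasi-greediness applied to \<open>P k_z\<close> shows that the \<open>E_n\<close> have bounded overlap,
  so their union over \<open>n \<in> A\<close> has area at least \<open>c |A|\<close>. Some \<open>y_n\<close> is large at each of its points, hence
  so are half of all the partial sums over subsets of \<open>A\<close>; their norms are controlled by that of the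
  full sum, and the weak type bound gives \<open>c |A| \<le> C N(1_A)^p\<close>.

  The kernel formula needs the density of polynomials in \<open>H_p\<close>, that is, \<open>f_r \<rightarrow> f\<close>. This follows
  from uniform PL-convexity of \<open>L_p\<close>: applied to \<open>w \<mapsto> f (\<sigma> \<zeta> b w)\<close> with a disc automorphism \<open>b\<close> and averaged over
  rotations \<open>\<zeta>\<close>, it bounds \<open>f_\<sigma> - f_\<sigma>'\<close> by the increments of the circle means.
\<close>

section \<open>Circle means\<close>

text \<open>For p < 1 the space H_p is not locally convex, so convexity arguments fail; estimates
  are made for p-th powers, which are subadditive. Boundary values are avoided altogether: only
  circles of radius below 1 are integrated over, where all functions are continuous, and limits are
  taken at the end.

  The hyperbolic area enters because |f z| (1 - |z|)^(1/p) is at once bounded by the norm of f and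
  of weak type p for this area. A bounded function of weak type p < 1 is integrable, and its small
  values carry little mass; this is where p < 1 enters.

  The last claim of the theorem concerns quasi-greedy bases. That these are truncation quasi-greedy,
  and almost greedy once they are democratic, is derived here as well, in p-normed spaces. Where a
  normed space would allow convex combinations of indicator sums, binary digits of the coefficients
  and absorption of small errors are used instead.\<close>

definition cmean :: "(complex \<Rightarrow> 'a::banach) \<Rightarrow> 'a" where
  "cmean F = (1 / (2 * pi)) *\<^sub>R integral {0..2 * pi} (\<lambda>t. F (cis t))"

lemma continuous_on_cis_comp:
  assumes "continuous_on (sphere 0 1) F"
  shows "continuous_on S (\<lambda>t. F (cis t))"
  by (rule continuous_on_compose2[OF assms]) (auto intro!: continuous_intros)

lemma integrable_cis_comp:
  fixes F :: "complex \<Rightarrow> 'a::banach"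
  assumes "continuous_on (sphere 0 1) F"
  shows "(\<lambda>t. F (cis t)) integrable_on {a..b}"
  by (rule integrable_continuous_interval[OF continuous_on_cis_comp[OF assms]])

lemma cmean_cong: "(\<And>z. norm z = 1 \<Longrightarrow> F z = G z) \<Longrightarrow> cmean F = cmean G"
  unfolding cmean_def by (simp cong: integral_cong)

lemma cmean_const [simp]: "cmean (\<lambda>_. c) = c"
  by (simp add: cmean_def)

lemma cmean_eq_0: "(\<And>z. norm z = 1 \<Longrightarrow> F z = 0) \<Longrightarrow> cmean F = 0"
  using cmean_cong[of F "\<lambda>_. 0"] by simp

lemma cmean_add:
  assumes "continuous_on (sphere 0 1) F" "continuous_on (sphere 0 1) G"
  shows "cmean (\<lambda>z. F z + G z) = cmean F + cmean G"
  unfolding cmean_def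
  by (subst integral_add) (auto intro!: integrable_cis_comp assms simp: scaleR_add_right)

lemma cmean_diff:
  assumes "continuous_on (sphere 0 1) F" "continuous_on (sphere 0 1) G"
  shows "cmean (\<lambda>z. F z - G z) = cmean F - cmean G"
  unfolding cmean_def
  by (subst integral_diff) (auto intro!: integrable_cis_comp assms simp: scaleR_diff_right)

lemma cmean_mult_left:
  fixes c :: "'a::{banach,real_normed_field}"
  shows "cmean (\<lambda>z. c * F z) = c * cmean F"
  unfolding cmean_def by simp

lemma cmean_mono:
  fixes F G :: "complex \<Rightarrow> real"
  assumes "continuous_on (sphere 0 1) F" "continuous_on (sphere 0 1) G"
    and "\<And>z. norm z = 1 \<Longrightarrow> F z \<le> G z"
  shows "cmean F \<le> cmean G"
  unfolding cmean_def
  by (auto intro!: mult_left_mono integral_le integrable_cis_comp assms divide_right_mono)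

lemma cmean_nonneg:
  fixes F :: "complex \<Rightarrow> real"
  assumes "continuous_on (sphere 0 1) F" "\<And>z. norm z = 1 \<Longrightarrow> 0 \<le> F z"
  shows "0 \<le> cmean F"
  using cmean_mono[of "\<lambda>_. 0" F] assms by simp

lemma norm_cmean_le:
  fixes F :: "complex \<Rightarrow> 'a::euclidean_space"
  assumes "continuous_on (sphere 0 1) F"
  shows "norm (cmean F) \<le> cmean (\<lambda>z. norm (F z))"
proof -
  have "norm (integral {0..2 * pi} (\<lambda>t. F (cis t))) \<le> integral {0..2 * pi} (\<lambda>t. norm (F (cis t)))"
    by (intro integral_norm_bound_integral integrable_cis_comp assms continuous_intros) auto
  then show ?thesis
    unfolding cmean_def by (simp add: divide_right_mono)
qed

text \<open>Multiplication by \<open>w\<close> shifts the angle by its argument; the part of the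
  interval that overhangs 2 pi is moved back by periodicity.\<close>

lemma cmean_rotate:
  fixes F :: "complex \<Rightarrow> 'a::euclidean_space"
  assumes F: "continuous_on (sphere 0 1) F" and w: "norm w = 1"
  shows "cmean (\<lambda>z. F (w * z)) = cmean F"
proof -
  define a where "a = Arg2pi w"
  have a: "0 \<le> a" "a \<le> 2 * pi" "w = cis a"
    using Arg2pi[of w] w unfolding a_def by (auto simp: cis_conv_exp is_Arg_def)
  define g where "g t = F (cis t)" for t
  have cont: "continuous_on S g" for S
    unfolding g_def by (rule continuous_on_cis_comp[OF F])
  have int: "g integrable_on {x..y}" for x y
    by (rule integrable_continuous_interval[OF cont])
  have "integral {0..2*pi} (\<lambda>t. g (t + a)) = integral {a..2*pi + a} g"
    using integral_shift[of 0 a "2*pi" g] cont by (simp add: o_def)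
  also have "\<dots> = integral {a..2*pi} g + integral {2*pi..2*pi + a} g"
    using a by (intro Henstock_Kurzweil_Integration.integral_combine[symmetric] int) auto
  also have "integral {2*pi..2*pi + a} g = integral {0..a} (\<lambda>t. g (t + 2*pi))"
    using integral_shift[of 0 "2*pi" a g] cont by (simp add: o_def add.commute)
  also have "(\<lambda>t. g (t + 2*pi)) = g"
    by (auto simp: g_def fun_eq_iff cis.code)
  also have "integral {a..2*pi} g + integral {0..a} g = integral {0..2*pi} g"
    using a by (subst add.commute, intro Henstock_Kurzweil_Integration.integral_combine int) auto
  finally show ?thesis
    unfolding cmean_def g_def a by (simp add: cis_mult add.commute)
qed

lemma cmean_swap:
  fixes F :: "complex \<Rightarrow> complex \<Rightarrow> 'a::banach"
  assumes "continuous_on (sphere 0 1 \<times> sphere 0 1) (\<lambda>(z, w). F z w)"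
  shows "cmean (\<lambda>z. cmean (F z)) = cmean (\<lambda>w. cmean (\<lambda>z. F z w))"
proof -
  have c: "continuous_on S (\<lambda>x. F (cis (fst x)) (cis (snd x)))" for S
    by (rule continuous_on_compose2[OF assms, of S "\<lambda>x. (cis (fst x), cis (snd x))", simplified])
       (auto intro!: continuous_intros)
  show ?thesis
    using integral_swap_continuous[of 0 0 "2*pi" "2*pi" "\<lambda>s t. F (cis s) (cis t)"] c
    unfolding cmean_def by (simp add: case_prod_unfold)
qed

lemma continuous_on_cmean:
  fixes F :: "'b::topological_space \<Rightarrow> complex \<Rightarrow> 'a::banach"
  assumes "continuous_on (U \<times> sphere 0 1) (\<lambda>(x, z). F x z)"
  shows "continuous_on U (\<lambda>x. cmean (F x))"
proof -
  have "continuous_on (U \<times> cbox 0 (2*pi)) (\<lambda>x. F (fst x) (cis (snd x)))"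
    by (rule continuous_on_compose2[OF assms, of _ "\<lambda>x. (fst x, cis (snd x))", simplified])
       (auto intro!: continuous_intros)
  then show ?thesis
    unfolding cmean_def
    by (intro continuous_intros integral_continuous_on_param[of U 0 "2*pi", simplified cbox_interval])
       (simp add: case_prod_unfold)
qed

text \<open>On the unit circle d u / (u - z) equals i d t / (1 - z cnj u), which turns Cauchy's
  formula into a mean over angles with a conjugated kernel.\<close>

lemma cmean_Cauchy:
  assumes F: "F holomorphic_on ball 0 R" "R > 1" and z: "norm z < 1"
  shows "cmean (\<lambda>\<zeta>. F \<zeta> / (1 - z * cnj \<zeta>)) = F z"
proof -
  have "F holomorphic_on cball 0 1"
    by (rule holomorphic_on_subset[OF F(1)]) (use F in auto)
  then have "((\<lambda>u. F u / (u - z)) has_contour_integral (2 * of_real pi * \<i> * F z)) (circlepath 0 1)"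
    using z by (intro Cauchy_integral_circlepath_simple) auto
  then have I: "((\<lambda>t. F (cis t) / (cis t - z) * \<i> * cis t) has_integral (2 * of_real pi * \<i> * F z)) {0..2*pi}"
    unfolding circlepath_def by (subst (asm) has_contour_integral_part_circlepath_iff) (auto simp: mult_ac)
  have "F (cis t) / (cis t - z) * \<i> * cis t = \<i> * (F (cis t) / (1 - z * cnj (cis t)))" for t
  proof -
    have "cis t * (1 - z * cnj (cis t)) = cis t - z"
      by (simp add: algebra_simps cis_cnj cis_mult)
    moreover have "cis t \<noteq> z" using z by auto
    ultimately show ?thesis
      by (auto simp: divide_simps)
  qed
  with I have "((\<lambda>t. \<i> * (F (cis t) / (1 - z * cnj (cis t)))) has_integral (2 * of_real pi * \<i> * F z)) {0..2*pi}"
    by simp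
  then have "integral {0..2*pi} (\<lambda>t. \<i> * (F (cis t) / (1 - z * cnj (cis t)))) = 2 * of_real pi * \<i> * F z"
    by (rule integral_unique)
  then have "\<i> * integral {0..2*pi} (\<lambda>t. F (cis t) / (1 - z * cnj (cis t))) = \<i> * (2 * of_real pi * F z)"
    by (simp only: integral_mult_right) (simp add: mult_ac)
  then have "integral {0..2*pi} (\<lambda>t. F (cis t) / (1 - z * cnj (cis t))) = 2 * of_real pi * F z"
    by (simp only: mult_cancel_left) auto
  then show ?thesis
    unfolding cmean_def by (simp add: scaleR_conv_of_real)
qed

lemma cmean_holomorphic:
  assumes "F holomorphic_on ball 0 R" "R > 1"
  shows "cmean F = F 0"
  using cmean_Cauchy[OF assms, of 0] by simp

section \<open>Blaschke factorisation and growth of circle means\<close>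

lemma cmod_blaschke_ineq:
  assumes "norm z \<le> 1" "norm a < 1"
  shows "norm (z - a) \<le> norm (1 - cnj a * z)"
    and "norm z = 1 \<Longrightarrow> norm (z - a) = norm (1 - cnj a * z)"
proof -
  have *: "(norm (1 - cnj a * z))\<^sup>2 - (norm (z - a))\<^sup>2 = (1 - (norm a)\<^sup>2) * (1 - (norm z)\<^sup>2)"
    unfolding cmod_power2 by (simp add: algebra_simps power2_eq_square)
  have "(norm a)\<^sup>2 \<le> 1" "(norm z)\<^sup>2 \<le> 1"
    using assms by (auto intro!: power_le_one)
  then have "0 \<le> (1 - (norm a)\<^sup>2) * (1 - (norm z)\<^sup>2)"
    by (intro mult_nonneg_nonneg) linarith+
  then have "(norm (z - a))\<^sup>2 \<le> (norm (1 - cnj a * z))\<^sup>2"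
    unfolding *[symmetric] by linarith
  then show "norm (z - a) \<le> norm (1 - cnj a * z)"
    by (rule power2_le_imp_le) simp
  show "norm (z - a) = norm (1 - cnj a * z)" if "norm z = 1"
  proof (rule power2_eq_imp_eq)
    have "(norm (1 - cnj a * z))\<^sup>2 - (norm (z - a))\<^sup>2 = 0"
      unfolding * that by simp
    then show "(norm (z - a))\<^sup>2 = (norm (1 - cnj a * z))\<^sup>2" by linarith
  qed simp_all
qed

text \<open>Induction on the number of distinct zeros in the open disc: replacing (z - a)^n by (1 -
  cnj a z)^n removes one zero with its full multiplicity and leaves the modulus on the circle
  unchanged. The circle itself must be free of zeros, so that the zero-free cofactor survives on a
  slightly larger disc.\<close>

lemma blaschke_factor:
  assumes "G holomorphic_on ball 0 R" "R > 1" "\<And>z. norm z = 1 \<Longrightarrow> G z \<noteq> 0"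
  shows "\<exists>B K R'. 1 < R' \<and> R' \<le> R \<and> B holomorphic_on ball 0 R' \<and> K holomorphic_on ball 0 R' \<and>
    (\<forall>z. norm z \<le> 1 \<longrightarrow> norm (B z) \<le> 1) \<and> (\<forall>z. norm z = 1 \<longrightarrow> norm (B z) = 1) \<and>
    (\<forall>z\<in>ball 0 R'. K z \<noteq> 0) \<and> (\<forall>z\<in>ball 0 R'. G z = B z * K z)"
proof -
  have fin: "finite {z \<in> cball 0 \<rho>. G z = 0}"
    if "G holomorphic_on ball 0 R" "\<And>z. norm z = 1 \<Longrightarrow> G z \<noteq> 0" "\<rho> < R" for G \<rho>
  proof (cases "G constant_on ball 0 R")
    case True
    then obtain c where c: "\<And>z. z \<in> ball 0 R \<Longrightarrow> G z = c" by (auto simp: constant_on_def)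
    with that(2)[of 1] assms(2) have "c \<noteq> 0" by force
    then have "{z \<in> cball 0 \<rho>. G z = 0} = {}" using c that by force
    then show ?thesis by (metis finite.emptyI)
  next
    case False
    show ?thesis
      by (rule holomorphic_compact_finite_zeros[OF that(1)]) (use that False in auto)
  qed
  show ?thesis using assms(1,3)
  proof (induction "card {z \<in> ball 0 1. G z = 0}" arbitrary: G rule: less_induct)
    case less
    have fin1: "finite {z \<in> ball 0 1. G z = 0}"
      by (rule finite_subset[OF _ fin[OF less(2,3) assms(2)]]) auto
    show ?case
    proof (cases "{z \<in> ball 0 1. G z = 0} = {}")
      case True
      \<comment> \<open>The finitely many zeros collected here lie outside the closed unit disc, so
        a radius slightly above 1 avoids them all.\<close>
      define Z where "Z = {z \<in> cball 0 ((1 + R) / 2). G z = 0}"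
      have "finite Z" unfolding Z_def using assms(2) by (intro fin less) auto
      moreover have "1 < norm z" if "z \<in> Z" for z
        using that True less(3)[of z] by (auto simp: Z_def) (metis linorder_neqE_linordered_idom)
      ultimately have "\<forall>\<^sub>F r in at_right 1. \<forall>z\<in>Z. r < norm z"
        by (intro eventually_ball_finite) (auto simp: eventually_at_right_field intro: exI[of _ "norm _"])
      moreover have "\<forall>\<^sub>F r in at_right (1::real). r < (1 + R) / 2" "\<forall>\<^sub>F r in at_right (1::real). 1 < r"
        using assms(2) by (auto simp: eventually_at_right_field intro: exI[of _ "(1 + R) / 2"])
      ultimately have "\<forall>\<^sub>F r in at_right 1. (\<forall>z\<in>Z. r < norm z) \<and> r < (1 + R) / 2 \<and> 1 < r"
        by eventually_elim auto
      then obtain r where r: "\<forall>z\<in>Z. r < norm z" "r < (1 + R) / 2" "1 < r"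
        by (auto dest!: eventually_happens)
      have "G z \<noteq> 0" if "z \<in> ball 0 r" for z
        using r that by (force simp: Z_def)
      moreover have "G holomorphic_on ball 0 r"
        by (rule holomorphic_on_subset[OF less(2)]) (use r assms in auto)
      ultimately show ?thesis using r assms(2)
        by (intro exI[of _ "\<lambda>_. 1"] exI[of _ G] exI[of _ r]) auto
    next
      case False
      then obtain a where a: "norm a < 1" "G a = 0" by auto
      have nc: "\<not> G constant_on ball 0 R"
      proof
        assume "G constant_on ball 0 R"
        then obtain c where c: "\<And>z. z \<in> ball 0 R \<Longrightarrow> G z = c" by (auto simp: constant_on_def)
        from c[of a] c[of 1] a assms(2) less(3)[of 1] show False by auto
      qed
      have aR: "a \<in> ball 0 R" using a assms(2) by auto
      obtain g r n where g: "0 < n" "0 < r" "ball a r \<subseteq> ball 0 R" "g holomorphic_on ball a r"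
        "\<And>w. w \<in> ball a r \<Longrightarrow> G w = (w - a) ^ n * g w" "\<And>w. w \<in> ball a r \<Longrightarrow> g w \<noteq> 0"
        using holomorphic_factor_zero_nonconstant[OF less(2) open_ball connected_ball aR a(2) nc]
        by metis
      \<comment> \<open>The quotient by (z - a)^n, with the removable singularity at
        \<open>a\<close> filled in by the local factor \<open>g\<close>.\<close>
      define h where "h z = (if z \<in> ball a r then g z else G z / (z - a) ^ n)" for z
      have hG: "h z = G z / (z - a) ^ n" if "z \<noteq> a" for z
        using that g(5)[of z] by (auto simp: h_def)
      have "h holomorphic_on ball a r"
        using g(4) by (rule holomorphic_transform) (auto simp: h_def)
      moreover have "h holomorphic_on (ball 0 R - {a})"
      proof (rule holomorphic_transform[of "\<lambda>z. G z / (z - a) ^ n"])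
        show "(\<lambda>z. G z / (z - a) ^ n) holomorphic_on ball 0 R - {a}"
          by (intro holomorphic_intros holomorphic_on_subset[OF less(2)]) auto
      qed (use hG in auto)
      ultimately have "h holomorphic_on (ball a r \<union> (ball 0 R - {a}))"
        by (intro holomorphic_on_Un) auto
      then have hh: "h holomorphic_on ball 0 R"
        by (rule holomorphic_on_subset) (use g(2) in auto)
      have h0: "h z = 0 \<longleftrightarrow> G z = 0 \<and> z \<noteq> a" for z
        using g(2) g(6)[of a] hG[of z] by (cases "z = a") (auto simp: h_def)
      have Gh: "G z = (z - a) ^ n * h z" for z
        using hG[of z] a g(1) by (cases "z = a") auto
      define G' where "G' z = (1 - cnj a * z) ^ n * h z" for z
      have ne: "1 - cnj a * z \<noteq> 0" if "norm z * norm a < 1" for z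
        using that by (metis complex_mod_cnj eq_iff_diff_eq_0 less_irrefl mult.commute norm_mult norm_one)
      have ne1: "1 - cnj a * z \<noteq> 0" if "norm z \<le> 1" for z
        using that a by (intro ne) (meson le_less_trans mult_left_le_one_le norm_ge_zero)
      have G'1: "G' holomorphic_on ball 0 R"
        unfolding G'_def by (intro holomorphic_intros hh)
      have G'2: "G' z \<noteq> 0" if "norm z = 1" for z
        using ne1[of z] h0[of z] less(3)[OF that] that by (auto simp: G'_def)
      have G'3: "card {z \<in> ball 0 1. G' z = 0} < card {z \<in> ball 0 1. G z = 0}"
      proof (rule psubset_card_mono[OF fin1])
        show "{z \<in> ball 0 1. G' z = 0} \<subset> {z \<in> ball 0 1. G z = 0}"
        proof
          show "{z \<in> ball 0 1. G' z = 0} \<subseteq> {z \<in> ball 0 1. G z = 0}"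
            using ne1 h0 by (auto simp: G'_def)
          have "G' a \<noteq> 0" using ne1[of a] h0[of a] a by (auto simp: G'_def)
          then show "{z \<in> ball 0 1. G' z = 0} \<noteq> {z \<in> ball 0 1. G z = 0}" using a by auto
        qed
      qed
      obtain B K R' where BK: "1 < R'" "R' \<le> R" "B holomorphic_on ball 0 R'"
        "K holomorphic_on ball 0 R'" "\<And>z. norm z \<le> 1 \<Longrightarrow> norm (B z) \<le> 1"
        "\<And>z. norm z = 1 \<Longrightarrow> norm (B z) = 1" "\<And>z. z\<in>ball 0 R' \<Longrightarrow> K z \<noteq> 0"
        "\<And>z. z\<in>ball 0 R' \<Longrightarrow> G' z = B z * K z"
        using less(1)[OF G'3 G'1 G'2] by blast
      \<comment> \<open>For nonzero \<open>a\<close>, the number 2 / (1 + |a|) lies strictly between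
        1 and 1 / |a|, the modulus of the pole of the new factor.\<close>
      define R'' where "R'' = min R' (2 / (1 + norm a))"
      have R'': "1 < R''" "R'' \<le> R'" using BK a by (auto simp: R''_def field_simps add_pos_nonneg)
      have ne2: "1 - cnj a * z \<noteq> 0" if "z \<in> ball 0 R''" for z
      proof (rule ne)
        have "norm z * norm a \<le> 2 / (1 + norm a) * norm a"
          using that by (intro mult_right_mono) (auto simp: R''_def)
        also have "\<dots> < 1" using a by (auto simp: field_simps add_pos_nonneg)
        finally show "norm z * norm a < 1" .
      qed
      define B' where "B' z = ((z - a) / (1 - cnj a * z)) ^ n * B z" for z
      show ?thesis
      proof (rule exI[of _ B'], rule exI[of _ K], rule exI[of _ R''], intro conjI allI impI ballI)
        show "1 < R''" "R'' \<le> R" using R'' BK by auto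
        show "B' holomorphic_on ball 0 R''" unfolding B'_def using ne2 R''
          by (intro holomorphic_intros holomorphic_on_subset[OF BK(3)]) auto
        show "K holomorphic_on ball 0 R''" using R''
          by (intro holomorphic_on_subset[OF BK(4)]) auto
        show "norm (B' z) \<le> 1" if "norm z \<le> 1" for z
        proof -
          have "norm ((z - a) / (1 - cnj a * z)) \<le> 1"
            using cmod_blaschke_ineq(1)[OF that a(1)] ne1[OF that] by (simp add: norm_divide)
          then show ?thesis
            unfolding B'_def norm_mult norm_power
            using BK(5)[OF that] by (intro mult_le_one power_le_one) auto
        qed
        show "norm (B' z) = 1" if "norm z = 1" for z
          using cmod_blaschke_ineq(2)[OF _ a(1)] BK(6)[OF that] ne1[of z] that
          by (auto simp: B'_def norm_mult norm_power norm_divide)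
        show "K z \<noteq> 0" if "z \<in> ball 0 R''" for z using that R'' BK(7)[of z] by auto
        show "G z = B' z * K z" if "z \<in> ball 0 R''" for z
        proof -
          have "B z * K z = (1 - cnj a * z) ^ n * h z"
            using BK(8)[of z] that R'' by (auto simp: G'_def)
          then have "B' z * K z = ((z - a) / (1 - cnj a * z)) ^ n * ((1 - cnj a * z) ^ n * h z)"
            by (simp add: B'_def mult.assoc)
          also have "\<dots> = (z - a) ^ n * h z"
            using ne2[OF that] by (simp add: power_divide)
          finally show ?thesis using Gh by simp
        qed
      qed
    qed
  qed
qed

text \<open>A zero-free function on a disc has a logarithm, and exp (s L) is a holomorphic stand-in
  for the real power |G|^s: it has the same modulus on the circle and, as |B| <= 1, at least that
  modulus inside.\<close>

lemma blaschke_exp_factor: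
  assumes "G holomorphic_on ball 0 R" "R > 1" "\<And>z. norm z = 1 \<Longrightarrow> G z \<noteq> 0"
  obtains B L R' where "1 < R'" "R' \<le> R" "B holomorphic_on ball 0 R'" "L holomorphic_on ball 0 R'"
    "\<And>z. norm z \<le> 1 \<Longrightarrow> norm (B z) \<le> 1" "\<And>z. norm z = 1 \<Longrightarrow> norm (B z) = 1"
    "\<And>z. z \<in> ball 0 R' \<Longrightarrow> G z = B z * exp (L z)"
proof -
  obtain B K R' where BK: "1 < R'" "R' \<le> R" "B holomorphic_on ball 0 R'" "K holomorphic_on ball 0 R'"
    "\<forall>z. norm z \<le> 1 \<longrightarrow> norm (B z) \<le> 1" "\<forall>z. norm z = 1 \<longrightarrow> norm (B z) = 1"
    "\<forall>z\<in>ball 0 R'. K z \<noteq> 0" "\<forall>z\<in>ball 0 R'. G z = B z * K z"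
    using blaschke_factor[OF assms] by blast
  obtain L where L: "L holomorphic_on ball 0 R'" "\<And>z. z \<in> ball 0 R' \<Longrightarrow> K z = exp (L z)"
    using contractible_imp_holomorphic_log[OF BK(4)] BK(7)
    by (metis convex_ball convex_imp_contractible)
  show thesis
    by (rule that[of R' B L]) (use BK L in auto)
qed

lemma open_cball_imp_ball:
  assumes "open S" "cball (0::complex) 1 \<subseteq> S"
  obtains R where "R > 1" "ball 0 R \<subseteq> S"
proof -
  obtain e where e: "e > 0" "(\<Union>x\<in>cball 0 1. ball x e) \<subseteq> S"
    using compact_subset_open_imp_ball_epsilon_subset[OF compact_cball assms(1,2)] by blast
  show thesis
  proof
    show "1 + e > 1" using e by simp
    show "ball 0 (1 + e) \<subseteq> S"
    proof
      fix z :: complex assume z: "z \<in> ball 0 (1 + e)"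
      show "z \<in> S"
      proof (cases "norm z \<le> 1")
        case True then show ?thesis using assms by auto
      next
        case False
        define x where "x = z / of_real (norm z)"
        have "z - x = of_real (1 - 1 / norm z) * z"
          by (simp add: x_def algebra_simps)
        then have "norm (z - x) = \<bar>1 - 1 / norm z\<bar> * norm z"
          by (simp only: norm_mult norm_of_real)
        also have "\<dots> = norm z - 1"
          using False by (cases "z = 0") (auto simp: abs_if field_simps)
        finally have "norm (z - x) = norm z - 1" .
        moreover have "norm x = 1" using False by (auto simp: x_def norm_divide)
        ultimately have "x \<in> cball 0 1" "z \<in> ball x e" using z by (auto simp: dist_norm norm_minus_commute)
        then show ?thesis using e by blast
      qed
    qed
  qed
qed

lemma continuous_on_norm_powr [continuous_intros]:
  fixes f :: "'a::topological_space \<Rightarrow> 'b::real_normed_vector"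
  assumes "continuous_on S f" "0 < s"
  shows "continuous_on S (\<lambda>x. norm (f x) powr s)"
  by (intro continuous_on_powr' continuous_intros assms) (use assms in auto)

lemma powr_add_le:
  fixes a b p :: real
  assumes "0 \<le> a" "0 \<le> b" "0 < p" "p \<le> 1"
  shows "(a + b) powr p \<le> a powr p + b powr p"
proof (cases "a + b = 0")
  case True
  then show ?thesis using assms by auto
next
  case False
  define s where "s = a + b"
  have s: "s > 0" using False assms by (auto simp: s_def)
  have le: "x / s \<le> (x / s) powr p" if "0 \<le> x" "x \<le> s" for x
  proof (cases "x = 0")
    case False
    then have "(x / s) powr 1 \<le> (x / s) powr p"
      using that s assms by (intro powr_mono') auto
    then show ?thesis using that s by simp
  qed auto
  have "1 = a / s + b / s" using s by (simp add: s_def add_divide_distrib[symmetric])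
  also have "\<dots> \<le> (a / s) powr p + (b / s) powr p"
    using assms by (intro add_mono le) (auto simp: s_def)
  also have "\<dots> = (a powr p + b powr p) / s powr p"
    using assms s by (simp add: powr_divide add_divide_distrib)
  finally show ?thesis using s by (simp add: field_simps s_def)
qed

lemma norm_add_powr_le:
  fixes a b :: "'a::real_normed_vector"
  assumes "0 < p" "p \<le> 1"
  shows "norm (a + b) powr p \<le> norm a powr p + norm b powr p"
proof -
  have "norm (a + b) powr p \<le> (norm a + norm b) powr p"
    using assms by (intro powr_mono2 norm_triangle_ineq) auto
  also have "\<dots> \<le> norm a powr p + norm b powr p"
    using assms by (intro powr_add_le) auto
  finally show ?thesis .
qed

lemma eventually_at_left_1: "\<forall>\<^sub>F r in at_left (1::real). 0 < r \<and> r < 1"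
  by (auto simp: eventually_at_left_field intro: exI[of _ 0])

text \<open>Zeros on the unit circle would spoil the factorisation. Only finitely many zeros lie in
  the closed disc, so all circles slightly inside avoid them, and estimates proved there pass to the
  limit.\<close>

lemma eventually_sphere_nonzero:
  assumes G: "G holomorphic_on ball 0 R" "R > 1" and "\<exists>z\<in>ball 0 R. G z \<noteq> 0"
  shows "\<forall>\<^sub>F r in at_left 1. \<forall>z. norm z = r \<longrightarrow> G z \<noteq> 0"
proof -
  define Z where "Z = {z \<in> cball 0 1. G z = 0}"
  have "finite Z"
  proof (cases "G constant_on ball 0 R")
    case True
    then have "Z = {}" using assms by (force simp: constant_on_def Z_def)
    then show ?thesis by simp
  next
    case False
    then show ?thesis unfolding Z_def
      by (intro holomorphic_compact_finite_zeros[OF G(1)]) (use G(2) in auto)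
  qed
  moreover have "\<forall>z\<in>Z. \<forall>\<^sub>F r in at_left 1. r \<noteq> norm z"
  proof
    fix z assume that: "z \<in> Z"
    have "norm z \<le> 1" using that by (simp add: Z_def)
    then consider "norm z < 1" | "norm z = 1" by linarith
    then show "\<forall>\<^sub>F r in at_left 1. r \<noteq> norm z"
    proof cases
      case 1 then show ?thesis by (auto simp: eventually_at_left_field)
    next
      case 2 then show ?thesis by (auto simp: eventually_at_left_field intro: exI[of _ 0])
    qed
  qed
  ultimately have "\<forall>\<^sub>F r in at_left 1. \<forall>z\<in>Z. r \<noteq> norm z"
    by (rule eventually_ball_finite)
  moreover note eventually_at_left_1
  ultimately show ?thesis
  proof eventually_elim
    case (elim r)
    show ?case
    proof (intro allI impI notI)
      fix z assume "norm z = r" "G z = 0"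
      with elim have "z \<in> Z" by (simp add: Z_def)
      with elim \<open>norm z = r\<close> show False by auto
    qed
  qed
qed

lemma cmean_dilate_tendsto:
  fixes \<Psi> :: "complex \<Rightarrow> real"
  assumes G: "continuous_on (cball 0 1) G" and \<Psi>: "continuous_on UNIV \<Psi>"
  shows "((\<lambda>r. cmean (\<lambda>\<zeta>. \<Psi> (G (of_real r * \<zeta>)))) \<longlongrightarrow> cmean (\<lambda>\<zeta>. \<Psi> (G \<zeta>))) (at_left 1)"
proof -
  have "continuous_on ({0..1} \<times> sphere 0 1) (\<lambda>x. \<Psi> (G (of_real (fst x) * snd x)))"
    by (rule continuous_on_compose2[OF \<Psi>], rule continuous_on_compose2[OF G])
       (auto intro!: continuous_intros simp: norm_mult mult_le_one)
  then have "continuous_on {0..1} (\<lambda>r. cmean (\<lambda>\<zeta>. \<Psi> (G (of_real r * \<zeta>))))"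
    by (intro continuous_on_cmean) (simp add: case_prod_unfold)
  then show ?thesis
    by (drule_tac continuous_on_Icc_at_leftD) auto
qed

lemma exp_powr_norm: "norm (exp (L::complex)) powr s = norm (exp (of_real s * L))"
  by (simp add: norm_exp_eq_Re powr_def)

text \<open>With \<open>G = B exp L\<close>, this is the Cauchy formula for \<open>exp (s L)\<close>.\<close>

lemma cmod_powr_growth:
  assumes G: "G holomorphic_on S" "open S" "cball 0 1 \<subseteq> S" and s: "0 < s" and z: "norm z < 1"
  shows "norm (G z) powr s * (1 - norm z) \<le> cmean (\<lambda>\<zeta>. norm (G \<zeta>) powr s)"
proof -
  obtain R where R: "R > 1" "ball 0 R \<subseteq> S" using open_cball_imp_ball[OF G(2,3)] by auto
  have GR: "G holomorphic_on ball 0 R" by (rule holomorphic_on_subset[OF G(1) R(2)])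
  have nz: "norm (G z) powr s * (1 - norm z) \<le> cmean (\<lambda>\<zeta>. norm (G \<zeta>) powr s)"
    if G: "G holomorphic_on ball 0 R" "\<And>z. norm z = 1 \<Longrightarrow> G z \<noteq> 0" for G
  proof -
    obtain B L R' where BL: "1 < R'" "R' \<le> R" "B holomorphic_on ball 0 R'" "L holomorphic_on ball 0 R'"
      "\<And>z. norm z \<le> 1 \<Longrightarrow> norm (B z) \<le> 1" "\<And>z. norm z = 1 \<Longrightarrow> norm (B z) = 1"
      "\<And>z. z \<in> ball 0 R' \<Longrightarrow> G z = B z * exp (L z)"
      by (rule blaschke_exp_factor[OF G(1) R(1) G(2)]) (assumption, rule that)
    define F where "F w = exp (of_real s * L w)" for w
    have F: "F holomorphic_on ball 0 R'" unfolding F_def using BL by (intro holomorphic_intros)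
    have cF: "continuous_on (sphere 0 1) F"
      using F BL(1) by (intro holomorphic_on_imp_continuous_on holomorphic_on_subset[OF F]) auto
    have ne: "1 - z * cnj \<zeta> \<noteq> 0" "1 - norm z \<le> norm (1 - z * cnj \<zeta>)" if "norm \<zeta> = 1" for \<zeta>
    proof -
      show "1 - norm z \<le> norm (1 - z * cnj \<zeta>)"
        using norm_triangle_ineq2[of 1 "z * cnj \<zeta>"] that by (simp add: norm_mult)
      then show "1 - z * cnj \<zeta> \<noteq> 0" using z by auto
    qed
    have c2: "continuous_on (sphere 0 1) (\<lambda>\<zeta>. F \<zeta> / (1 - z * cnj \<zeta>))"
      using ne by (intro continuous_intros cF) auto
    have "norm (G z) powr s \<le> norm (F z)"
    proof -
      have "norm (G z) \<le> norm (exp (L z))"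
        using BL(7)[of z] BL(5)[of z] BL(1) z by (simp add: norm_mult mult_left_le_one_le)
      then show ?thesis
        unfolding F_def exp_powr_norm[symmetric] using s by (intro powr_mono2) auto
    qed
    also have "norm (F z) = norm (cmean (\<lambda>\<zeta>. F \<zeta> / (1 - z * cnj \<zeta>)))"
      using cmean_Cauchy[OF F BL(1) z] by simp
    also have "\<dots> \<le> cmean (\<lambda>\<zeta>. norm (F \<zeta> / (1 - z * cnj \<zeta>)))"
      by (rule norm_cmean_le[OF c2])
    also have "\<dots> \<le> cmean (\<lambda>\<zeta>. (1 / (1 - norm z)) * norm (F \<zeta>))"
    proof (rule cmean_mono)
      fix \<zeta> :: complex assume "norm \<zeta> = 1"
      then show "norm (F \<zeta> / (1 - z * cnj \<zeta>)) \<le> (1 / (1 - norm z)) * norm (F \<zeta>)"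
        using ne[of \<zeta>] z by (auto simp: norm_divide intro!: divide_left_mono mult_pos_pos)
    qed (intro continuous_intros c2 cF)+
    also have "\<dots> = (1 / (1 - norm z)) * cmean (\<lambda>\<zeta>. norm (F \<zeta>))"
      by (rule cmean_mult_left)
    also have "cmean (\<lambda>\<zeta>. norm (F \<zeta>)) = cmean (\<lambda>\<zeta>. norm (G \<zeta>) powr s)"
      using BL by (intro cmean_cong) (auto simp del: norm_exp_eq_Re simp: F_def exp_powr_norm[symmetric] norm_mult)
    finally show ?thesis using z by (simp add: field_simps)
  qed
  show ?thesis
  proof (cases "\<exists>z\<in>ball 0 R. G z \<noteq> 0")
    case False
    then have "cmean (\<lambda>\<zeta>. norm (G \<zeta>) powr s) = cmean (\<lambda>_. 0::real)"
      using R by (intro cmean_cong) auto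
    moreover have "G z = 0" using False z R(1) by auto
    ultimately show ?thesis by simp
  next
    case True
    have cG: "continuous_on (cball 0 1) G"
      using G by (auto intro: holomorphic_on_imp_continuous_on holomorphic_on_subset)
    have lim: "((\<lambda>r. cmean (\<lambda>\<zeta>. norm (G (of_real r * \<zeta>)) powr s)) \<longlongrightarrow> cmean (\<lambda>\<zeta>. norm (G \<zeta>) powr s)) (at_left 1)"
      by (rule cmean_dilate_tendsto[OF cG]) (use s in \<open>intro continuous_intros\<close>)
    have "isCont G z"
    proof -
      have "z \<in> S" using G(3) z by auto
      then show ?thesis
        using holomorphic_on_imp_continuous_on[OF G(1)] continuous_on_eq_continuous_at[OF G(2), of G] by blast
    qed
    then have "((\<lambda>r. G (of_real r * z)) \<longlongrightarrow> G z) (at_left 1)"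
      by (intro isCont_tendsto_compose[of z G]) (auto intro!: tendsto_eq_intros)
    then have lim2: "((\<lambda>r. norm (G (of_real r * z)) powr s * (1 - norm z)) \<longlongrightarrow> norm (G z) powr s * (1 - norm z)) (at_left 1)"
      using s by (intro tendsto_intros tendsto_powr') auto
    have ev: "\<forall>\<^sub>F r in at_left 1. norm (G (of_real r * z)) powr s * (1 - norm z) \<le> cmean (\<lambda>\<zeta>. norm (G (of_real r * \<zeta>)) powr s)"
      using eventually_sphere_nonzero[OF GR R(1) True]
        eventually_at_left_1
    proof eventually_elim
      case (elim r)
      show ?case
      proof (rule nz)
        show "(\<lambda>\<zeta>. G (of_real r * \<zeta>)) holomorphic_on ball 0 R"
        proof (rule holomorphic_on_compose_gen[OF _ GR, unfolded o_def])
          have "r * norm w < R" if "norm w < R" for w :: complex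
            using that elim by (meson le_less_trans mult_left_le_one_le norm_ge_zero less_imp_le)
          then show "(*) (complex_of_real r) ` ball 0 R \<subseteq> ball 0 R"
            using elim by (auto simp: norm_mult)
        qed (intro holomorphic_intros)
        show "G (of_real r * w) \<noteq> 0" if "norm w = 1" for w
          using elim that by (auto simp: norm_mult)
      qed
    qed
    show ?thesis
      by (rule tendsto_le[OF _ lim lim2 ev]) simp
  qed
qed

section \<open>Elementary inequalities for uniform convexity\<close>

lemma bernoulli_powr:
  fixes y a :: real
  assumes "0 \<le> y" "1 \<le> a"
  shows "1 + a * (y - 1) \<le> y powr a"
proof (cases "y = 0")
  case False
  \<comment> \<open>The weighted arithmetic-geometric mean inequality for y^a and 1 with weights 1/a
    and 1 - 1/a.\<close>
  have "(y powr a) powr (1/a) * 1 powr (1 - 1/a) \<le> (1/a) * (y powr a) + (1 - 1/a) * 1"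
    using assms False by (intro Youngs_inequality_0) auto
  then have "y \<le> (1/a) * (y powr a) + (1 - 1/a)"
    using assms False by (simp add: powr_powr)
  then have "a * y \<le> a * ((1/a) * (y powr a) + (1 - 1/a))"
    using assms by (intro mult_left_mono) auto
  then show ?thesis using assms by (simp add: algebra_simps)
qed (use assms in auto)

text \<open>The bracket keeps its linear term because that term has circle mean 0 for holomorphic
  \<open>v\<close> with v 0 = 0. The bracket dominates |v|^2, which controls everything away from v
  = 0; near 0 the left side is below \<eta> by continuity.\<close>

lemma power_deviation_bound:
  fixes k :: nat and p \<eta> :: real
  assumes p: "0 < p" "p \<le> 1" and k: "2 \<le> real k * p" and "0 < \<eta>"
  shows "\<exists>C\<ge>0. \<forall>v::complex. norm ((1 + v) ^ k - 1) powr p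
     \<le> \<eta> + C * (norm (1 + v) powr (real k * p) - 1 - real k * p * Re v)"
proof -
  define q where "q = real k * p"
  have "continuous_on UNIV (\<lambda>v::complex. norm ((1 + v) ^ k - 1) powr p)"
    using p by (intro continuous_intros)
  then have "isCont (\<lambda>v::complex. norm ((1 + v) ^ k - 1) powr p) 0"
    by (simp add: continuous_on_eq_continuous_at)
  then obtain d0 where d0: "d0 > 0" "\<And>v::complex. norm v < d0 \<Longrightarrow> norm ((1 + v) ^ k - 1) powr p < \<eta>"
    using assms unfolding continuous_at_eps_delta by (force simp: dist_norm)
  define d where "d = min d0 1"
  have d: "0 < d" "d \<le> 1" "\<And>v::complex. norm v < d \<Longrightarrow> norm ((1 + v) ^ k - 1) powr p < \<eta>"
    using d0 by (auto simp: d_def)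
  \<comment> \<open>Where |v| >= d, the left side is at most D + 2 + q Re v with \<open>D\<close>
    the bracket, and both 1 <= D / d^2 and |v| <= D / d.\<close>
  define C where "C = 1 + 2 / d\<^sup>2 + q / d"
  have q: "2 \<le> q" using k by (simp add: q_def)
  have C: "C \<ge> 0" using d q by (auto simp: C_def)
  have main: "norm ((1 + v) ^ k - 1) powr p \<le> \<eta> + C * (norm (1 + v) powr q - 1 - q * Re v)" for v :: complex
  proof -
    define D where "D = norm (1 + v) powr q - 1 - q * Re v"
    \<comment> \<open>Bernoulli with exponent q / 2 >= 1 for |1 + v|^2 = 1 + 2 Re v + |v|^2.\<close>
    have "1 + (q / 2) * ((norm (1 + v))\<^sup>2 - 1) \<le> ((norm (1 + v))\<^sup>2) powr (q / 2)"
      using q by (intro bernoulli_powr) auto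
    also have "((norm (1 + v))\<^sup>2) powr (q / 2) = norm (1 + v) powr q"
      by (simp add: powr_powr flip: powr_numeral)
    also have "(norm (1 + v))\<^sup>2 = 1 + 2 * Re v + (norm v)\<^sup>2"
      unfolding cmod_power2 by (simp add: power2_eq_square algebra_simps)
    finally have "(q / 2) * (norm v)\<^sup>2 \<le> D"
      by (simp add: D_def algebra_simps)
    moreover have "1 * (norm v)\<^sup>2 \<le> (q / 2) * (norm v)\<^sup>2"
      using q by (intro mult_right_mono) auto
    ultimately have Dv: "(norm v)\<^sup>2 \<le> D" by simp
    then have D0: "0 \<le> D" by (meson order_trans zero_le_power2)
    show ?thesis
    proof (cases "norm v < d")
      case True
      then show ?thesis using d(3)[OF True] C D0 by (simp add: D_def[symmetric] add_increasing2 less_imp_le)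
    next
      case False
      then have dv: "d \<le> norm v" by simp
      have "norm ((1 + v) ^ k - 1) powr p \<le> norm ((1 + v) ^ k) powr p + norm (- 1 :: complex) powr p"
        using norm_add_powr_le[OF p, of "(1 + v) ^ k" "- 1"] by simp
      also have "norm ((1 + v) ^ k) powr p = norm (1 + v) powr q"
        by (cases "1 + v = 0") (use k p in \<open>auto simp: norm_power powr_realpow[symmetric] powr_powr q_def intro: gr0I\<close>)
      finally have "norm ((1 + v) ^ k - 1) powr p \<le> D + 2 + q * Re v"
        by (simp add: D_def)
      also have "q * Re v \<le> q * norm v"
        using q by (intro mult_left_mono complex_Re_le_cmod) auto
      also have "norm v \<le> (norm v)\<^sup>2 / d"
        using d dv by (simp add: field_simps power2_eq_square mult_right_mono)
      also have "(norm v)\<^sup>2 / d \<le> D / d" using Dv d by (intro divide_right_mono) auto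
      also have "2 \<le> 2 * D / d\<^sup>2"
      proof -
        have "d\<^sup>2 \<le> (norm v)\<^sup>2" using dv d by (intro power_mono) auto
        then have "d\<^sup>2 \<le> D" using Dv by linarith
        then show ?thesis using d by (simp add: field_simps)
      qed
      finally have "norm ((1 + v) ^ k - 1) powr p \<le> D + 2 * D / d\<^sup>2 + q * (D / d)"
        using q by (simp add: mult_left_mono)
      also have "\<dots> = C * D" by (simp add: C_def algebra_simps)
      finally show ?thesis using assms by (simp add: D_def)
    qed
  qed
  show ?thesis using C main by (auto simp: q_def)
qed

lemma cmean_Re:
  assumes "continuous_on (sphere 0 1) F"
  shows "cmean (\<lambda>z. Re (F z)) = Re (cmean F)"
  using integral_linear[OF integrable_cis_comp[OF assms, of 0 "2*pi"] bounded_linear_Re]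
  by (simp add: cmean_def o_def)

section \<open>Uniform PL-convexity\<close>

text \<open>For exponent 2, orthogonality gives the exact value 1 - |B 0|^2 for the mean of |B - B
  0|^2. The exponent p is reduced to 2 by t^p <= \<eta> + c t^2, and 1 - s^2 <= (2 / p) (1 - s^p)
  leads back to p-th powers.\<close>

lemma blaschke_deviation_bound:
  fixes p \<eta> :: real
  assumes p: "0 < p" "p \<le> 1" and \<eta>: "0 < \<eta>"
  shows "\<exists>C\<ge>0. \<forall>B R. B holomorphic_on ball 0 R \<longrightarrow> 1 < R \<longrightarrow> (\<forall>z. norm z = 1 \<longrightarrow> norm (B z) = 1) \<longrightarrow>
     norm (B 0) \<le> 1 \<longrightarrow> cmean (\<lambda>z. norm (B z - B 0) powr p) \<le> \<eta> + C * (1 - norm (B 0) powr p)"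
proof -
  \<comment> \<open>Below \<delta> the power t^p is at most \<eta>; above it t^(p - 2) is at most
    \<open>c\<close>.\<close>
  define \<delta> where "\<delta> = \<eta> powr (1 / p)"
  have \<delta>: "\<delta> > 0" "\<delta> powr p = \<eta>" using \<eta> p by (auto simp: \<delta>_def powr_powr)
  define c where "c = \<delta> powr (p - 2)"
  have pt: "t powr p \<le> \<eta> + c * t\<^sup>2" if "0 \<le> t" for t
  proof (cases "t \<le> \<delta>")
    case True
    then have "t powr p \<le> \<eta>" using \<delta>(2) powr_mono2[of p t \<delta>] p that by auto
    then show ?thesis by (auto simp: c_def intro: add_increasing2)
  next
    case False
    then have t: "t > 0" using \<delta> by auto
    have "t powr p = t powr (p - 2) * t\<^sup>2"
      using t by (simp add: powr_diff)
    also have "t powr (p - 2) \<le> c" unfolding c_def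
      using False \<delta> p by (intro powr_mono2') auto
    finally show ?thesis using \<eta> by (simp add: mult_right_mono add_increasing)
  qed
  have main: "cmean (\<lambda>z. norm (B z - B 0) powr p) \<le> \<eta> + (c * (2 / p)) * (1 - norm (B 0) powr p)"
    if B: "B holomorphic_on ball 0 R" "1 < R" "\<And>z. norm z = 1 \<Longrightarrow> norm (B z) = 1" "norm (B 0) \<le> 1" for B R
  proof -
    have cB: "continuous_on (sphere 0 1) B"
      using B by (intro holomorphic_on_imp_continuous_on holomorphic_on_subset[OF B(1)]) auto
    have "cmean (\<lambda>z. norm (B z - B 0) powr p) \<le> cmean (\<lambda>z. \<eta> + c * (norm (B z - B 0))\<^sup>2)"
      using p by (intro cmean_mono continuous_intros cB pt) auto
    also have "\<dots> = cmean (\<lambda>z. \<eta> + c * (1 + (norm (B 0))\<^sup>2 - 2 * Re (cnj (B 0) * B z)))"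
    proof (rule cmean_cong)
      fix z :: complex assume "norm z = 1"
      then have "(norm (B z))\<^sup>2 = 1" using B(3) by simp
      moreover have "(norm (B z - B 0))\<^sup>2 = (norm (B z))\<^sup>2 + (norm (B 0))\<^sup>2 - 2 * Re (cnj (B 0) * B z)"
        unfolding cmod_power2 by (simp add: power2_eq_square algebra_simps)
      ultimately show "\<eta> + c * (norm (B z - B 0))\<^sup>2 = \<eta> + c * (1 + (norm (B 0))\<^sup>2 - 2 * Re (cnj (B 0) * B z))" by simp
    qed
    also have "\<dots> = \<eta> + c * (1 + (norm (B 0))\<^sup>2 - 2 * cmean (\<lambda>z. Re (cnj (B 0) * B z)))"
      by (subst cmean_add cmean_diff cmean_mult_left | intro continuous_intros cB | simp)+
    also have "cmean (\<lambda>z. Re (cnj (B 0) * B z)) = Re (cnj (B 0) * B 0)"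
      by (subst cmean_Re) (auto intro!: continuous_intros cB simp: cmean_mult_left cmean_holomorphic[OF B(1,2)])
    also have "Re (cnj (B 0) * B 0) = (norm (B 0))\<^sup>2"
      unfolding cmod_power2 by (simp add: power2_eq_square)
    also have "\<eta> + c * (1 + (norm (B 0))\<^sup>2 - 2 * (norm (B 0))\<^sup>2) = \<eta> + c * (1 - (norm (B 0))\<^sup>2)"
      by (simp add: algebra_simps)
    also have "1 - (norm (B 0))\<^sup>2 \<le> (2 / p) * (1 - norm (B 0) powr p)"
    proof -
      have "1 + (2 / p) * (norm (B 0) powr p - 1) \<le> (norm (B 0) powr p) powr (2 / p)"
        using p by (intro bernoulli_powr) auto
      also have "\<dots> = (norm (B 0))\<^sup>2"
        using p by (cases "B 0 = 0") (auto simp: powr_powr)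
      finally show ?thesis by (simp add: algebra_simps)
    qed
    finally show ?thesis by (simp add: c_def mult_left_mono mult.assoc)
  qed
  show ?thesis using main p by (intro exI[of _ "c * (2 / p)"]) (auto simp: c_def)
qed

text \<open>
  A quantitative form of the uniform PL-convexity of \<open>L_p\<close>: if the circle mean of
  \<open>|G|^p\<close> barely exceeds \<open>|G 0|^p\<close>, then \<open>G\<close> is nearly constant. For zero-free \<open>G\<close>, write
  \<open>G = H^k\<close> with \<open>k p \<ge> 2\<close> and use that \<open>|1 + v|^(k p) - 1 - k p Re v \<ge> |v|^2\<close>.
\<close>

lemma cmean_deviation_bound:
  fixes p \<eta> :: real
  assumes p: "0 < p" "p \<le> 1" and \<eta>: "0 < \<eta>"
  shows "\<exists>C\<ge>0. \<forall>G S. G holomorphic_on S \<longrightarrow> open S \<longrightarrow> cball 0 1 \<subseteq> S \<longrightarrow>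
     cmean (\<lambda>z. norm (G z - G 0) powr p) \<le> \<eta> * cmean (\<lambda>z. norm (G z) powr p)
       + C * (cmean (\<lambda>z. norm (G z) powr p) - norm (G 0) powr p)"
proof -
  obtain k :: nat where "real k > 2 / p" using reals_Archimedean2 by blast
  then have k: "2 \<le> real k * p" "k > 0" using p by (auto simp: field_simps intro: gr0I)
  define q where "q = real k * p"
  obtain C1 where C1: "C1 \<ge> 0" "\<And>v::complex. norm ((1 + v) ^ k - 1) powr p
     \<le> \<eta> / 2 + C1 * (norm (1 + v) powr q - 1 - q * Re v)"
    using power_deviation_bound[OF p k(1), of "\<eta> / 2"] \<eta> unfolding q_def by auto
  obtain C2 where C2: "C2 \<ge> 0" "\<And>B R. B holomorphic_on ball 0 R \<Longrightarrow> 1 < R \<Longrightarrow> (\<And>z. norm z = 1 \<Longrightarrow> norm (B z) = 1) \<Longrightarrow>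
     norm (B 0) \<le> 1 \<Longrightarrow> cmean (\<lambda>z. norm (B z - B 0) powr p) \<le> \<eta> / 2 + C2 * (1 - norm (B 0) powr p)"
    using blaschke_deviation_bound[OF p, of "\<eta> / 2"] \<eta> by auto
  define C where "C = max C1 C2"
  have nz: "cmean (\<lambda>z. norm (G z - G 0) powr p) \<le> \<eta> * cmean (\<lambda>z. norm (G z) powr p)
       + C * (cmean (\<lambda>z. norm (G z) powr p) - norm (G 0) powr p)"
    if R: "1 < R" and G: "G holomorphic_on ball 0 R" "\<And>z. norm z = 1 \<Longrightarrow> G z \<noteq> 0" for G R
  proof -
    obtain B L R' where BL: "1 < R'" "R' \<le> R" "B holomorphic_on ball 0 R'" "L holomorphic_on ball 0 R'"
      "\<And>z. norm z \<le> 1 \<Longrightarrow> norm (B z) \<le> 1" "\<And>z. norm z = 1 \<Longrightarrow> norm (B z) = 1"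
      "\<And>z. z \<in> ball 0 R' \<Longrightarrow> G z = B z * exp (L z)"
      by (rule blaschke_exp_factor[OF G(1) R G(2)]) (assumption, rule that)
    define K where "K z = exp (L z)" for z
    \<comment> \<open>\<open>1 + v\<close> is the k-th root of K / K 0 provided by the logarithm
      \<open>L\<close>, so v 0 = 0.\<close>
    define v where "v z = exp ((L z - L 0) / of_nat k) - 1" for z
    have hol: "K holomorphic_on ball 0 R'" "v holomorphic_on ball 0 R'"
      unfolding K_def v_def using BL k by (auto intro!: holomorphic_intros)
    have cont: "continuous_on (sphere 0 1) F" if "F holomorphic_on ball 0 R'" for F
      using BL by (intro holomorphic_on_imp_continuous_on holomorphic_on_subset[OF that]) auto
    note c [continuous_intros] = cont[OF hol(1)] cont[OF hol(2)] cont[OF BL(3)]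
    have Kv: "K z = K 0 * (1 + v z) ^ k" for z
      using k by (simp add: K_def v_def exp_of_nat_mult[symmetric] exp_add[symmetric])
    have nKv: "norm (K z) powr p = norm (K 0) powr p * norm (1 + v z) powr q" for z
    proof -
      have "norm ((1 + v z) ^ k) powr p = norm (1 + v z) powr q"
        by (simp add: v_def norm_power powr_realpow[symmetric] powr_powr q_def)
      then show ?thesis by (subst Kv) (simp add: norm_mult powr_mult)
    qed
    define a where "a = cmean (\<lambda>z. norm (K z) powr p)"
    define k0 where "k0 = norm (K 0) powr p"
    define b0 where "b0 = norm (B 0) powr p"
    have aG: "a = cmean (\<lambda>z. norm (G z) powr p)"
      unfolding a_def using BL by (intro cmean_cong) (auto simp: K_def norm_mult)
    have G0: "norm (G 0) powr p = b0 * k0"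
      using BL by (auto simp: b0_def k0_def K_def norm_mult powr_mult)
    have k0a: "k0 \<le> a"
      using cmod_powr_growth[OF hol(1) open_ball _ p(1), of 0] BL(1)
      by (simp add: k0_def a_def cball_subset_ball_iff)
    have b0: "b0 \<le> 1" "0 \<le> b0" "0 \<le> k0" using BL(5)[of 0] p by (auto simp: b0_def k0_def intro: powr_le1)
    have devK: "cmean (\<lambda>z. norm (K z - K 0) powr p) \<le> \<eta> / 2 * k0 + C1 * (a - k0)"
    proof -
      have "cmean (\<lambda>z. norm (K z - K 0) powr p) = cmean (\<lambda>z. k0 * norm ((1 + v z) ^ k - 1) powr p)"
      proof (rule cmean_cong)
        fix z
        have "K z - K 0 = K 0 * ((1 + v z) ^ k - 1)" by (subst Kv) (simp add: algebra_simps)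
        then show "norm (K z - K 0) powr p = k0 * norm ((1 + v z) ^ k - 1) powr p"
          by (simp add: norm_mult powr_mult k0_def)
      qed
      also have "\<dots> \<le> cmean (\<lambda>z. k0 * (\<eta> / 2 + C1 * (norm (1 + v z) powr q - 1 - q * Re (v z))))"
        using p k by (intro cmean_mono continuous_intros mult_left_mono C1) (auto simp: q_def k0_def)
      also have "\<dots> = cmean (\<lambda>z. (\<eta> / 2 * k0 - C1 * k0) + C1 * norm (K z) powr p - C1 * k0 * q * Re (v z))"
        by (rule cmean_cong, subst nKv) (simp add: k0_def[symmetric] algebra_simps)
      also have "\<dots> = \<eta> / 2 * k0 - C1 * k0 + C1 * a - C1 * k0 * q * cmean (\<lambda>z. Re (v z))"
      proof -
        have 1: "continuous_on (sphere 0 1) (\<lambda>z. norm (K z) powr p)"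
          using p by (intro continuous_intros)
        have 2: "continuous_on (sphere 0 1) (\<lambda>z. \<eta> / 2 * k0 - C1 * k0 + C1 * norm (K z) powr p)"
          "continuous_on (sphere 0 1) (\<lambda>z. C1 * norm (K z) powr p)"
          "continuous_on (sphere 0 1) (\<lambda>z. C1 * k0 * q * Re (v z))"
          using 1 by (auto intro!: continuous_intros)
        show ?thesis
          unfolding cmean_diff[OF 2(1,3)] cmean_add[OF continuous_on_const 2(2)] cmean_mult_left a_def
          by simp
      qed
      also have "cmean (\<lambda>z. Re (v z)) = 0"
        by (subst cmean_Re[OF c(2)]) (simp add: cmean_holomorphic[OF hol(2) BL(1)] v_def)
      finally show ?thesis by (simp add: algebra_simps)
    qed
    have "cmean (\<lambda>z. norm (G z - G 0) powr p)
        \<le> cmean (\<lambda>z. norm (K z - K 0) powr p + k0 * norm (B z - B 0) powr p)"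
    proof (rule cmean_mono)
      show "continuous_on (sphere 0 1) (\<lambda>z. norm (G z - G 0) powr p)"
        using p R G(1) by (intro continuous_intros holomorphic_on_imp_continuous_on) (auto intro: holomorphic_on_subset)
      show "continuous_on (sphere 0 1) (\<lambda>z. norm (K z - K 0) powr p + k0 * norm (B z - B 0) powr p)"
        using p by (intro continuous_intros)
      fix z :: complex assume z: "norm z = 1"
      have "G z = B z * K z" "G 0 = B 0 * K 0" using BL(1) BL(7)[of z] BL(7)[of 0] z by (auto simp: K_def)
      \<comment> \<open>The zero-free factor and the Blaschke factor are treated separately; as |B|
        = 1 on the circle, the first term has exactly the modulus of the deviation of
        \<open>K\<close>.\<close>
      then have "G z - G 0 = B z * (K z - K 0) + K 0 * (B z - B 0)"
        by (simp add: algebra_simps)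
      also have "norm \<dots> powr p \<le> norm (B z * (K z - K 0)) powr p + norm (K 0 * (B z - B 0)) powr p"
        by (rule norm_add_powr_le[OF p])
      also have "\<dots> = norm (K z - K 0) powr p + k0 * norm (B z - B 0) powr p"
        using BL(6)[OF z] by (simp add: norm_mult powr_mult k0_def)
      finally show "norm (G z - G 0) powr p \<le> norm (K z - K 0) powr p + k0 * norm (B z - B 0) powr p" .
    qed
    also have "\<dots> = cmean (\<lambda>z. norm (K z - K 0) powr p) + k0 * cmean (\<lambda>z. norm (B z - B 0) powr p)"
      using p by (subst cmean_add) (auto intro!: continuous_intros simp: cmean_mult_left)
    also have "\<dots> \<le> (\<eta> / 2 * k0 + C1 * (a - k0)) + k0 * (\<eta> / 2 + C2 * (1 - b0))"
      unfolding b0_def using BL b0 by (intro add_mono devK mult_left_mono C2(2)[of B R']) auto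
    also have "\<dots> = \<eta> * k0 + (C1 * (a - k0) + C2 * (k0 * (1 - b0)))"
      by (simp add: algebra_simps)
    \<comment> \<open>With a common constant the two deficits telescope: (a - k0) + k0 (1 - b0) = a
      - b0 k0, the excess of the mean over the value at the centre.\<close>
    also have "\<dots> \<le> \<eta> * a + (C * (a - k0) + C * (k0 * (1 - b0)))"
      using \<eta> k0a b0 by (intro add_mono mult_left_mono mult_right_mono) (auto simp: C_def)
    also have "\<dots> = \<eta> * a + C * (a - b0 * k0)" by (simp add: algebra_simps)
    finally show ?thesis unfolding aG G0 .
  qed
  have C0: "C \<ge> 0" using C1 by (simp add: C_def)
  have main: "cmean (\<lambda>z. norm (G z - G 0) powr p) \<le> \<eta> * cmean (\<lambda>z. norm (G z) powr p)
       + C * (cmean (\<lambda>z. norm (G z) powr p) - norm (G 0) powr p)"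
    if G: "G holomorphic_on S" "open S" "cball 0 1 \<subseteq> S" for G S
  proof -
    obtain R where R: "R > 1" "ball 0 R \<subseteq> S" using open_cball_imp_ball[OF G(2,3)] by auto
    have GR: "G holomorphic_on ball 0 R" by (rule holomorphic_on_subset[OF G(1) R(2)])
    show ?thesis
    proof (cases "\<exists>z\<in>ball 0 R. G z \<noteq> 0")
      case False
      then have "G z = 0" if "norm z \<le> 1" for z using R that by auto
      then have "cmean (\<lambda>z. norm (G z - G 0) powr p) = 0"
        "cmean (\<lambda>z. norm (G z) powr p) = 0" "G 0 = 0"
        by (auto intro!: cmean_eq_0)
      then show ?thesis by simp
    next
      case True
      have cG: "continuous_on (cball 0 1) G"
        using G by (auto intro: holomorphic_on_imp_continuous_on holomorphic_on_subset)
      define l where "l r = cmean (\<lambda>z. norm (G (of_real r * z) - G 0) powr p)" for r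
      define m where "m r = cmean (\<lambda>z. norm (G (of_real r * z)) powr p)" for r
      have lim: "(l \<longlongrightarrow> cmean (\<lambda>z. norm (G z - G 0) powr p)) (at_left 1)"
        unfolding l_def by (rule cmean_dilate_tendsto[OF cG]) (use p in \<open>intro continuous_intros\<close>)
      have lim2: "(m \<longlongrightarrow> cmean (\<lambda>z. norm (G z) powr p)) (at_left 1)"
        unfolding m_def by (rule cmean_dilate_tendsto[OF cG]) (use p in \<open>intro continuous_intros\<close>)
      have lim3: "((\<lambda>r. \<eta> * m r + C * (m r - norm (G 0) powr p)) \<longlongrightarrow>
          \<eta> * cmean (\<lambda>z. norm (G z) powr p) + C * (cmean (\<lambda>z. norm (G z) powr p) - norm (G 0) powr p)) (at_left 1)"
        by (intro tendsto_intros lim2)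
      have ev: "\<forall>\<^sub>F r in at_left 1. l r \<le> \<eta> * m r + C * (m r - norm (G 0) powr p)"
        using eventually_sphere_nonzero[OF GR R(1) True] eventually_at_left_1
      proof eventually_elim
        case (elim r)
        have r: "0 < r" "r < 1" using elim by auto
        have "(\<lambda>\<zeta>. G (of_real r * \<zeta>)) holomorphic_on ball 0 R"
        proof (rule holomorphic_on_compose_gen[OF _ GR, unfolded o_def])
          have "r * norm w < R" if "norm w < R" for w :: complex
            using that r by (meson le_less_trans mult_left_le_one_le norm_ge_zero less_imp_le)
          then show "(*) (complex_of_real r) ` ball 0 R \<subseteq> ball 0 R"
            using r by (auto simp: norm_mult)
        qed (intro holomorphic_intros)
        from nz[OF R(1) this] show ?case
          using elim r by (auto simp: l_def m_def norm_mult)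
      qed
      show ?thesis
        by (rule tendsto_le[OF _ lim3 lim ev]) simp
    qed
  qed
  show ?thesis using C0 main by blast
qed

section \<open>Convergence of dilations\<close>

text \<open>The disc automorphism taking 0 to \<open>\<rho>\<close>. A real parameter suffices,
  since the arguments of points are supplied by a separate rotation.\<close>

definition disc_moebius :: "real \<Rightarrow> complex \<Rightarrow> complex" where
  "disc_moebius \<rho> w = (w + of_real \<rho>) / (1 + of_real \<rho> * w)"

lemma disc_moebius:
  assumes "0 \<le> \<rho>" "\<rho> < 1"
  shows disc_moebius_0: "disc_moebius \<rho> 0 = of_real \<rho>"
    and norm_disc_moebius_le: "norm w \<le> 1 \<Longrightarrow> norm (disc_moebius \<rho> w) \<le> 1"
    and norm_disc_moebius_eq: "norm w = 1 \<Longrightarrow> norm (disc_moebius \<rho> w) = 1"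
    and disc_moebius_nz: "norm w * \<rho> < 1 \<Longrightarrow> 1 + of_real \<rho> * w \<noteq> 0"
proof -
  show nz: "1 + of_real \<rho> * w \<noteq> 0" if "norm w * \<rho> < 1" for w :: complex
  proof
    assume "1 + of_real \<rho> * w = 0"
    then have "of_real \<rho> * w = - 1" by (simp add: add_eq_0_iff)
    then have "norm (of_real \<rho> * w) = norm (-1 :: complex)" by (rule arg_cong)
    then show False using that assms by (simp add: norm_mult mult.commute)
  qed
  have nz1: "1 + of_real \<rho> * w \<noteq> 0" if "norm w \<le> 1" for w :: complex
    using that assms by (intro nz) (meson le_less_trans mult_left_le_one_le norm_ge_zero)
  have a: "norm (- of_real \<rho> :: complex) < 1" using assms by simp
  show "disc_moebius \<rho> 0 = of_real \<rho>" by (simp add: disc_moebius_def)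
  show "norm w \<le> 1 \<Longrightarrow> norm (disc_moebius \<rho> w) \<le> 1"
    using cmod_blaschke_ineq(1)[OF _ a, of w] nz1[of w] by (simp add: disc_moebius_def norm_divide)
  show "norm w = 1 \<Longrightarrow> norm (disc_moebius \<rho> w) = 1"
    using cmod_blaschke_ineq(2)[OF _ a, of w] nz1[of w] by (simp add: disc_moebius_def norm_divide)
qed

lemma holomorphic_disc_moebius:
  assumes "0 \<le> \<rho>" "\<rho> < 1"
  shows "disc_moebius \<rho> holomorphic_on ball 0 (2 / (1 + \<rho>))"
proof -
  have "norm w * \<rho> < 1" if "norm w < 2 / (1 + \<rho>)" for w :: complex
  proof -
    have "norm w * \<rho> \<le> 2 / (1 + \<rho>) * \<rho>"
      using that assms by (intro mult_right_mono) auto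
    also have "\<dots> < 1" using assms by (simp add: field_simps)
    finally show ?thesis .
  qed
  then have "1 + of_real \<rho> * w \<noteq> 0" if "w \<in> ball 0 (2 / (1 + \<rho>))" for w :: complex
    using that by (intro disc_moebius_nz[OF assms]) auto
  then show ?thesis unfolding disc_moebius_def by (intro holomorphic_intros) auto
qed

lemma continuous_disc_moebius:
  assumes "0 \<le> \<rho>" "\<rho> < 1"
  shows "continuous_on (cball 0 1) (disc_moebius \<rho>)"
  by (rule holomorphic_on_imp_continuous_on, rule holomorphic_on_subset[OF holomorphic_disc_moebius[OF assms]])
     (use assms in \<open>auto simp: field_simps cball_subset_ball_iff\<close>)

text \<open>
  Averaging over rotations makes the composition with the disc automorphism invisible, so
  no change of variables is ever needed.
\<close>

lemma cmean_disc_moebius: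
  fixes F :: "complex \<Rightarrow> real"
  assumes F: "continuous_on (sphere 0 1) F" and \<rho>: "0 \<le> \<rho>" "\<rho> < 1"
  shows "cmean (\<lambda>\<zeta>. cmean (\<lambda>w. F (\<zeta> * disc_moebius \<rho> w))) = cmean F"
proof -
  have b: "continuous_on (sphere 0 1) (disc_moebius \<rho>)"
    by (rule continuous_on_subset[OF continuous_disc_moebius[OF \<rho>]]) auto
  have "cmean (\<lambda>\<zeta>. cmean (\<lambda>w. F (\<zeta> * disc_moebius \<rho> w))) = cmean (\<lambda>w. cmean (\<lambda>\<zeta>. F (\<zeta> * disc_moebius \<rho> w)))"
  proof (rule cmean_swap)
    have "continuous_on (sphere 0 1 \<times> sphere 0 1) (\<lambda>x::complex\<times>complex. fst x * disc_moebius \<rho> (snd x))"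
      by (intro continuous_intros continuous_on_compose2[OF b]) auto
    then show "continuous_on (sphere 0 1 \<times> sphere 0 1) (\<lambda>(\<zeta>, w). F (\<zeta> * disc_moebius \<rho> w))"
      unfolding case_prod_unfold
      by (rule continuous_on_compose2[OF F]) (auto simp: norm_mult norm_disc_moebius_eq[OF \<rho>])
  qed
  also have "\<dots> = cmean (\<lambda>_. cmean F)"
  proof (rule cmean_cong)
    fix w :: complex assume "norm w = 1"
    from cmean_rotate[OF F norm_disc_moebius_eq[OF \<rho> this]]
    show "cmean (\<lambda>\<zeta>. F (\<zeta> * disc_moebius \<rho> w)) = cmean F" by (simp only: mult.commute)
  qed
  finally show ?thesis by simp
qed

text \<open>The convexity estimate needs a function holomorphic past the closed disc. Since |c| < 1,
  the closed disc goes to a compact subset of the open one, which leaves the required room.\<close>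

lemma holomorphic_moebius_comp:
  assumes f: "f holomorphic_on ball 0 1" and \<sigma>: "norm c < 1" and \<rho>: "0 \<le> \<rho>" "\<rho> < 1"
  obtains S where "open S" "cball 0 1 \<subseteq> S" "(\<lambda>w. f (c * disc_moebius \<rho> w)) holomorphic_on S"
proof -
  define S where "S = ball 0 (2 / (1 + \<rho>)) \<inter> (\<lambda>w. c * disc_moebius \<rho> w) -` ball 0 1"
  have h: "(\<lambda>w. c * disc_moebius \<rho> w) holomorphic_on ball 0 (2 / (1 + \<rho>))"
    by (intro holomorphic_intros holomorphic_disc_moebius \<rho>)
  show thesis
  proof
    show "open S" unfolding S_def
      by (intro continuous_open_preimage holomorphic_on_imp_continuous_on h open_ball)
    show "cball 0 1 \<subseteq> S"
    proof
      fix w :: complex assume w: "w \<in> cball 0 1"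
      have "norm (c * disc_moebius \<rho> w) \<le> norm c * 1"
        unfolding norm_mult using w norm_disc_moebius_le[OF \<rho>, of w] by (intro mult_left_mono) auto
      moreover have "norm w < 2 / (1 + \<rho>)"
      proof -
        have "1 < 2 / (1 + \<rho>)" using \<rho> by (simp add: field_simps)
        then show ?thesis using w by simp
      qed
      ultimately show "w \<in> S" using \<sigma> by (auto simp: S_def)
    qed
    show "(\<lambda>w. f (c * disc_moebius \<rho> w)) holomorphic_on S"
      by (rule holomorphic_on_compose_gen[OF holomorphic_on_subset[OF h] f, unfolded o_def]) (auto simp: S_def)
  qed
qed

lemma continuous_on_dilate:
  assumes "continuous_on (ball 0 1) f" "0 \<le> r" "r < (1::real)"
  shows "continuous_on (cball 0 1) (\<lambda>z::complex. f (of_real r * z))"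
proof (rule continuous_on_compose2[OF assms(1)])
  have "r * norm z < 1" if "norm z \<le> 1" for z :: complex
    using that assms by (meson le_less_trans mult_left_le norm_ge_zero)
  then show "(*) (complex_of_real r) ` cball 0 1 \<subseteq> ball 0 1"
    using assms by (auto simp: norm_mult)
qed (intro continuous_intros)

lemma continuous_on_twist:
  fixes f :: "complex \<Rightarrow> 'b::topological_space"
  assumes f: "continuous_on (cball 0 1) f" and \<rho>: "0 \<le> \<rho>" "\<rho> < 1"
  shows "continuous_on (sphere 0 1 \<times> sphere 0 1) (\<lambda>x. f (fst x * disc_moebius \<rho> (snd x)))"
proof (rule continuous_on_compose2[OF f])
  have b: "continuous_on (sphere 0 1) (disc_moebius \<rho>)"
    by (rule continuous_on_subset[OF continuous_disc_moebius[OF \<rho>]]) auto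
  show "continuous_on (sphere 0 1 \<times> sphere 0 1) (\<lambda>x::complex\<times>complex. fst x * disc_moebius \<rho> (snd x))"
    by (intro continuous_intros continuous_on_compose2[OF b]) auto
qed (auto simp: norm_mult norm_disc_moebius_eq[OF \<rho>])

section \<open>Means over circles: monotonicity and the Cauchy property\<close>

definition pmean :: "real \<Rightarrow> (complex \<Rightarrow> complex) \<Rightarrow> real \<Rightarrow> real" where
  "pmean p f r = cmean (\<lambda>\<zeta>. norm (f (of_real r * \<zeta>)) powr p)"

text \<open>The subtracted term is the value of the twisted function at w = 0, so the inner mean is
  the quantity that uniform convexity bounds.\<close>

definition moebius_deviation :: "real \<Rightarrow> (complex \<Rightarrow> complex) \<Rightarrow> real \<Rightarrow> real \<Rightarrow> real" where
  "moebius_deviation p f \<sigma> \<rho> = cmean (\<lambda>\<zeta>. cmean (\<lambda>w.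
     norm (f (of_real \<sigma> * (\<zeta> * disc_moebius \<rho> w)) - f (of_real (\<sigma> * \<rho>) * \<zeta>)) powr p))"

lemma continuous_on_slice:
  fixes F :: "complex \<Rightarrow> complex \<Rightarrow> 'a::topological_space"
  assumes "continuous_on (sphere 0 1 \<times> sphere 0 1) (\<lambda>x. F (fst x) (snd x))" "norm z = 1"
  shows "continuous_on (sphere 0 1) (F z)"
proof -
  have "continuous_on (sphere 0 1) (\<lambda>w. F (fst (z, w)) (snd (z, w)))"
    by (rule continuous_on_compose2[OF assms(1)]) (use assms(2) in \<open>auto intro!: continuous_intros\<close>)
  then show ?thesis by simp
qed

lemma cmean_mono2:
  fixes F G :: "complex \<Rightarrow> complex \<Rightarrow> real"
  assumes F: "continuous_on (sphere 0 1 \<times> sphere 0 1) (\<lambda>x. F (fst x) (snd x))"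
    and G: "continuous_on (sphere 0 1 \<times> sphere 0 1) (\<lambda>x. G (fst x) (snd x))"
    and "\<And>z w. norm z = 1 \<Longrightarrow> norm w = 1 \<Longrightarrow> F z w \<le> G z w"
  shows "cmean (\<lambda>z. cmean (F z)) \<le> cmean (\<lambda>z. cmean (G z))"
proof (rule cmean_mono)
  show "continuous_on (sphere 0 1) (\<lambda>z. cmean (F z))" "continuous_on (sphere 0 1) (\<lambda>z. cmean (G z))"
    using F G by (auto intro!: continuous_on_cmean simp: case_prod_unfold)
  fix z :: complex assume z: "norm z = 1"
  from continuous_on_slice[OF F z] continuous_on_slice[OF G z] show "cmean (F z) \<le> cmean (G z)"
    using z assms(3) by (intro cmean_mono) auto
qed

context
  fixes f :: "complex \<Rightarrow> complex" and p :: real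
  assumes f: "f holomorphic_on ball 0 1" and p: "0 < p" "p \<le> 1"
begin

lemma continuous_on_dilation: "0 \<le> r \<Longrightarrow> r < 1 \<Longrightarrow> continuous_on (cball 0 1) (\<lambda>z. f (of_real r * z))"
  by (intro continuous_on_dilate holomorphic_on_imp_continuous_on f)

lemma continuous_on_dilation_powr:
  "0 \<le> r \<Longrightarrow> r < 1 \<Longrightarrow> 0 < s \<Longrightarrow> continuous_on (sphere 0 1) (\<lambda>z. norm (f (of_real r * z)) powr s)"
  by (intro continuous_intros continuous_on_subset[OF continuous_on_dilation]) auto

lemma pmean_nonneg: "0 \<le> r \<Longrightarrow> r < 1 \<Longrightarrow> 0 \<le> pmean p f r"
  unfolding pmean_def using p by (intro cmean_nonneg continuous_on_dilation_powr) auto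

text \<open>Uniform convexity is applied for each \<open>\<zeta>\<close> to w -> f (\<sigma> \<zeta>
  b w), with b the automorphism. Averaging over \<open>\<zeta>\<close> turns the circle means into
  the mean over radius \<open>\<sigma>\<close> and the centre values into the mean over radius
  \<open>\<sigma> * \<rho>\<close>.\<close>

lemma pmean_deviation:
  fixes \<eta> :: real
  assumes "0 < \<eta>"
  shows "\<exists>C\<ge>0. \<forall>\<sigma> \<rho>. 0 \<le> \<sigma> \<longrightarrow> \<sigma> < 1 \<longrightarrow> 0 \<le> \<rho> \<longrightarrow> \<rho> < 1 \<longrightarrow>
    moebius_deviation p f \<sigma> \<rho> \<le> \<eta> * pmean p f \<sigma> + C * (pmean p f \<sigma> - pmean p f (\<sigma> * \<rho>))"
proof -
  obtain C where C: "C \<ge> 0" "\<And>G S. G holomorphic_on S \<Longrightarrow> open S \<Longrightarrow> cball 0 1 \<subseteq> S \<Longrightarrow>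
     cmean (\<lambda>z. norm (G z - G 0) powr p) \<le> \<eta> * cmean (\<lambda>z. norm (G z) powr p)
       + C * (cmean (\<lambda>z. norm (G z) powr p) - norm (G 0) powr p)"
    using cmean_deviation_bound[OF p assms] by blast
  have "moebius_deviation p f \<sigma> \<rho> \<le> \<eta> * pmean p f \<sigma> + C * (pmean p f \<sigma> - pmean p f (\<sigma> * \<rho>))"
    if \<sigma>: "0 \<le> \<sigma>" "\<sigma> < 1" and \<rho>: "0 \<le> \<rho>" "\<rho> < 1" for \<sigma> \<rho>
  proof -
    define A where "A \<zeta> w = norm (f (of_real \<sigma> * (\<zeta> * disc_moebius \<rho> w)) - f (of_real (\<sigma> * \<rho>) * \<zeta>)) powr p" for \<zeta> w
    define D where "D \<zeta> w = norm (f (of_real \<sigma> * (\<zeta> * disc_moebius \<rho> w))) powr p" for \<zeta> w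
    have \<sigma>\<rho>: "\<sigma> * \<rho> < 1" "0 \<le> \<sigma> * \<rho>" using \<sigma> \<rho> by (auto simp: mult_le_one intro: le_less_trans[OF mult_left_le[of \<rho> \<sigma>]])
    have c1: "continuous_on (sphere 0 1 \<times> sphere 0 1) (\<lambda>x. f (of_real \<sigma> * (fst x * disc_moebius \<rho> (snd x))))"
      by (rule continuous_on_twist[OF continuous_on_dilation[OF \<sigma>] \<rho>])
    have c2: "continuous_on (sphere 0 1 \<times> sphere 0 1) (\<lambda>x::complex\<times>complex. f (of_real (\<sigma> * \<rho>) * fst x))"
      by (rule continuous_on_compose2[OF continuous_on_dilation[OF \<sigma>\<rho>(2,1)]]) (auto intro!: continuous_intros)
    have c3: "continuous_on (sphere 0 1) (\<lambda>\<zeta>. norm (f (of_real (\<sigma> * \<rho>) * \<zeta>)) powr p)"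
      using p by (intro continuous_intros continuous_on_subset[OF continuous_on_dilation[OF \<sigma>\<rho>(2,1)]]) auto
    have cA: "continuous_on (sphere 0 1) (\<lambda>\<zeta>. cmean (A \<zeta>))"
      unfolding A_def using p c1 c2 by (intro continuous_on_cmean) (auto simp: case_prod_unfold intro!: continuous_intros)
    have cD: "continuous_on (sphere 0 1) (\<lambda>\<zeta>. cmean (D \<zeta>))"
      unfolding D_def using p c1 by (intro continuous_on_cmean) (auto simp: case_prod_unfold intro!: continuous_intros)
    have "cmean (\<lambda>\<zeta>. cmean (A \<zeta>)) \<le>
        cmean (\<lambda>\<zeta>. \<eta> * cmean (D \<zeta>) + C * (cmean (D \<zeta>) - norm (f (of_real (\<sigma> * \<rho>) * \<zeta>)) powr p))"
    proof (rule cmean_mono)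
      fix \<zeta> :: complex assume z: "norm \<zeta> = 1"
      have "norm (of_real \<sigma> * \<zeta>) < 1" using z \<sigma> by (simp add: norm_mult)
      from holomorphic_moebius_comp[OF f this \<rho>] obtain S where
        S: "open S" "cball 0 1 \<subseteq> S" "(\<lambda>w. f (of_real \<sigma> * \<zeta> * disc_moebius \<rho> w)) holomorphic_on S" by blast
      from C(2)[OF S(3,1,2)]
      show "cmean (A \<zeta>) \<le> \<eta> * cmean (D \<zeta>) + C * (cmean (D \<zeta>) - norm (f (of_real (\<sigma> * \<rho>) * \<zeta>)) powr p)"
        by (simp add: A_def[abs_def] D_def[abs_def] disc_moebius_0[OF \<rho>] mult_ac)
    qed (intro continuous_intros cA cD c3)+
    also have "\<dots> = \<eta> * cmean (\<lambda>\<zeta>. cmean (D \<zeta>)) + C * (cmean (\<lambda>\<zeta>. cmean (D \<zeta>)) - pmean p f (\<sigma> * \<rho>))"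
    proof -
      have i: "continuous_on (sphere 0 1) (\<lambda>\<zeta>. \<eta> * cmean (D \<zeta>))"
        "continuous_on (sphere 0 1) (\<lambda>\<zeta>. C * (cmean (D \<zeta>) - norm (f (of_real (\<sigma> * \<rho>) * \<zeta>)) powr p))"
        by (intro continuous_intros cD c3)+
      show ?thesis
        unfolding cmean_add[OF i] cmean_mult_left cmean_diff[OF cD c3] pmean_def ..
    qed
    also have "cmean (\<lambda>\<zeta>. cmean (D \<zeta>)) = pmean p f \<sigma>"
      unfolding D_def pmean_def using p
      by (rule_tac cmean_disc_moebius[of "\<lambda>\<zeta>. norm (f (of_real \<sigma> * \<zeta>)) powr p", OF _ \<rho>])
         (intro continuous_intros continuous_on_subset[OF continuous_on_dilation[OF \<sigma>]], auto)
    finally show ?thesis unfolding moebius_deviation_def A_def .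
  qed
  then show ?thesis using C(1) by blast
qed

text \<open>Subharmonicity of |f|^s in the form of a Poisson integral: the automorphism moves the
  point to the centre, so that no Poisson kernel has to be written.\<close>

lemma pmean_growth_integrated:
  assumes \<sigma>: "0 \<le> \<sigma>" "\<sigma> < 1" and \<rho>: "0 \<le> \<rho>" "\<rho> < 1" and s: "0 < s" and \<zeta>: "norm \<zeta> = 1"
  shows "norm (f (of_real (\<sigma> * \<rho>) * \<zeta>)) powr s
      \<le> cmean (\<lambda>w. norm (f (of_real \<sigma> * (\<zeta> * disc_moebius \<rho> w))) powr s)"
proof -
  have "norm (of_real \<sigma> * \<zeta>) < 1" using \<zeta> \<sigma> by (simp add: norm_mult)
  from holomorphic_moebius_comp[OF f this \<rho>] obtain S where
    S: "open S" "cball 0 1 \<subseteq> S" "(\<lambda>w. f (of_real \<sigma> * \<zeta> * disc_moebius \<rho> w)) holomorphic_on S" by blast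
  from cmod_powr_growth[OF S(3,1,2) s, of 0] show ?thesis
    by (simp add: disc_moebius_0[OF \<rho>] mult_ac)
qed

text \<open>The pointwise subharmonic bound with \<rho> = r / \<sigma>, averaged over
  rotations.\<close>

lemma pmean_mono:
  assumes "0 \<le> r" "r \<le> \<sigma>" "\<sigma> < 1"
  shows "pmean p f r \<le> pmean p f \<sigma>"
proof (cases "r = \<sigma>")
  case False
  then have \<sigma>: "0 \<le> \<sigma>" "\<sigma> < 1" "0 < \<sigma>" using assms by auto
  define \<rho> where "\<rho> = r / \<sigma>"
  have \<rho>: "0 \<le> \<rho>" "\<rho> < 1" "\<sigma> * \<rho> = r" using assms False \<sigma> by (auto simp: \<rho>_def)
  have r: "0 \<le> r" "r < 1" using assms by auto
  have c1: "continuous_on (sphere 0 1 \<times> sphere 0 1) (\<lambda>x. f (of_real \<sigma> * (fst x * disc_moebius \<rho> (snd x))))"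
    by (rule continuous_on_twist[OF continuous_on_dilation[OF \<sigma>(1,2)] \<rho>(1,2)])
  have "pmean p f r \<le> cmean (\<lambda>\<zeta>. cmean (\<lambda>w. norm (f (of_real \<sigma> * (\<zeta> * disc_moebius \<rho> w))) powr p))"
    unfolding pmean_def
  proof (rule cmean_mono)
    show "continuous_on (sphere 0 1) (\<lambda>z. norm (f (of_real r * z)) powr p)"
      using p by (intro continuous_intros continuous_on_subset[OF continuous_on_dilation[OF r]]) auto
    show "continuous_on (sphere 0 1) (\<lambda>\<zeta>. cmean (\<lambda>w. norm (f (of_real \<sigma> * (\<zeta> * disc_moebius \<rho> w))) powr p))"
      using p c1 by (intro continuous_on_cmean) (auto simp: case_prod_unfold intro!: continuous_intros)
    fix z :: complex assume "norm z = 1"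
    then show "norm (f (of_real r * z)) powr p \<le> cmean (\<lambda>w. norm (f (of_real \<sigma> * (z * disc_moebius \<rho> w))) powr p)"
      using pmean_growth_integrated[OF \<sigma>(1,2) \<rho>(1,2) p(1)] \<rho>(3) by simp
  qed
  also have "\<dots> = pmean p f \<sigma>"
    unfolding pmean_def using p
    by (rule_tac cmean_disc_moebius[of "\<lambda>\<zeta>. norm (f (of_real \<sigma> * \<zeta>)) powr p", OF _ \<rho>(1,2)])
       (intro continuous_intros continuous_on_subset[OF continuous_on_dilation[OF \<sigma>(1,2)]], auto)
  finally show ?thesis .
qed simp

text \<open>The means increase to a finite supremum, so beyond some radius their increments are
  small, and f at radius \<sigma>, twisted by the automorphism, is close to f at radius \<sigma>
  \<rho>. The latter circle stays in a compact disc, where uniform continuity compares \<sigma> with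
  \<sigma>'.\<close>

lemma pmean_Cauchy:
  assumes bdd: "\<And>r. 0 < r \<Longrightarrow> r < 1 \<Longrightarrow> pmean p f r \<le> M" and \<epsilon>: "0 < \<epsilon>"
  shows "\<exists>r0. 0 < r0 \<and> r0 < 1 \<and> (\<forall>\<sigma> \<sigma>'. r0 < \<sigma> \<longrightarrow> \<sigma> < 1 \<longrightarrow> r0 < \<sigma>' \<longrightarrow> \<sigma>' < 1 \<longrightarrow>
    cmean (\<lambda>\<zeta>. norm (f (of_real \<sigma> * \<zeta>) - f (of_real \<sigma>' * \<zeta>)) powr p) \<le> \<epsilon>)"
proof -
  have M0: "0 \<le> M" using bdd[of "1/2"] pmean_nonneg[of "1/2"] by linarith
  define \<eta> where "\<eta> = \<epsilon> / (6 * (M + 1))"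
  have \<eta>: "\<eta> > 0" "\<eta> * M \<le> \<epsilon> / 6"
    using \<epsilon> M0 by (auto simp: \<eta>_def field_simps)
  obtain C where C: "C \<ge> 0" "\<And>\<sigma> \<rho>. 0 \<le> \<sigma> \<Longrightarrow> \<sigma> < 1 \<Longrightarrow> 0 \<le> \<rho> \<Longrightarrow> \<rho> < 1 \<Longrightarrow>
    moebius_deviation p f \<sigma> \<rho> \<le> \<eta> * pmean p f \<sigma> + C * (pmean p f \<sigma> - pmean p f (\<sigma> * \<rho>))"
    using pmean_deviation[OF \<eta>(1)] by blast
  define \<Lambda> where "\<Lambda> = (SUP r\<in>{0<..<1}. pmean p f r)"
  have bd: "bdd_above (pmean p f ` {0<..<1})" using bdd by (intro bdd_aboveI2) auto
  define \<kappa> where "\<kappa> = \<epsilon> / (6 * (C + 1))"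
  have \<kappa>: "\<kappa> > 0" "C * \<kappa> \<le> \<epsilon> / 6" using \<epsilon> C(1) by (auto simp: \<kappa>_def field_simps)
  obtain t where t: "0 < t" "t < 1" "\<Lambda> - \<kappa> < pmean p f t"
    using less_cSUP_iff[of "{0<..<1::real}" "pmean p f" "\<Lambda> - \<kappa>"] bd \<kappa> by (auto simp: \<Lambda>_def)
  \<comment> \<open>With the square root, \<sigma> > \<rho> already gives \<sigma> \<rho> > t, so
    the means at both radii lie within \<open>\<kappa>\<close> of the supremum.\<close>
  define \<rho> where "\<rho> = sqrt t"
  have \<rho>: "0 < \<rho>" "\<rho> < 1" "\<rho> * \<rho> = t" using t by (auto simp: \<rho>_def)
  have dev: "moebius_deviation p f \<sigma> \<rho> \<le> \<epsilon> / 3"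
    if "\<rho> < \<sigma>" "\<sigma> < 1" for \<sigma>
  proof -
    have "pmean p f t \<le> pmean p f (\<sigma> * \<rho>)"
      using that \<rho> by (intro pmean_mono) (auto simp: mult_le_one intro: mult_right_mono le_less_trans[OF mult_left_le[of \<rho> \<sigma>]])
    moreover have "pmean p f \<sigma> \<le> \<Lambda>"
      unfolding \<Lambda>_def using that \<rho> by (intro cSUP_upper bd) auto
    ultimately have "C * (pmean p f \<sigma> - pmean p f (\<sigma> * \<rho>)) \<le> C * \<kappa>"
      using t C by (intro mult_left_mono) auto
    moreover have "\<eta> * pmean p f \<sigma> \<le> \<eta> * M" using that \<rho> \<eta> by (intro mult_left_mono bdd) auto
    moreover have "moebius_deviation p f \<sigma> \<rho> \<le> \<eta> * pmean p f \<sigma> + C * (pmean p f \<sigma> - pmean p f (\<sigma> * \<rho>))"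
      using that \<rho> by (intro C(2)) auto
    ultimately show ?thesis using \<kappa>(2) \<eta>(2) by linarith
  qed
  have "uniformly_continuous_on (cball 0 \<rho>) f"
    using \<rho> by (intro compact_uniformly_continuous holomorphic_on_imp_continuous_on holomorphic_on_subset[OF f]) auto
  moreover have "(\<epsilon> / 3) powr (1 / p) > 0" using \<epsilon> by simp
  ultimately obtain d where d: "d > 0" "\<And>x y. x \<in> cball 0 \<rho> \<Longrightarrow> y \<in> cball 0 \<rho> \<Longrightarrow> dist x y < d \<Longrightarrow> dist (f x) (f y) < (\<epsilon> / 3) powr (1 / p)"
    unfolding uniformly_continuous_on_def by metis
  \<comment> \<open>The first bound serves the deviation estimate, the second forces |\<sigma> -
    \<sigma>'| < d.\<close>
  define r0 where "r0 = max \<rho> (1 - d)"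
  have r0: "0 < r0" "r0 < 1" using \<rho> d by (auto simp: r0_def)
  have main: "cmean (\<lambda>\<zeta>. norm (f (of_real \<sigma> * \<zeta>) - f (of_real \<sigma>' * \<zeta>)) powr p) \<le> \<epsilon>"
    if s: "r0 < \<sigma>" "\<sigma> < 1" "r0 < \<sigma>'" "\<sigma>' < 1" for \<sigma> \<sigma>'
  proof -
    have s0: "0 \<le> \<sigma>" "0 \<le> \<sigma>'" using s r0 by auto
    have le: "\<sigma> * \<rho> \<le> \<rho>" "\<sigma>' * \<rho> \<le> \<rho>"
      using s s0 \<rho> by (auto intro: mult_left_le_one_le)
    then have \<sigma>\<rho>: "\<sigma> * \<rho> < 1" "0 \<le> \<sigma> * \<rho>" "\<sigma>' * \<rho> < 1" "0 \<le> \<sigma>' * \<rho>" "\<sigma> * \<rho> \<le> \<rho>" "\<sigma>' * \<rho> \<le> \<rho>"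
      using s s0 \<rho> le_less_trans[OF le(1) \<rho>(2)] le_less_trans[OF le(2) \<rho>(2)] by auto
    define A where "A \<sigma> \<zeta> w = norm (f (of_real \<sigma> * (\<zeta> * disc_moebius \<rho> w)) - f (of_real (\<sigma> * \<rho>) * \<zeta>)) powr p" for \<sigma> \<zeta> w
    define D where "D \<zeta> w = norm (f (of_real \<sigma> * (\<zeta> * disc_moebius \<rho> w)) - f (of_real \<sigma>' * (\<zeta> * disc_moebius \<rho> w))) powr p" for \<zeta> w
    have c1: "continuous_on (sphere 0 1 \<times> sphere 0 1) (\<lambda>x. f (of_real \<sigma> * (fst x * disc_moebius \<rho> (snd x))))"
      if "0 \<le> \<sigma>" "\<sigma> < 1" for \<sigma>
      by (rule continuous_on_twist[OF continuous_on_dilation[OF that]]) (use \<rho> in auto)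
    have c2: "continuous_on (sphere 0 1 \<times> sphere 0 1) (\<lambda>x::complex\<times>complex. f (of_real r * fst x))" if "0 \<le> r" "r < 1" for r
      by (rule continuous_on_compose2[OF continuous_on_dilation[OF that]]) (auto intro!: continuous_intros)
    have cA: "continuous_on (sphere 0 1 \<times> sphere 0 1) (\<lambda>x. A \<sigma> (fst x) (snd x))"
      "continuous_on (sphere 0 1 \<times> sphere 0 1) (\<lambda>x. A \<sigma>' (fst x) (snd x))"
      unfolding A_def using p c1[OF s0(1) s(2)] c1[OF s0(2) s(4)] c2[OF \<sigma>\<rho>(2,1)] c2[OF \<sigma>\<rho>(4,3)]
      by (auto intro!: continuous_intros)
    have cD: "continuous_on (sphere 0 1 \<times> sphere 0 1) (\<lambda>x. D (fst x) (snd x))"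
      unfolding D_def using p c1[OF s0(1) s(2)] c1[OF s0(2) s(4)] by (auto intro!: continuous_intros)
    have cA': "continuous_on (sphere 0 1) (\<lambda>z. cmean (A \<sigma> z))" "continuous_on (sphere 0 1) (\<lambda>z. cmean (A \<sigma>' z))"
      using cA by (auto intro!: continuous_on_cmean simp: case_prod_unfold)
    have cDs: "continuous_on (sphere 0 1) (\<lambda>\<zeta>. norm (f (of_real \<sigma> * \<zeta>) - f (of_real \<sigma>' * \<zeta>)) powr p)"
      using p by (intro continuous_intros continuous_on_subset[OF continuous_on_dilation[OF s0(1) s(2)]]
         continuous_on_subset[OF continuous_on_dilation[OF s0(2) s(4)]]) auto
    \<comment> \<open>A mean over all rotations does not change when its argument is twisted by the
      automorphism; in the twisted form it can be compared with the two deviations.\<close>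
    have "cmean (\<lambda>\<zeta>. norm (f (of_real \<sigma> * \<zeta>) - f (of_real \<sigma>' * \<zeta>)) powr p) = cmean (\<lambda>\<zeta>. cmean (D \<zeta>))"
      unfolding D_def using cmean_disc_moebius[OF cDs, of \<rho>] \<rho> by simp
    also have "\<dots> \<le> cmean (\<lambda>\<zeta>. cmean (\<lambda>w. A \<sigma> \<zeta> w + A \<sigma>' \<zeta> w + \<epsilon> / 3))"
    proof (rule cmean_mono2)
      fix z w :: complex assume zw: "norm z = 1" "norm w = 1"
      define x where "x = of_real (\<sigma> * \<rho>) * z"
      define y where "y = of_real (\<sigma>' * \<rho>) * z"
      have "dist x y = \<bar>\<sigma> * \<rho> - \<sigma>' * \<rho>\<bar>"
      proof -
        have "x - y = of_real (\<sigma> * \<rho> - \<sigma>' * \<rho>) * z" by (simp add: x_def y_def algebra_simps)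
        then show ?thesis using zw by (simp only: dist_norm norm_mult norm_of_real mult_1_right)
      qed
      also have "\<dots> = \<bar>\<sigma> - \<sigma>'\<bar> * \<rho>" using \<rho> by (simp add: abs_mult flip: left_diff_distrib)
      also have "\<dots> \<le> \<bar>\<sigma> - \<sigma>'\<bar>" using \<rho> by (simp add: mult_left_le)
      also have "\<dots> < d" using s by (auto simp: r0_def)
      finally have "dist x y < d" .
      moreover have "x \<in> cball 0 \<rho>" "y \<in> cball 0 \<rho>" using zw \<sigma>\<rho> by (auto simp: x_def y_def norm_mult)
      ultimately have "norm (f x - f y) < (\<epsilon> / 3) powr (1 / p)" using d(2) by (simp add: dist_norm)
      then have "norm (f x - f y) powr p \<le> ((\<epsilon> / 3) powr (1 / p)) powr p"
        using p by (intro powr_mono2) auto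
      then have xy: "norm (f x - f y) powr p \<le> \<epsilon> / 3" using p \<epsilon> by (simp add: powr_powr)
      define u where "u = f (of_real \<sigma> * (z * disc_moebius \<rho> w))"
      define v where "v = f (of_real \<sigma>' * (z * disc_moebius \<rho> w))"
      have "norm (u - v) powr p \<le> norm (u - f x) powr p + norm (f x - v) powr p"
        using norm_add_powr_le[OF p, of "u - f x" "f x - v"] by simp
      also have "norm (f x - v) powr p \<le> norm (f x - f y) powr p + norm (f y - v) powr p"
        using norm_add_powr_le[OF p, of "f x - f y" "f y - v"] by simp
      finally show "D z w \<le> A \<sigma> z w + A \<sigma>' z w + \<epsilon> / 3"
        using xy by (simp add: D_def A_def u_def v_def x_def y_def norm_minus_commute)
    qed (intro continuous_intros cA cD)+
    also have "\<dots> = cmean (\<lambda>\<zeta>. cmean (A \<sigma> \<zeta>) + cmean (A \<sigma>' \<zeta>) + \<epsilon> / 3)"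
    proof (rule cmean_cong)
      fix z :: complex assume z: "norm z = 1"
      note i = continuous_on_slice[OF cA(1) z] continuous_on_slice[OF cA(2) z]
      show "cmean (\<lambda>w. A \<sigma> z w + A \<sigma>' z w + \<epsilon> / 3) = cmean (A \<sigma> z) + cmean (A \<sigma>' z) + \<epsilon> / 3"
        using cmean_add[OF continuous_on_add[OF i] continuous_on_const] cmean_add[OF i] by simp
    qed
    also have "\<dots> = cmean (\<lambda>\<zeta>. cmean (A \<sigma> \<zeta>)) + cmean (\<lambda>\<zeta>. cmean (A \<sigma>' \<zeta>)) + \<epsilon> / 3"
      using cmean_add[OF continuous_on_add[OF cA'] continuous_on_const] cmean_add[OF cA'] by simp
    also have "\<dots> \<le> \<epsilon> / 3 + \<epsilon> / 3 + \<epsilon> / 3"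
      unfolding A_def moebius_deviation_def[symmetric]
      using s by (intro add_mono dev order_refl) (auto simp: r0_def)
    finally show ?thesis by simp
  qed
  show ?thesis using r0 main by blast
qed

end

section \<open>Hardy spaces as quasi-normed spaces\<close>

lemma hardy_mean_eq: "hardy_mean p f r = pmean p f r powr (1 / p)"
  by (simp add: hardy_mean_def pmean_def cmean_def)

lemma sum_fun_apply: "(\<Sum>i\<in>A. F i) x = (\<Sum>i\<in>A. F i x)"
  by (induction A rule: infinite_finite_induct) auto

definition disc_monom :: "nat \<Rightarrow> complex \<Rightarrow> complex" where
  "disc_monom n z = (if norm z < 1 then z ^ n else 0)"

definition dilation :: "real \<Rightarrow> (complex \<Rightarrow> complex) \<Rightarrow> complex \<Rightarrow> complex" where
  "dilation r f z = (if norm z < 1 then f (of_real r * z) else 0)"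

context
  fixes p :: real
  assumes p: "0 < p" "p \<le> 1"
begin

lemma hardy_holomorphic: "f \<in> hardy p \<Longrightarrow> f holomorphic_on ball 0 1"
  by (auto simp: hardy_def analytic_on_open)

lemma hardy_outside: "f \<in> hardy p \<Longrightarrow> 1 \<le> norm z \<Longrightarrow> f z = 0"
  by (auto simp: hardy_def)

lemma hardyI:
  assumes "f holomorphic_on ball 0 1" "\<And>z. 1 \<le> norm z \<Longrightarrow> f z = 0"
    and c: "0 \<le> c" "\<And>r. 0 < r \<Longrightarrow> r < 1 \<Longrightarrow> pmean p f r \<le> c powr p"
  shows "f \<in> hardy p" and "hardy_norm p f \<le> c"
proof -
  have le: "hardy_mean p f r \<le> c" if "r \<in> {0<..<1}" for r
  proof -
    have "pmean p f r powr (1 / p) \<le> (c powr p) powr (1 / p)"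
      using that c p pmean_nonneg[OF assms(1) p, of r] by (intro powr_mono2) auto
    then show ?thesis using c p by (simp add: hardy_mean_eq powr_powr)
  qed
  then have "bdd_above (hardy_mean p f ` {0<..<1})" by (intro bdd_aboveI2)
  then show "f \<in> hardy p" using assms by (auto simp: hardy_def analytic_on_open)
  show "hardy_norm p f \<le> c" unfolding hardy_norm_def using le by (intro cSUP_least) auto
qed

lemma hardy_norm_nonneg: "f \<in> hardy p \<Longrightarrow> 0 \<le> hardy_norm p f"
proof -
  assume f: "f \<in> hardy p"
  have "0 \<le> hardy_mean p f (1/2)" by (simp add: hardy_mean_eq)
  also have "\<dots> \<le> hardy_norm p f"
    unfolding hardy_norm_def using f by (intro cSUP_upper) (auto simp: hardy_def)
  finally show ?thesis .
qed

lemma pmean_le_hardy_norm: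
  assumes f: "f \<in> hardy p" and r: "0 < r" "r < 1"
  shows "pmean p f r \<le> hardy_norm p f powr p"
proof -
  have "hardy_mean p f r \<le> hardy_norm p f"
    unfolding hardy_norm_def using f r by (intro cSUP_upper) (auto simp: hardy_def)
  then have "(pmean p f r powr (1 / p)) powr p \<le> hardy_norm p f powr p"
    unfolding hardy_mean_eq using p by (intro powr_mono2) auto
  then show ?thesis
    using p r pmean_nonneg[OF hardy_holomorphic[OF f] p, of r] by (simp add: powr_powr)
qed

lemma hardy_bounded:
  assumes "f holomorphic_on ball 0 1" "\<And>z. 1 \<le> norm z \<Longrightarrow> f z = 0"
    and "0 \<le> c" "\<And>z. norm z < 1 \<Longrightarrow> norm (f z) \<le> c"
  shows "f \<in> hardy p" and "hardy_norm p f \<le> c"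
proof -
  have "pmean p f r \<le> c powr p" if "0 < r" "r < 1" for r
  proof -
    have "pmean p f r \<le> cmean (\<lambda>_. c powr p)"
      unfolding pmean_def using that assms p
      by (intro cmean_mono continuous_on_dilation_powr[OF assms(1) p] powr_mono2) (auto simp: norm_mult)
    then show ?thesis by simp
  qed
  then show "f \<in> hardy p" "hardy_norm p f \<le> c" using hardyI[OF assms(1-3)] by auto
qed

lemma hardy_scale_le:
  assumes f: "f \<in> hardy p"
  shows "fscale c f \<in> hardy p" and "hardy_norm p (fscale c f) \<le> norm c * hardy_norm p f"
proof -
  have h: "fscale c f holomorphic_on ball 0 1"
    unfolding fscale_def by (intro holomorphic_intros hardy_holomorphic f)
  have z: "fscale c f z = 0" if "1 \<le> norm z" for z
    using hardy_outside[OF f that] by (simp add: fscale_def)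
  have b: "pmean p (fscale c f) r \<le> (norm c * hardy_norm p f) powr p" if "0 < r" "r < 1" for r
  proof -
    have "pmean p (fscale c f) r = norm c powr p * pmean p f r"
      unfolding pmean_def fscale_def by (simp add: norm_mult powr_mult cmean_mult_left)
    also have "\<dots> \<le> norm c powr p * hardy_norm p f powr p"
      using that by (intro mult_left_mono pmean_le_hardy_norm f) auto
    finally show ?thesis using hardy_norm_nonneg[OF f] by (simp add: powr_mult)
  qed
  show "fscale c f \<in> hardy p" "hardy_norm p (fscale c f) \<le> norm c * hardy_norm p f"
    using hardyI[OF h z _ b] hardy_norm_nonneg[OF f] by auto
qed

lemma hardy_zero: "0 \<in> hardy p" "hardy_norm p 0 = 0"
proof -
  have "0 \<in> hardy p \<and> hardy_norm p 0 \<le> 0"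
    using hardy_bounded[of 0 0] by (auto simp: zero_fun_def)
  then show "0 \<in> hardy p" "hardy_norm p 0 = 0"
    using hardy_norm_nonneg[of 0] by auto
qed

lemma hardy_norm_scale:
  assumes f: "f \<in> hardy p"
  shows "hardy_norm p (fscale c f) = norm c * hardy_norm p f"
proof (cases "c = 0")
  case True
  have "fscale 0 f = 0" by (auto simp: fscale_def)
  then show ?thesis using True hardy_zero by simp
next
  case False
  have "fscale (1 / c) (fscale c f) = f" using False by (auto simp: fscale_def)
  then have "hardy_norm p f \<le> norm (1 / c) * hardy_norm p (fscale c f)"
    using hardy_scale_le(2)[OF hardy_scale_le(1)[OF f], of "1 / c" c] by simp
  then show ?thesis
    using hardy_scale_le(2)[OF f, of c] False by (simp add: norm_divide field_simps)
qed

lemma hardy_add: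
  assumes f: "f \<in> hardy p" and g: "g \<in> hardy p"
  shows "f + g \<in> hardy p"
    and "hardy_norm p (f + g) powr p \<le> hardy_norm p f powr p + hardy_norm p g powr p"
proof -
  define c where "c = (hardy_norm p f powr p + hardy_norm p g powr p) powr (1 / p)"
  have c: "0 \<le> c" "c powr p = hardy_norm p f powr p + hardy_norm p g powr p"
    using p by (auto simp: c_def powr_powr)
  note h = hardy_holomorphic[OF f] hardy_holomorphic[OF g]
  have hol: "(f + g) holomorphic_on ball 0 1"
    unfolding plus_fun_def by (intro holomorphic_intros h)
  have z: "(f + g) z = 0" if "1 \<le> norm z" for z
    using hardy_outside[OF f that] hardy_outside[OF g that] by simp
  have b: "pmean p (f + g) r \<le> c powr p" if r: "0 < r" "r < 1" for r
  proof -
    note i = continuous_on_dilation_powr[OF h(1) p, of r p] continuous_on_dilation_powr[OF h(2) p, of r p]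
    have "pmean p (f + g) r \<le> cmean (\<lambda>\<zeta>. norm (f (of_real r * \<zeta>)) powr p + norm (g (of_real r * \<zeta>)) powr p)"
      unfolding pmean_def using r p
      by (intro cmean_mono continuous_on_dilation_powr[OF hol p] continuous_on_add i)
         (auto intro!: norm_add_powr_le)
    also have "\<dots> = pmean p f r + pmean p g r"
      unfolding pmean_def using r p by (intro cmean_add i) auto
    also have "\<dots> \<le> c powr p"
      unfolding c(2) using r by (intro add_mono pmean_le_hardy_norm f g)
    finally show ?thesis .
  qed
  show "f + g \<in> hardy p" using hardyI(1)[OF hol z c(1) b] .
  then have "hardy_norm p (f + g) powr p \<le> c powr p"
    using hardyI(2)[OF hol z c(1) b] p by (intro powr_mono2 hardy_norm_nonneg) auto
  then show "hardy_norm p (f + g) powr p \<le> hardy_norm p f powr p + hardy_norm p g powr p"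
    by (simp add: c)
qed

text \<open>The growth estimate is applied to w -> f (r w) at z / r: the value stays f z while the
  circle of integration lies inside the disc. Then r tends to 1.\<close>

lemma hardy_growth:
  assumes f: "f \<in> hardy p" and z: "norm z < 1"
  shows "norm (f z) powr p * (1 - norm z) \<le> hardy_norm p f powr p"
proof -
  have ev: "\<forall>\<^sub>F r in at_left 1. norm (f z) powr p * (1 - norm z / r) \<le> hardy_norm p f powr p"
  proof -
    have "\<forall>\<^sub>F r in at_left (1::real). norm z < r" using z by (auto simp: eventually_at_left_field)
    then show ?thesis using eventually_at_left_1
    proof eventually_elim
      case (elim r)
      then have r: "0 < r" "r < 1" "norm z < r" by auto
      have "(\<lambda>w. f (of_real r * w)) holomorphic_on ball 0 (1 / r)"
        by (rule holomorphic_on_compose_gen[OF _ hardy_holomorphic[OF f], unfolded o_def])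
           (use r in \<open>auto intro!: holomorphic_intros simp: norm_mult field_simps\<close>)
      from cmod_powr_growth[OF this open_ball _ p(1), of "z / of_real r"]
      have "norm (f z) powr p * (1 - norm z / r) \<le> pmean p f r"
        using r by (auto simp: pmean_def norm_divide cball_subset_ball_iff)
      then show ?case using pmean_le_hardy_norm[OF f r(1,2)] by linarith
    qed
  qed
  have "((\<lambda>r. norm (f z) powr p * (1 - norm z / r)) \<longlongrightarrow> norm (f z) powr p * (1 - norm z / 1)) (at_left 1)"
    by (intro tendsto_intros) auto
  from tendsto_upperbound[OF this ev] show ?thesis by simp
qed

lemma disc_monom_hardy: "disc_monom n \<in> hardy p" "hardy_norm p (disc_monom n) \<le> 1"
proof -
  have "disc_monom n holomorphic_on ball 0 1"
    by (rule holomorphic_transform[of "\<lambda>z. z ^ n"]) (auto intro!: holomorphic_intros simp: disc_monom_def)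
  from hardy_bounded[OF this, of 1] show "disc_monom n \<in> hardy p" "hardy_norm p (disc_monom n) \<le> 1"
    by (auto simp: disc_monom_def norm_power power_le_one)
qed

lemma hardy_sum: "(\<And>i. i \<in> A \<Longrightarrow> F i \<in> hardy p) \<Longrightarrow> (\<Sum>i\<in>A. F i) \<in> hardy p"
  by (induction A rule: infinite_finite_induct) (auto intro: hardy_add hardy_zero)

lemma hardy_diff: "f \<in> hardy p \<Longrightarrow> g \<in> hardy p \<Longrightarrow> f - g \<in> hardy p"
proof -
  assume "f \<in> hardy p" "g \<in> hardy p"
  then have "f + fscale (- 1) g \<in> hardy p" by (intro hardy_add hardy_scale_le)
  then show ?thesis by (simp add: fscale_def fun_diff_def plus_fun_def)
qed

section \<open>Density of polynomials\<close>

lemma dilation_tendsto: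
  assumes f: "f \<in> hardy p" and \<epsilon>: "0 < \<epsilon>"
  shows "\<exists>r. 0 < r \<and> r < 1 \<and> f - dilation r f \<in> hardy p \<and> hardy_norm p (f - dilation r f) \<le> \<epsilon>"
proof -
  note h = hardy_holomorphic[OF f]
  have "\<epsilon> powr p > 0" using \<epsilon> by simp
  from pmean_Cauchy[OF h p pmean_le_hardy_norm[OF f] this] obtain r0 where r0: "0 < r0" "r0 < 1"
    "\<And>\<sigma> \<sigma>'. r0 < \<sigma> \<Longrightarrow> \<sigma> < 1 \<Longrightarrow> r0 < \<sigma>' \<Longrightarrow> \<sigma>' < 1 \<Longrightarrow>
      cmean (\<lambda>\<zeta>. norm (f (of_real \<sigma> * \<zeta>) - f (of_real \<sigma>' * \<zeta>)) powr p) \<le> \<epsilon> powr p"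
    by blast
  \<comment> \<open>Every radius \<sigma> > r then satisfies both \<sigma> > r0 and r \<sigma> > r0,
    as the Cauchy estimate requires.\<close>
  define r where "r = sqrt r0"
  have r: "0 < r" "r < 1" "r * r = r0" using r0 by (auto simp: r_def)
  have r0r: "r0 < r" using r mult_strict_left_mono[of r 1 r] by simp
  have d: "(\<lambda>z. f (of_real r * z)) holomorphic_on ball 0 1"
  proof (rule holomorphic_on_compose_gen[OF _ h, unfolded o_def])
    have "r * norm w < 1" if "norm w < 1" for w :: complex
      using that r by (meson le_less_trans mult_left_le_one_le norm_ge_zero less_imp_le)
    then show "(*) (complex_of_real r) ` ball 0 1 \<subseteq> ball 0 1" using r by (auto simp: norm_mult)
  qed (intro holomorphic_intros)
  have hol: "(f - dilation r f) holomorphic_on ball 0 1"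
    by (rule holomorphic_transform[of "\<lambda>z. f z - f (of_real r * z)"])
       (auto intro!: holomorphic_intros h d simp: dilation_def)
  have z: "(f - dilation r f) z = 0" if "1 \<le> norm z" for z
    using hardy_outside[OF f that] that by (simp add: dilation_def)
  have b: "pmean p (f - dilation r f) s \<le> \<epsilon> powr p" if s: "0 < s" "s < 1" for s
  proof -
    \<comment> \<open>Monotonicity of the means allows a small radius \<open>s\<close> to be
      replaced by one beyond \<open>r\<close>.\<close>
    define \<sigma> where "\<sigma> = max s ((1 + r) / 2)"
    have \<sigma>: "r < \<sigma>" "\<sigma> < 1" "s \<le> \<sigma>" "0 < \<sigma>" using s r by (auto simp: \<sigma>_def less_max_iff_disj)
    have "pmean p (f - dilation r f) s \<le> pmean p (f - dilation r f) \<sigma>"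
      using \<sigma> s by (intro pmean_mono[OF hol p]) auto
    also have "\<dots> = cmean (\<lambda>\<zeta>. norm (f (of_real \<sigma> * \<zeta>) - f (of_real (r * \<sigma>) * \<zeta>)) powr p)"
      unfolding pmean_def using \<sigma> by (intro cmean_cong) (simp add: dilation_def norm_mult mult.assoc)
    also have "\<dots> \<le> \<epsilon> powr p"
    proof (rule r0(3))
      show "r0 < \<sigma>" "\<sigma> < 1" using \<sigma> r0r by auto
      have "r * r < r * \<sigma>" using \<sigma> r by (intro mult_strict_left_mono) auto
      then show "r0 < r * \<sigma>" using r by simp
      show "r * \<sigma> < 1" using \<sigma> r mult_strict_mono[of r 1 \<sigma> 1] by simp
    qed
    finally show ?thesis .
  qed
  show ?thesis using hardyI[OF hol z _ b] \<epsilon> r by (intro exI[of _ r]) auto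
qed

text \<open>Taylor polynomials are taken of a dilation of \<open>f\<close>: its series converges
  absolutely and uniformly on the disc, hence in H_p. The constant \<open>e\<close> splits
  \<epsilon>^p into two halves, since the triangle inequality holds for p-th powers.\<close>

lemma polynomials_dense:
  assumes f: "f \<in> hardy p" and \<epsilon>: "0 < \<epsilon>"
  shows "\<exists>a n. hardy_norm p (f - (\<Sum>i<n. fscale (a i) (disc_monom i))) \<le> \<epsilon>"
proof -
  define e where "e = (\<epsilon> powr p / 2) powr (1 / p)"
  have e: "e > 0" "e powr p = \<epsilon> powr p / 2" using \<epsilon> p by (auto simp: e_def powr_powr)
  obtain r where r: "0 < r" "r < 1" "f - dilation r f \<in> hardy p" "hardy_norm p (f - dilation r f) \<le> e"
    using dilation_tendsto[OF f e(1)] by blast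
  define c where "c n = (deriv ^^ n) f 0 / fact n" for n
  have sums: "(\<lambda>n. c n * w ^ n) sums f w" if "norm w < 1" for w
    using holomorphic_power_series[OF hardy_holomorphic[OF f], of w] that by (simp add: c_def)
  obtain s where s: "r < s" "s < 1" using r dense by blast
  have "summable (\<lambda>n. c n * (of_real s :: complex) ^ n)"
    using sums[of "of_real s"] s r by (auto simp: sums_iff)
  from powser_insidea[OF this, of "of_real r"] have summ: "summable (\<lambda>n. norm (c n * of_real r ^ n))"
    using s r by simp
  define a where "a n = c n * of_real r ^ n" for n
  have summ_a: "summable (\<lambda>n. norm (a n))" using summ by (simp add: a_def)
  obtain n where n: "norm (\<Sum>i. norm (a (i + n))) < e"
    using suminf_exist_split[OF e(1) summ_a] by blast
  define q where "q = (\<Sum>i<n. fscale (a i) (disc_monom i))"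
  have q: "q \<in> hardy p" unfolding q_def by (intro hardy_sum hardy_scale_le disc_monom_hardy)
  have "dilation r f - q \<in> hardy p \<and> hardy_norm p (dilation r f - q) \<le> e"
  proof -
    have "dilation r f \<in> hardy p"
      using hardy_diff[OF f r(3)] by simp
    then have m: "dilation r f - q \<in> hardy p" by (rule hardy_diff[OF _ q])
    have "norm ((dilation r f - q) z) \<le> e" if z: "norm z < 1" for z
    proof -
      have rz: "norm (of_real r * z) < 1" using z r by (simp add: norm_mult) (meson le_less_trans mult_left_le_one_le norm_ge_zero less_imp_le)
      have sm: "summable (\<lambda>i. a i * z ^ i)"
        using sums[OF rz] by (auto simp: sums_iff a_def power_mult_distrib mult_ac)
      have le: "norm (a i * z ^ i) \<le> norm (a i)" for i
        using z by (simp add: norm_mult norm_power mult_left_le power_le_one)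
      have "f (of_real r * z) = (\<Sum>i. a i * z ^ i)"
        using sums[OF rz] by (auto simp: sums_iff a_def power_mult_distrib mult_ac)
      also have "\<dots> = (\<Sum>i. a (i + n) * z ^ (i + n)) + (\<Sum>i<n. a i * z ^ i)"
        by (rule suminf_split_initial_segment[OF sm])
      finally have "(dilation r f - q) z = (\<Sum>i. a (i + n) * z ^ (i + n))"
        using z by (simp add: dilation_def q_def sum_fun_apply fscale_def disc_monom_def)
      also have "norm \<dots> \<le> (\<Sum>i. norm (a (i + n)))"
        by (rule norm_suminf_le[OF le summable_ignore_initial_segment[OF summ_a]])
      also have "\<dots> < e" using n by simp
      finally show ?thesis by simp
    qed
    from hardy_bounded(2)[of "dilation r f - q" e, OF hardy_holomorphic[OF m] hardy_outside[OF m] _ this] e(1) m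
    show ?thesis by (metis less_imp_le)
  qed
  then have "hardy_norm p ((f - dilation r f) + (dilation r f - q)) powr p
      \<le> hardy_norm p (f - dilation r f) powr p + hardy_norm p (dilation r f - q) powr p"
    using r by (intro hardy_add) auto
  also have "\<dots> \<le> e powr p + e powr p"
    using r p \<open>dilation r f - q \<in> hardy p \<and> hardy_norm p (dilation r f - q) \<le> e\<close>
    by (intro add_mono powr_mono2 hardy_norm_nonneg) auto
  also have "\<dots> = \<epsilon> powr p" using e by simp
  finally have "hardy_norm p (f - q) powr p \<le> \<epsilon> powr p" by simp
  then have "hardy_norm p (f - q) \<le> \<epsilon>"
    using p \<epsilon> by (meson less_le_not_le linorder_not_le powr_less_mono2)
  then show ?thesis unfolding q_def by blast
qed

end

section \<open>Weak type estimates for the hyperbolic area\<close>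

text \<open>Links the gauge integral behind \<open>cmean\<close> with the Lebesgue integral used for
  areas.\<close>

lemma nn_integral_continuous_interval:
  fixes F :: "real \<Rightarrow> real"
  assumes c: "continuous_on UNIV F" and "\<And>x. x \<in> {a..b} \<Longrightarrow> 0 \<le> F x"
  shows "(\<integral>\<^sup>+x. ennreal (F x) * indicator {a..b} x \<partial>lborel) = ennreal (integral {a..b} F)"
proof -
  define G where "G t = F t * indicator {a..b} t" for t
  have "(F has_integral integral {a..b} F) {a..b}"
    by (rule integrable_integral[OF integrable_continuous_interval[OF continuous_on_subset[OF c]]]) simp
  then have "((\<lambda>t. if t \<in> {a..b} then F t else 0) has_integral integral {a..b} F) UNIV"
    by (simp only: has_integral_restrict_UNIV)
  moreover have "(\<lambda>t. if t \<in> {a..b} then F t else 0) = G"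
    by (auto simp: G_def fun_eq_iff)
  ultimately have I: "(G has_integral integral {a..b} F) UNIV" by simp
  have m: "G \<in> borel_measurable borel"
    unfolding G_def using borel_measurable_continuous_onI[OF c] by measurable
  have "integral\<^sup>N lborel G = ennreal (integral {a..b} F)"
    by (rule nn_integral_has_integral_lborel[OF m _ I]) (use assms in \<open>auto simp: G_def split: split_indicator\<close>)
  also have "integral\<^sup>N lborel G = (\<integral>\<^sup>+x. ennreal (F x) * indicator {a..b} x \<partial>lborel)"
    by (intro nn_integral_cong) (auto simp: G_def split: split_indicator)
  finally show ?thesis by simp
qed

lemma nn_integral_cis:
  assumes F: "continuous_on (sphere 0 1) F" "\<And>z. norm z = 1 \<Longrightarrow> (0::real) \<le> F z"
  shows "(\<integral>\<^sup>+t. ennreal (F (cis t)) * indicator {0..2*pi} t \<partial>lborel) = ennreal (2 * pi * cmean F)"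
  using nn_integral_continuous_interval[OF continuous_on_cis_comp[OF F(1)], of 0 "2*pi"] F(2)
  by (simp add: cmean_def)

text \<open>The hyperbolic area on the disc, in polar coordinates.\<close>

definition hyp_weight :: "real \<times> real \<Rightarrow> real" where
  "hyp_weight x = indicator ({0<..<1} \<times> {0..2*pi}) x * (1 - fst x) powr (-2)"

text \<open>Up to bounded factors near the boundary this is the Moebius invariant area: the Jacobian
  r is dropped and 1 - r^2 is replaced by 1 - r.\<close>

definition hyp_measure :: "(real \<times> real) measure" where
  "hyp_measure = density lborel (\<lambda>x. ennreal (hyp_weight x))"

definition disc_point :: "real \<times> real \<Rightarrow> complex" where
  "disc_point x = of_real (fst x) * cis (snd x)"

text \<open>The exponent is that of the growth estimate, so at points of the disc the value stays
  below the norm of \<open>f\<close>.\<close>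

definition hyp_size :: "real \<Rightarrow> (complex \<Rightarrow> complex) \<Rightarrow> real \<times> real \<Rightarrow> real" where
  "hyp_size p f x = norm (f (disc_point x)) * (1 - fst x) powr (1 / p)"

lemma sets_hyp_measure [measurable_cong, simp]: "sets hyp_measure = sets borel"
  by (simp add: hyp_measure_def)

lemma space_hyp_measure [simp]: "space hyp_measure = UNIV"
  by (simp add: hyp_measure_def)

lemma borel_measurable_fst_snd [measurable]:
  "fst \<in> borel_measurable (borel :: (real \<times> real) measure)"
  "snd \<in> borel_measurable (borel :: (real \<times> real) measure)"
  by (intro borel_measurable_continuous_onI continuous_intros)+

lemma measurable_cis [measurable]: "cis \<in> borel_measurable borel"
  by (intro borel_measurable_continuous_onI continuous_intros)

lemma measurable_disc_point [measurable]: "disc_point \<in> borel_measurable borel"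
  unfolding disc_point_def[abs_def] by measurable

lemma measurable_hyp_weight [measurable]: "hyp_weight \<in> borel_measurable borel"
proof -
  have "({0<..<1} \<times> {0..2*pi}) \<in> sets (borel :: (real\<times>real) measure)"
    by (intro borel_Times) auto
  then have a: "indicat_real ({0<..<1} \<times> {0..2*pi}) \<in> borel_measurable (borel :: (real\<times>real) measure)"
    by (rule borel_measurable_indicator)
  have b: "(\<lambda>x::real\<times>real. (1 - fst x) powr (-2)) \<in> borel_measurable borel"
    by measurable
  show ?thesis unfolding hyp_weight_def[abs_def]
    by (rule borel_measurable_times[OF a b])
qed

lemma nn_integral_hyp_measure:
  assumes [measurable]: "g \<in> borel_measurable borel"
  shows "(\<integral>\<^sup>+x. g x \<partial>hyp_measure) = (\<integral>\<^sup>+r. \<integral>\<^sup>+t. ennreal (hyp_weight (r, t)) * g (r, t) \<partial>lborel \<partial>lborel)"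
proof -
  have "(\<integral>\<^sup>+x. g x \<partial>hyp_measure) = (\<integral>\<^sup>+x. ennreal (hyp_weight x) * g x \<partial>lborel)"
    unfolding hyp_measure_def by (subst nn_integral_density) auto
  also have "\<dots> = (\<integral>\<^sup>+x. ennreal (hyp_weight x) * g x \<partial>(lborel \<Otimes>\<^sub>M lborel))"
    by (simp add: lborel_prod)
  also have "\<dots> = (\<integral>\<^sup>+r. \<integral>\<^sup>+t. ennreal (hyp_weight (r, t)) * g (r, t) \<partial>lborel \<partial>lborel)"
    by (rule lborel.nn_integral_fst[symmetric]) (simp add: lborel_prod)
  finally show ?thesis .
qed

lemma AE_hyp_measure: "AE x in hyp_measure. 0 < fst x \<and> fst x < 1"
proof -
  have "(\<lambda>x. ennreal (hyp_weight x)) \<in> borel_measurable lborel" by measurable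
  then show ?thesis
    unfolding hyp_measure_def
    by (simp only: AE_density) (rule AE_I2, auto simp: hyp_weight_def indicator_def split: if_splits)
qed

text \<open>The radial integral of the Marcinkiewicz argument. The maximum is positive only for 1 -
  r > a = l^2 / (4 g^2), where it is at most \<open>g\<close>; what remains is the integral of (1 -
  r)^(-3/2) up to 1 - a, which is below 2 a^(-1/2) = 4 g / l. If a > 1 the integrand
  vanishes.\<close>

lemma radial_truncation_bound:
  fixes g l :: real
  assumes "0 \<le> g" "0 < l"
  shows "(\<integral>\<^sup>+r. ennreal (indicator {0<..<1} r * ((1 - r) powr (-2) * (2 / l * (1 - r) powr (1/2))
            * max 0 (g - l / 2 * (1 - r) powr (-1/2)))) \<partial>lborel) \<le> ennreal (8 * g\<^sup>2 / l\<^sup>2)"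
    (is "(\<integral>\<^sup>+r. ennreal (?h r) \<partial>lborel) \<le> _")
proof (cases "g = 0 \<or> 1 < l\<^sup>2 / (4 * g\<^sup>2)")
  case True
  have "max 0 (g - l / 2 * (1 - r) powr (-1/2)) = 0" if r: "r \<in> {0<..<1}" for r
  proof (cases "g = 0")
    case False
    have "g < l / 2"
    proof (rule power2_less_imp_less)
      show "g\<^sup>2 < (l / 2)\<^sup>2" using True False by (simp add: field_simps)
    qed (use assms in auto)
    also have "\<dots> \<le> l / 2 * (1 - r) powr (-1/2)"
      using powr_mono2'[of "-1/2" "1 - r" 1] r assms by simp
    finally show ?thesis by simp
  next
    case True
    have "0 \<le> l / 2 * (1 - r) powr (-1/2)" using assms by simp
    then show ?thesis using True by (simp add: max_absorb1)
  qed
  then have "(\<integral>\<^sup>+r. ennreal (?h r) \<partial>lborel) = (\<integral>\<^sup>+r. 0 \<partial>(lborel :: real measure))"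
    by (intro nn_integral_cong) (auto split: split_indicator)
  then show ?thesis by simp
next
  case False
  then have g: "0 < g" using assms by auto
  define a where "a = l\<^sup>2 / (4 * g\<^sup>2)"
  have a: "0 < a" "a \<le> 1" using False g assms by (auto simp: a_def)
  have sa: "a powr (1/2) = l / (2 * g)"
    using g assms by (simp add: a_def powr_half_sqrt real_sqrt_divide real_sqrt_mult)
  define F where "F r = 2 * (1 - r) powr (-1/2)" for r :: real
  have "(\<integral>\<^sup>+r. ennreal (?h r) \<partial>lborel)
      \<le> (\<integral>\<^sup>+r. ennreal (2 * g / l) * (ennreal ((1 - r) powr (-3/2)) * indicator {0..1 - a} r) \<partial>lborel)"
  proof (rule nn_integral_mono)
    fix r :: real
    have "?h r \<le> 2 * g / l * ((1 - r) powr (-3/2) * indicator {0..1 - a} r)"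
    proof (cases "r \<in> {0<..<1}")
      case True
      then have r: "0 < r" "r < 1" by auto
      have e: "(1 - r) powr (-2) * (2 / l * (1 - r) powr (1/2)) = 2 / l * (1 - r) powr (-3/2)"
        using r by (simp add: powr_add[symmetric])
      show ?thesis
      proof (cases "r \<le> 1 - a")
        case True
        have "max 0 (g - l / 2 * (1 - r) powr (-1/2)) \<le> g"
          using g assms by (simp add: max_def)
        then have "2 / l * (1 - r) powr (-3/2) * max 0 (g - l / 2 * (1 - r) powr (-1/2)) \<le> 2 / l * (1 - r) powr (-3/2) * g"
          using assms by (intro mult_left_mono) auto
        then show ?thesis unfolding e using True r by (simp add: mult_ac)
      next
        case False
        have "(1 - r) powr (1/2) \<le> a powr (1/2)" using False r by (intro powr_mono2) auto
        then have "(1 - r) powr (1/2) * (2 * g) \<le> l" using sa g by (simp add: field_simps)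
        then have "(1 - r) powr (1/2) * (2 * g) * (1 - r) powr (-1/2) \<le> l * (1 - r) powr (-1/2)"
          by (rule mult_right_mono) simp
        moreover have "(1 - r) powr (1/2) * (2 * g) * (1 - r) powr (-1/2) = 2 * g"
        proof -
          have "(1 - r) powr (1/2) * (1 - r) powr (-1/2) = 1"
            using r by (simp flip: powr_add)
          then have "2 * g * ((1 - r) powr (1/2) * (1 - r) powr (-1/2)) = 2 * g" by (simp only: mult_1_right)
          then show ?thesis by (simp only: mult_ac)
        qed
        ultimately have "2 * g \<le> l * (1 - r) powr (-1/2)" by (simp only:)
        then have "g - l / 2 * (1 - r) powr (-1/2) \<le> 0" by simp
        then show ?thesis using False by simp
      qed
    qed (use assms g in auto)
    moreover have "ennreal (2 * g / l) * (ennreal ((1 - r) powr (-3/2)) * indicator {0..1 - a} r)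
        = ennreal (2 * g / l * ((1 - r) powr (-3/2) * indicator {0..1 - a} r))"
      using assms by (subst ennreal_mult) (auto split: split_indicator)
    ultimately show "ennreal (?h r) \<le> ennreal (2 * g / l) * (ennreal ((1 - r) powr (-3/2)) * indicator {0..1 - a} r)"
      by (simp only: ennreal_leI)
  qed
  also have "\<dots> = ennreal (2 * g / l) * (\<integral>\<^sup>+r. ennreal ((1 - r) powr (-3/2)) * indicator {0..1 - a} r \<partial>lborel)"
    by (rule nn_integral_cmult) auto
  also have "(\<integral>\<^sup>+r. ennreal ((1 - r) powr (-3/2)) * indicator {0..1 - a} r \<partial>lborel) = F (1 - a) - F 0"
  proof (rule nn_integral_FTC_Icc)
    fix r assume "r \<in> {0..1 - a}"
    then have "r < 1" using a by auto
    then show "(F has_real_derivative (1 - r) powr (-3/2)) (at r)"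
      unfolding F_def by (auto intro!: derivative_eq_intros)
  qed (use a in auto)
  also have "F (1 - a) - F 0 \<le> 4 * g / l"
  proof -
    have "a powr (-1/2) = 2 * g / l"
      using sa g assms by (simp add: powr_minus_divide)
    then show ?thesis using a by (simp add: F_def)
  qed
  also have "ennreal (2 * g / l) * ennreal (4 * g / l) = ennreal (8 * g\<^sup>2 / l\<^sup>2)"
    using g assms by (simp add: ennreal_mult[symmetric] power2_eq_square)
  finally show ?thesis by (simp add: mult_left_mono ennreal_leI)
qed

text \<open>Passing to g = |f|^(p/2) turns the p-th mean into a mean of squares, and g <= c + E with
  E = max 0 (g - c). The height \<open>c\<close> is half the threshold for g, so on the set in
  question the Poisson mean of \<open>E\<close> must supply the other half. Chebyshev's inequality
  reduces the measure to the mean of \<open>E\<close>, from which rotation invariance removes the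
  automorphism.\<close>

lemma hyp_weak_type_dilated:
  fixes p l R :: real
  assumes f: "f holomorphic_on ball 0 1" and p: "0 < p" "p \<le> 1" and R: "0 < R" "R < 1" and l: "0 < l"
  shows "(\<integral>\<^sup>+r. \<integral>\<^sup>+t. ennreal (hyp_weight (r, t)) *
      indicator {x. l < norm (f (of_real R * disc_point x)) * (1 - fst x) powr (1 / p)} (r, t) \<partial>lborel \<partial>lborel)
    \<le> ennreal (16 * pi * pmean p f R / l powr p)"
    (is "(\<integral>\<^sup>+r. \<integral>\<^sup>+t. ?w r t \<partial>lborel \<partial>lborel) \<le> _")
proof -
  define m where "m = l powr (p / 2)"
  have m: "0 < m" "m\<^sup>2 = l powr p"
    using l by (auto simp: m_def power2_eq_square powr_add[symmetric])
  define g where "g \<zeta> = norm (f (of_real R * \<zeta>)) powr (p / 2)" for \<zeta>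
  have g0: "0 \<le> g \<zeta>" for \<zeta> by (simp add: g_def)
  have cg: "continuous_on (sphere 0 1) g"
    unfolding g_def using R p by (intro continuous_on_dilation_powr[OF f p]) auto
  have cgt: "continuous_on UNIV (\<lambda>t. g (cis t))" by (rule continuous_on_cis_comp[OF cg])
  have [measurable]: "(\<lambda>t. g (cis t)) \<in> borel_measurable borel"
    by (rule borel_measurable_continuous_onI[OF cgt])
  define c where "c r = m / 2 * (1 - r) powr (-1/2)" for r
  define E where "E \<zeta> r = max 0 (g \<zeta> - c r)" for \<zeta> r
  have cE: "continuous_on (sphere 0 1) (\<lambda>\<zeta>. E \<zeta> r)" for r
    unfolding E_def by (intro continuous_intros cg)
  \<comment> \<open>The hyperbolic density (1 - r)^(-2) divided by the height
    \<open>c r\<close>.\<close>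
  define k where "k r = (1 - r) powr (-2) * (2 / m * (1 - r) powr (1/2))" for r
  have inner: "(\<integral>\<^sup>+t. ?w r t \<partial>lborel)
    \<le> (\<integral>\<^sup>+t. ennreal (indicator {0<..<1} r * (k r * E (cis t) r)) * indicator {0..2*pi} t \<partial>lborel)" for r
  proof (cases "r \<in> {0<..<1}")
    case True
    then have r: "0 < r" "r < 1" "0 \<le> r" by auto
    define U where "U \<zeta> = cmean (\<lambda>w. E (\<zeta> * disc_moebius r w) r)" for \<zeta>
    have "continuous_on (sphere 0 1 \<times> sphere 0 1) (\<lambda>x. E (fst x * disc_moebius r (snd x)) r)"
      unfolding E_def g_def using R p
      by (intro continuous_intros continuous_on_twist[OF continuous_on_dilation[OF f p] r(3,2)]) auto
    note ct = this
    have cU: "continuous_on (sphere 0 1) U"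
      unfolding U_def using ct by (intro continuous_on_cmean) (simp add: case_prod_unfold)
    have U0: "0 \<le> U \<zeta>" if "norm \<zeta> = 1" for \<zeta>
      unfolding U_def
      by (intro cmean_nonneg continuous_on_slice[OF ct that]) (auto simp: E_def)
    have meanU: "cmean U = cmean (\<lambda>\<zeta>. E \<zeta> r)"
      unfolding U_def by (rule cmean_disc_moebius[OF cE r(3,2)])
    define d where "d = 1 / c r"
    have cr: "0 < c r" using m r by (simp add: c_def)
    have step: "hyp_weight (r, t) * indicator {x. l < norm (f (of_real R * disc_point x)) * (1 - fst x) powr (1 / p)} (r, t)
        \<le> (1 - r) powr (-2) * (d * U (cis t)) * indicator {0..2*pi} t" for t
    proof (cases "l < norm (f (of_real R * disc_point (r, t))) * (1 - r) powr (1 / p)")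
      case True
      define \<zeta> where "\<zeta> = cis t"
      have z: "norm \<zeta> = 1" by (simp add: \<zeta>_def)
      define h where "h = norm (f (of_real (R * r) * \<zeta>)) powr (p / 2)"
      have "l powr (p / 2) \<le> (norm (f (of_real (R * r) * \<zeta>)) * (1 - r) powr (1 / p)) powr (p / 2)"
        using True l p by (intro powr_mono2) (auto simp: disc_point_def \<zeta>_def mult.assoc)
      also have "\<dots> = h * (1 - r) powr (1 / 2)"
        using p r by (simp add: powr_mult powr_powr h_def)
      finally have "m \<le> h * (1 - r) powr (1 / 2)" by (simp add: m_def)
      then have "m * (1 - r) powr (-1/2) \<le> h"
        using r by (simp add: powr_minus_divide field_simps)
      then have "2 * c r \<le> h" by (simp add: c_def)
      also have "h \<le> cmean (\<lambda>w. g (\<zeta> * disc_moebius r w))"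
        unfolding h_def g_def using R r p z
        by (intro pmean_growth_integrated[OF f p]) auto
      also have "\<dots> \<le> cmean (\<lambda>w. c r + E (\<zeta> * disc_moebius r w) r)"
      proof (rule cmean_mono)
        have "continuous_on (sphere 0 1 \<times> sphere 0 1) (\<lambda>x. g (fst x * disc_moebius r (snd x)))"
          unfolding g_def using R p
          by (intro continuous_intros continuous_on_twist[OF continuous_on_dilation[OF f p] r(3,2)]) auto
        from continuous_on_slice[OF this z]
        show "continuous_on (sphere 0 1) (\<lambda>w. g (\<zeta> * disc_moebius r w))" .
        show "continuous_on (sphere 0 1) (\<lambda>w. c r + E (\<zeta> * disc_moebius r w) r)"
          by (intro continuous_intros continuous_on_slice[OF ct z])
      qed (simp add: E_def)
      also have "\<dots> = c r + U \<zeta>"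
        unfolding U_def using cmean_add[OF continuous_on_const continuous_on_slice[OF ct z]] by simp
      finally have "1 \<le> d * U \<zeta>" using cr by (simp add: d_def field_simps)
      then have "(1 - r) powr (-2) * 1 * indicator {0..2*pi} t \<le> (1 - r) powr (-2) * (d * U \<zeta>) * indicator {0..2*pi} t"
        by (intro mult_right_mono mult_left_mono) auto
      then show ?thesis using True r by (auto simp: hyp_weight_def \<zeta>_def split: split_indicator)
    next
      case False
      then show ?thesis using U0[of "cis t"] cr by (auto simp: d_def)
    qed
    have dk: "(1 - r) powr (-2) * d = k r"
      using m r by (simp add: d_def k_def c_def powr_minus_divide)
    have "(\<integral>\<^sup>+t. ?w r t \<partial>lborel)
      \<le> (\<integral>\<^sup>+t. ennreal (k r * U (cis t)) * indicator {0..2*pi} t \<partial>lborel)"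
    proof (rule nn_integral_mono)
      fix t
      have "?w r t
        = ennreal (hyp_weight (r, t) *
          indicator {x. l < norm (f (of_real R * disc_point x)) * (1 - fst x) powr (1 / p)} (r, t))"
        by (auto split: split_indicator)
      also have "\<dots> \<le> ennreal ((1 - r) powr (-2) * (d * U (cis t)) * indicator {0..2*pi} t)"
        by (rule ennreal_leI[OF step])
      also have "\<dots> = ennreal (k r * U (cis t)) * indicator {0..2*pi} t"
        by (auto simp: dk[symmetric] mult_ac split: split_indicator)
      finally show "?w r t
          \<le> ennreal (k r * U (cis t)) * indicator {0..2*pi} t" .
    qed
    also have "\<dots> = ennreal (2 * pi * cmean (\<lambda>\<zeta>. k r * U \<zeta>))"
      using m U0 by (intro nn_integral_cis continuous_intros cU) (auto simp: k_def)
    also have "cmean (\<lambda>\<zeta>. k r * U \<zeta>) = cmean (\<lambda>\<zeta>. k r * E \<zeta> r)"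
      by (simp add: cmean_mult_left meanU)
    also have "ennreal (2 * pi * cmean (\<lambda>\<zeta>. k r * E \<zeta> r)) = (\<integral>\<^sup>+t. ennreal (k r * E (cis t) r) * indicator {0..2*pi} t \<partial>lborel)"
      using m by (intro nn_integral_cis[symmetric] continuous_intros cE) (auto simp: k_def E_def)
    finally show ?thesis using True by simp
  next
    case False
    then have "hyp_weight (r, t) = 0" for t by (auto simp: hyp_weight_def)
    then show ?thesis by simp
  qed
  have "(\<integral>\<^sup>+r. \<integral>\<^sup>+t. ?w r t \<partial>lborel \<partial>lborel)
    \<le> (\<integral>\<^sup>+r. \<integral>\<^sup>+t. ennreal (indicator {0<..<1} r * (k r * E (cis t) r)) * indicator {0..2*pi} t \<partial>lborel \<partial>lborel)"
    by (intro nn_integral_mono inner)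
  \<comment> \<open>Integrating in r first turns the truncation into the square of \<open>g\<close>;
    the final 16 pi is 2 pi times the 8 of the radial integral.\<close>
  also have "\<dots> = (\<integral>\<^sup>+t. \<integral>\<^sup>+r. ennreal (indicator {0<..<1} r * (k r * E (cis t) r)) * indicator {0..2*pi} t \<partial>lborel \<partial>lborel)"
    by (rule lborel_pair.Fubini'[symmetric]) (simp add: E_def k_def c_def, measurable)
  also have "\<dots> \<le> (\<integral>\<^sup>+t. ennreal (8 / m\<^sup>2 * (g (cis t))\<^sup>2) * indicator {0..2*pi} t \<partial>lborel)"
  proof (rule nn_integral_mono)
    fix t
    have "(\<integral>\<^sup>+r. ennreal (indicator {0<..<1} r * (k r * E (cis t) r)) * indicator {0..2*pi} t \<partial>lborel)
      = (\<integral>\<^sup>+r. ennreal (indicator {0<..<1} r * (k r * E (cis t) r)) \<partial>lborel) * indicator {0..2*pi} t"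
      by (rule nn_integral_multc) (simp add: E_def k_def c_def)
    also have "(\<integral>\<^sup>+r. ennreal (indicator {0<..<1} r * (k r * E (cis t) r)) \<partial>lborel) \<le> ennreal (8 * (g (cis t))\<^sup>2 / m\<^sup>2)"
      using radial_truncation_bound[OF g0[of "cis t"] m(1)] by (simp add: k_def E_def c_def)
    finally show "(\<integral>\<^sup>+r. ennreal (indicator {0<..<1} r * (k r * E (cis t) r)) * indicator {0..2*pi} t \<partial>lborel)
      \<le> ennreal (8 / m\<^sup>2 * (g (cis t))\<^sup>2) * indicator {0..2*pi} t"
      by (simp add: mult_right_mono)
  qed
  also have "\<dots> = ennreal (2 * pi * cmean (\<lambda>\<zeta>. 8 / m\<^sup>2 * (g \<zeta>)\<^sup>2))"
    by (intro nn_integral_cis continuous_intros cg) auto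
  also have "cmean (\<lambda>\<zeta>. 8 / m\<^sup>2 * (g \<zeta>)\<^sup>2) = 8 / m\<^sup>2 * pmean p f R"
  proof -
    have "(g \<zeta>)\<^sup>2 = norm (f (of_real R * \<zeta>)) powr p" for \<zeta>
      by (simp add: g_def power2_eq_square powr_add[symmetric])
    then show ?thesis unfolding pmean_def cmean_mult_left by simp
  qed
  finally show ?thesis by (simp add: m mult_ac)
qed

context
  fixes p :: real
  assumes p: "0 < p" "p < 1"
begin

lemma exponent_bounds: "0 < p" "p \<le> 1" using p by auto

lemma measurable_hardy [measurable_dest]:
  assumes f: "f \<in> hardy p"
  shows "f \<in> borel_measurable borel"
proof -
  have "(\<lambda>x. indicator (ball 0 1) x *\<^sub>R f x) \<in> borel_measurable borel"
    by (rule borel_measurable_continuous_on_indicator)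
       (auto intro: holomorphic_on_imp_continuous_on hardy_holomorphic[OF exponent_bounds f])
  also have "(\<lambda>x. indicator (ball 0 1) x *\<^sub>R f x) = f"
    using hardy_outside[OF exponent_bounds f] by (auto simp: fun_eq_iff indicator_def)
  finally show ?thesis .
qed

lemma measurable_hyp_size:
  assumes f: "f \<in> hardy p"
  shows "hyp_size p f \<in> borel_measurable borel"
proof -
  have [measurable]: "f \<in> borel_measurable borel" by (rule measurable_hardy[OF f])
  show ?thesis unfolding hyp_size_def[abs_def] by measurable
qed

text \<open>Fatou's lemma lets the dilation tend to the identity: the inequality defining the set is
  strict, so at each of its points it persists for all large \<open>n\<close>.\<close>

lemma hyp_weak_type:
  assumes f: "f \<in> hardy p" and l: "0 < l"
  shows "emeasure hyp_measure {x. l < hyp_size p f x} \<le> ennreal (16 * pi * hardy_norm p f powr p / l powr p)"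
proof -
  have [measurable]: "f \<in> borel_measurable borel" "hyp_size p f \<in> borel_measurable borel"
    by (rule measurable_hardy[OF f] measurable_hyp_size[OF f])+
  define R where "R n = 1 - 1 / (real n + 2)" for n
  have R: "0 < R n" "R n < 1" for n by (auto simp: R_def field_simps)
  have R1: "R \<longlonglongrightarrow> 1"
  proof -
    have "(\<lambda>n. 1 / (real n + 2)) \<longlonglongrightarrow> 0"
      using LIMSEQ_ignore_initial_segment[OF lim_1_over_n, of 2] by (simp add: add.commute)
    from tendsto_diff[OF tendsto_const[of 1] this] show ?thesis by (simp add: R_def[abs_def])
  qed
  define S where "S n = {x. l < norm (f (of_real (R n) * disc_point x)) * (1 - fst x) powr (1 / p)}" for n
  have [measurable]: "S n \<in> sets borel" for n unfolding S_def by measurable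
  have S: "emeasure hyp_measure (S n) \<le> ennreal (16 * pi * hardy_norm p f powr p / l powr p)" for n
  proof -
    have "emeasure hyp_measure (S n) = (\<integral>\<^sup>+x. indicator (S n) x \<partial>hyp_measure)" by simp
    also have "\<dots> = (\<integral>\<^sup>+r. \<integral>\<^sup>+t. ennreal (hyp_weight (r, t)) * indicator (S n) (r, t) \<partial>lborel \<partial>lborel)"
      by (rule nn_integral_hyp_measure) measurable
    also have "\<dots> \<le> ennreal (16 * pi * pmean p f (R n) / l powr p)"
      unfolding S_def by (rule hyp_weak_type_dilated[OF hardy_holomorphic[OF exponent_bounds f] exponent_bounds R l])
    also have "\<dots> \<le> ennreal (16 * pi * hardy_norm p f powr p / l powr p)"
      using R pmean_le_hardy_norm[OF exponent_bounds f, of "R n"]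
      by (intro ennreal_leI divide_right_mono mult_left_mono) auto
    finally show ?thesis .
  qed
  have "emeasure hyp_measure {x. l < hyp_size p f x} = (\<integral>\<^sup>+x. indicator {x. l < hyp_size p f x} x \<partial>hyp_measure)"
    by (subst nn_integral_indicator) auto
  also have "\<dots> \<le> (\<integral>\<^sup>+x. liminf (\<lambda>n. indicator (S n) x) \<partial>hyp_measure)"
  proof (rule nn_integral_mono_AE)
    show "AE x in hyp_measure. (indicator {x. l < hyp_size p f x} x :: ennreal) \<le> liminf (\<lambda>n. indicator (S n) x)"
      using AE_hyp_measure
    proof eventually_elim
      case (elim x)
      show ?case
      proof (cases "l < hyp_size p f x")
        case True
        have "isCont f (disc_point x)"
          using holomorphic_on_imp_continuous_on[OF hardy_holomorphic[OF exponent_bounds f]] elim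
          by (simp add: continuous_on_eq_continuous_at disc_point_def norm_mult)
        moreover have "(\<lambda>n. of_real (R n) * disc_point x) \<longlonglongrightarrow> disc_point x"
          using tendsto_mult[OF tendsto_of_real[OF R1] tendsto_const[of "disc_point x"]] by simp
        ultimately have "(\<lambda>n. f (of_real (R n) * disc_point x)) \<longlonglongrightarrow> f (disc_point x)"
          by (rule isCont_tendsto_compose)
        then have "(\<lambda>n. norm (f (of_real (R n) * disc_point x)) * (1 - fst x) powr (1 / p)) \<longlonglongrightarrow> hyp_size p f x"
          unfolding hyp_size_def by (intro tendsto_intros)
        from order_tendstoD(1)[OF this True] have "\<forall>\<^sub>F n in sequentially. 1 \<le> (indicator (S n) x :: ennreal)"
          by eventually_elim (simp add: S_def)
        then have "1 \<le> liminf (\<lambda>n. indicator (S n) x :: ennreal)"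
          by (rule Liminf_bounded)
        then show ?thesis by (auto simp: indicator_def)
      qed auto
    qed
  qed
  also have "\<dots> \<le> liminf (\<lambda>n. \<integral>\<^sup>+x. indicator (S n) x \<partial>hyp_measure)"
    by (rule nn_integral_liminf) measurable
  also have "\<dots> = liminf (\<lambda>n. emeasure hyp_measure (S n))" by simp
  also have "\<dots> \<le> limsup (\<lambda>n. emeasure hyp_measure (S n))"
    by (rule Liminf_le_Limsup) simp
  also have "\<dots> \<le> ennreal (16 * pi * hardy_norm p f powr p / l powr p)"
    using S by (intro Limsup_bounded) auto
  finally show ?thesis .
qed

text \<open>On the dyadic layer at height e_j = d 2^(-j) the weak type bound contributes a multiple
  of e_j^(1 - p). For p < 1 these sum geometrically with ratio \<open>q\<close>, and the total tends
  to 0 with d.\<close>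

lemma hyp_layer_bound:
  shows "\<exists>C>0. \<forall>f\<in>hardy p. \<forall>d>0.
    (\<integral>\<^sup>+x. ennreal (hyp_size p f x * indicator {x. hyp_size p f x \<le> d} x) \<partial>hyp_measure)
      \<le> ennreal (C * d powr (1 - p) * hardy_norm p f powr p)"
proof -
  define q where "q = (1/2::real) powr (1 - p)"
  have q: "0 < q" "q < 1"
    using powr_less_mono2[of "1 - p" "1/2" 1] p by (auto simp: q_def)
  define C where "C = 16 * pi * 2 powr p / (1 - q)"
  have C: "C > 0" using q by (simp add: C_def)
  have "(\<integral>\<^sup>+x. ennreal (hyp_size p f x * indicator {x. hyp_size p f x \<le> d} x) \<partial>hyp_measure)
      \<le> ennreal (C * d powr (1 - p) * hardy_norm p f powr p)" if f: "f \<in> hardy p" and d: "0 < d" for f d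
  proof -
    have [measurable]: "hyp_size p f \<in> borel_measurable borel" by (rule measurable_hyp_size[OF f])
    define e where "e j = d * (1/2) ^ j" for j :: nat
    have e: "0 < e j" for j using d by (simp add: e_def)
    define S where "S j = {x. e (Suc j) < hyp_size p f x}" for j
    have [measurable]: "S j \<in> sets borel" for j unfolding S_def by measurable
    have v0: "0 \<le> hyp_size p f x" for x by (simp add: hyp_size_def)
    have pt: "ennreal (hyp_size p f x * indicator {x. hyp_size p f x \<le> d} x) \<le> (\<Sum>j. ennreal (e j) * indicator (S j) x)" for x
    proof (cases "0 < hyp_size p f x \<and> hyp_size p f x \<le> d")
      case True
      define v where "v = hyp_size p f x"
      have v: "0 < v" "v \<le> d" using True by (auto simp: v_def)
      have "e \<longlonglongrightarrow> d * 0" unfolding e_def[abs_def] by (intro tendsto_intros LIMSEQ_realpow_zero) auto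
      then have "\<forall>\<^sub>F n in sequentially. e n < v" using v by (intro order_tendstoD) auto
      then have ex: "\<exists>n. e n < v" by (auto dest: eventually_happens)
      define n where "n = (LEAST n. e n < v)"
      have n: "e n < v" unfolding n_def using ex by (rule LeastI_ex)
      have "n \<noteq> 0" using n v by (auto simp: e_def intro: gr0I)
      then obtain j where j: "n = Suc j" by (cases n) auto
      have "\<not> e j < v" using not_less_Least[of j "\<lambda>n. e n < v"] j by (auto simp: n_def[symmetric])
      then have "ennreal v \<le> ennreal (e j) * indicator (S j) x"
        using n j by (auto simp: S_def v_def ennreal_leI)
      also have "\<dots> \<le> (\<Sum>j. ennreal (e j) * indicator (S j) x)"
      proof -
        define F where "F j = ennreal (e j) * indicator (S j) x" for j
        have "sum F {j} \<le> suminf F" by (rule sum_le_suminf) auto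
        then have "F j \<le> suminf F" by simp
        then show ?thesis unfolding F_def[abs_def] .
      qed
      finally show ?thesis using v by (simp add: v_def)
    next
      case False
      then have "hyp_size p f x * indicator {x. hyp_size p f x \<le> d} x = 0"
        using v0[of x] by (auto simp: indicator_def)
      then have "ennreal (hyp_size p f x * indicator {x. hyp_size p f x \<le> d} x) = 0"
        by (simp only: ennreal_0)
      then show ?thesis by (simp only: zero_le)
    qed
    define M where "M = 16 * pi * hardy_norm p f powr p"
    have M: "0 \<le> M" by (simp add: M_def)
    have "(\<integral>\<^sup>+x. ennreal (hyp_size p f x * indicator {x. hyp_size p f x \<le> d} x) \<partial>hyp_measure)
      \<le> (\<integral>\<^sup>+x. (\<Sum>j. ennreal (e j) * indicator (S j) x) \<partial>hyp_measure)"
      by (intro nn_integral_mono pt)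
    also have "\<dots> = (\<Sum>j. \<integral>\<^sup>+x. ennreal (e j) * indicator (S j) x \<partial>hyp_measure)"
      by (rule nn_integral_suminf) measurable
    also have "\<dots> = (\<Sum>j. ennreal (e j) * emeasure hyp_measure (S j))"
      by (simp add: nn_integral_cmult)
    also have "\<dots> \<le> (\<Sum>j. ennreal (d powr (1 - p) * (2 powr p * M) * q ^ j))"
    proof (rule suminf_le)
      fix j
      have "ennreal (e j) * emeasure hyp_measure (S j) \<le> ennreal (e j) * ennreal (M / e (Suc j) powr p)"
        unfolding S_def M_def by (intro mult_left_mono hyp_weak_type[OF f e]) simp
      also have "\<dots> = ennreal (e j * (M / e (Suc j) powr p))"
        using e[of j] by (subst ennreal_mult'') (auto simp: M)
      also have "e j * (M / e (Suc j) powr p) = d powr (1 - p) * (2 powr p * M) * q ^ j"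
      proof -
        have half: "e (Suc j) = e j / 2" by (simp add: e_def)
        have "e j * (M / e (Suc j) powr p) = (e j powr 1 / e j powr p) * (2 powr p * M)"
          unfolding half using e[of j] by (simp add: powr_divide)
        also have "e j powr 1 / e j powr p = e j powr (1 - p)" by (rule powr_diff[symmetric])
        also have "e j powr (1 - p) = d powr (1 - p) * q ^ j"
          using d by (simp add: e_def q_def powr_mult powr_powr mult.commute flip: powr_realpow)
        finally show ?thesis by simp
      qed
      finally show "ennreal (e j) * emeasure hyp_measure (S j) \<le> ennreal (d powr (1 - p) * (2 powr p * M) * q ^ j)" .
    qed auto
    also have "\<dots> = ennreal (d powr (1 - p) * (2 powr p * M) * (1 / (1 - q)))"
      using q M by (intro suminf_ennreal_eq sums_mult geometric_sums) auto
    also have "d powr (1 - p) * (2 powr p * M) * (1 / (1 - q)) = C * d powr (1 - p) * hardy_norm p f powr p"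
      by (simp add: C_def M_def)
    finally show ?thesis .
  qed
  then show ?thesis using C by blast
qed

lemma hyp_size_le:
  assumes f: "f \<in> hardy p" and elim: "0 < fst x" "fst x < 1"
  shows "hyp_size p f x \<le> hardy_norm p f"
proof -
  define N where "N = hardy_norm p f"
  have N: "0 \<le> N" unfolding N_def by (rule hardy_norm_nonneg[OF exponent_bounds f])
  have nd: "norm (disc_point x) = fst x" using elim by (simp add: disc_point_def norm_mult)
  have "norm (f (disc_point x)) powr p * (1 - fst x) \<le> N powr p"
    using hardy_growth[OF exponent_bounds f, of "disc_point x"] elim by (simp add: nd N_def)
  then have "(norm (f (disc_point x)) powr p * (1 - fst x)) powr (1 / p) \<le> (N powr p) powr (1 / p)"
    using p elim by (intro powr_mono2) auto
  then show ?thesis using p N elim by (simp add: hyp_size_def powr_mult powr_powr N_def)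
qed

lemma AE_hyp_size_le: "f \<in> hardy p \<Longrightarrow> AE x in hyp_measure. hyp_size p f x \<le> hardy_norm p f"
  using AE_hyp_measure by eventually_elim (simp add: hyp_size_le)

text \<open>\<open>hyp_size\<close> is almost everywhere at most the norm, so the layer below d =
  \<open>hardy_norm p f\<close> is everything.\<close>

lemma hyp_total_bound:
  shows "\<exists>C>0. \<forall>f\<in>hardy p. (\<integral>\<^sup>+x. ennreal (hyp_size p f x) \<partial>hyp_measure) \<le> ennreal (C * hardy_norm p f)"
proof -
  obtain C where C: "C > 0" "\<And>f d. f \<in> hardy p \<Longrightarrow> 0 < d \<Longrightarrow>
    (\<integral>\<^sup>+x. ennreal (hyp_size p f x * indicator {x. hyp_size p f x \<le> d} x) \<partial>hyp_measure)
      \<le> ennreal (C * d powr (1 - p) * hardy_norm p f powr p)"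
    using hyp_layer_bound by blast
  have "(\<integral>\<^sup>+x. ennreal (hyp_size p f x) \<partial>hyp_measure) \<le> ennreal (C * hardy_norm p f)" if f: "f \<in> hardy p" for f
  proof (cases "hardy_norm p f = 0")
    case True
    have "AE x in hyp_measure. ennreal (hyp_size p f x) = 0"
      using AE_hyp_size_le[OF f] by eventually_elim (simp add: True ennreal_neg)
    then have "(\<integral>\<^sup>+x. ennreal (hyp_size p f x) \<partial>hyp_measure) = (\<integral>\<^sup>+x. 0 \<partial>hyp_measure)"
      by (rule nn_integral_cong_AE)
    then show ?thesis by simp
  next
    case False
    then have N: "0 < hardy_norm p f" using hardy_norm_nonneg[OF exponent_bounds f] by simp
    have "AE x in hyp_measure. ennreal (hyp_size p f x)
        = ennreal (hyp_size p f x * indicator {x. hyp_size p f x \<le> hardy_norm p f} x)"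
      using AE_hyp_size_le[OF f] by eventually_elim simp
    then have "(\<integral>\<^sup>+x. ennreal (hyp_size p f x) \<partial>hyp_measure)
        = (\<integral>\<^sup>+x. ennreal (hyp_size p f x * indicator {x. hyp_size p f x \<le> hardy_norm p f} x) \<partial>hyp_measure)"
      by (rule nn_integral_cong_AE)
    also have "\<dots> \<le> ennreal (C * hardy_norm p f powr (1 - p) * hardy_norm p f powr p)"
      by (rule C(2)[OF f N])
    also have "C * hardy_norm p f powr (1 - p) * hardy_norm p f powr p = C * hardy_norm p f"
      using N by (simp add: mult.assoc powr_add[symmetric])
    finally show ?thesis .
  qed
  then show ?thesis using C(1) by blast
qed

end

section \<open>Reproducing kernels and bounded functionals\<close>

lemma cmean_uniform_limit:
  fixes F :: "nat \<Rightarrow> complex \<Rightarrow> complex"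
  assumes u: "uniform_limit (sphere 0 1) F G sequentially"
    and c: "\<And>n. continuous_on (sphere 0 1) (F n)"
  shows "(\<lambda>n. cmean (F n)) \<longlonglongrightarrow> cmean G"
proof (rule tendstoI)
  fix e :: real assume e: "0 < e"
  have cG: "continuous_on (sphere 0 1) G"
    by (rule uniform_limit_theorem[OF _ u]) (use c in auto)
  have "\<forall>\<^sub>F n in sequentially. \<forall>z\<in>sphere 0 1. dist (F n z) (G z) < e / 2"
    using uniform_limitD[OF u, of "e / 2"] e by simp
  then show "\<forall>\<^sub>F n in sequentially. dist (cmean (F n)) (cmean G) < e"
  proof eventually_elim
    case (elim n)
    have "norm (cmean (\<lambda>z. F n z - G z)) \<le> cmean (\<lambda>z. norm (F n z - G z))"
      by (intro norm_cmean_le continuous_intros c cG)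
    also have "\<dots> \<le> cmean (\<lambda>_. e / 2)"
      using elim by (intro cmean_mono continuous_intros c cG) (auto simp: dist_norm less_imp_le)
    finally show ?case using e by (simp add: dist_norm cmean_diff[OF c cG])
  qed
qed

lemma cmean_cnj:
  assumes "continuous_on (sphere 0 1) F"
  shows "cmean (\<lambda>z. cnj (F z)) = cnj (cmean F)"
  using integral_linear[OF integrable_cis_comp[OF assms, of 0 "2*pi"] bounded_linear_cnj]
  by (simp add: cmean_def o_def)

lemma cmean_power: "cmean (\<lambda>z. z ^ n) = (if n = 0 then 1 else 0)"
proof -
  have "(\<lambda>z::complex. z ^ n) holomorphic_on ball 0 2" by (intro holomorphic_intros)
  from cmean_holomorphic[OF this] show ?thesis by (simp add: power_0_left)
qed

lemma cmean_power_cnj: "cmean (\<lambda>z. z ^ k * cnj z ^ n) = (if n = k then 1 else 0)"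
proof (cases "n \<le> k")
  case True
  have "cmean (\<lambda>z. z ^ k * cnj z ^ n) = cmean (\<lambda>z. z ^ (k - n))"
  proof (rule cmean_cong)
    fix z :: complex assume "norm z = 1"
    then have "(z * cnj z) ^ n = 1" by (simp add: complex_norm_square[symmetric])
    moreover have "z ^ k * cnj z ^ n = z ^ (k - n) * (z * cnj z) ^ n"
      using True by (simp add: power_mult_distrib mult.assoc[symmetric] power_add[symmetric])
    ultimately show "z ^ k * cnj z ^ n = z ^ (k - n)" by simp
  qed
  then show ?thesis using True by (simp add: cmean_power)
next
  case False
  have "cmean (\<lambda>z. z ^ k * cnj z ^ n) = cmean (\<lambda>z. cnj (z ^ (n - k)))"
  proof (rule cmean_cong)
    fix z :: complex assume "norm z = 1"
    then have "(z * cnj z) ^ k = 1" by (simp add: complex_norm_square[symmetric])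
    moreover have "z ^ k * cnj z ^ n = cnj z ^ (n - k) * (z * cnj z) ^ k"
      using False by (simp add: power_mult_distrib mult_ac power_add[symmetric])
    ultimately show "z ^ k * cnj z ^ n = cnj (z ^ (n - k))" by simp
  qed
  also have "\<dots> = cnj (cmean (\<lambda>z. z ^ (n - k)))"
    by (rule cmean_cnj) (intro continuous_intros)
  finally show ?thesis using False by (simp add: cmean_power)
qed

lemma cmean_sum:
  fixes F :: "nat \<Rightarrow> complex \<Rightarrow> complex"
  assumes "\<And>i. i < n \<Longrightarrow> continuous_on (sphere 0 1) (F i)"
  shows "cmean (\<lambda>z. \<Sum>i<n. F i z) = (\<Sum>i<n. cmean (F i))"
  using assms
proof (induction n)
  case (Suc n)
  have "continuous_on (sphere 0 1) (\<lambda>z. \<Sum>i<n. F i z)"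
    using Suc.prems by (intro continuous_on_sum) auto
  then show ?case using Suc by (simp add: cmean_add)
qed (simp add: cmean_eq_0)

text \<open>Absolute summability gives uniform convergence on the circle, so the mean may be taken
  term by term, and orthogonality of the powers leaves a single term.\<close>

lemma cmean_coefficient:
  fixes d :: "nat \<Rightarrow> complex"
  assumes d: "summable (\<lambda>n. norm (d n))"
  shows "cmean (\<lambda>z. z ^ k * (\<Sum>n. d n * cnj z ^ n)) = d k"
proof -
  have u: "uniform_limit (sphere 0 1) (\<lambda>N z. \<Sum>n<N. z ^ k * (d n * cnj z ^ n)) (\<lambda>z. \<Sum>n. z ^ k * (d n * cnj z ^ n)) sequentially"
    by (rule Weierstrass_m_test[OF _ d]) (auto simp: norm_mult norm_power)
  have "(\<lambda>N. cmean (\<lambda>z. \<Sum>n<N. z ^ k * (d n * cnj z ^ n))) \<longlonglongrightarrow> cmean (\<lambda>z. \<Sum>n. z ^ k * (d n * cnj z ^ n))"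
    by (rule cmean_uniform_limit[OF u]) (intro continuous_intros)
  moreover have "cmean (\<lambda>z. \<Sum>n<N. z ^ k * (d n * cnj z ^ n)) = (if k < N then d k else 0)" for N
  proof -
    have "cmean (\<lambda>z. \<Sum>n<N. z ^ k * (d n * cnj z ^ n)) = (\<Sum>n<N. cmean (\<lambda>z. d n * (z ^ k * cnj z ^ n)))"
      by (subst cmean_sum) (auto intro!: continuous_intros sum.cong simp: mult_ac)
    also have "\<dots> = (\<Sum>n<N. if n = k then d k else 0)"
      by (intro sum.cong) (auto simp: cmean_mult_left cmean_power_cnj)
    finally show ?thesis by simp
  qed
  moreover have "(\<lambda>N. if k < N then d k else 0) \<longlonglongrightarrow> d k"
    by (rule tendsto_eventually) (use eventually_gt_at_top[of k] in \<open>eventually_elim, simp\<close>)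
  ultimately have "cmean (\<lambda>z. \<Sum>n. z ^ k * (d n * cnj z ^ n)) = d k"
    using LIMSEQ_unique by auto
  moreover have "cmean (\<lambda>z. \<Sum>n. z ^ k * (d n * cnj z ^ n)) = cmean (\<lambda>z. z ^ k * (\<Sum>n. d n * cnj z ^ n))"
  proof (rule cmean_cong)
    fix z :: complex assume z: "norm z = 1"
    have "summable (\<lambda>n. norm (d n * cnj z ^ n))" using d z by (simp add: norm_mult norm_power)
    then show "(\<Sum>n. z ^ k * (d n * cnj z ^ n)) = z ^ k * (\<Sum>n. d n * cnj z ^ n)"
      by (rule suminf_mult[OF summable_norm_cancel])
  qed
  ultimately show ?thesis by simp
qed

section \<open>Weighted Bergman kernels\<close>

lemma beta_integral:
  "((\<lambda>r. 2 * r * r ^ (2 * n) * (1 - r\<^sup>2) ^ B) has_integral (fact n * fact B / fact (n + B + 1) :: real)) {0..1}"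
proof (induction B arbitrary: n)
  case 0
  define F where "F r = r ^ (2 * n + 2) / real (n + 1)" for r :: real
  have dF: "(F has_vector_derivative 2 * x * x ^ (2 * n)) (at x within {0..1})" for x
  proof -
    have "(F has_real_derivative real (2 * n + 2) * x ^ (2 * n + 2 - Suc 0) / real (n + 1)) (at x within {0..1})"
      unfolding F_def by (rule DERIV_cdivide[OF DERIV_pow])
    moreover have "real (2 * n + 2) * x ^ (2 * n + 2 - Suc 0) / real (n + 1) = 2 * x * x ^ (2 * n)"
    proof -
      have "real (2 * n + 2) / real (n + 1) = 2" by (simp add: field_simps)
      then have "real (2 * n + 2) / real (n + 1) * x ^ (2 * n + 1) = 2 * x ^ (2 * n + 1)" by (simp only:)
      then show ?thesis by simp
    qed
    ultimately show ?thesis by (simp only: has_real_derivative_iff_has_vector_derivative)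
  qed
  have "((\<lambda>r. 2 * r * r ^ (2 * n)) has_integral (F 1 - F 0)) {0..1::real}"
    by (rule fundamental_theorem_of_calculus[OF _ dF]) simp
  moreover have "F 1 - F 0 = fact n * fact 0 / fact (n + 0 + 1)"
  proof -
    have "(fact (n + 0 + 1) :: real) = real (n + 1) * fact n" by simp
    then show ?thesis by (simp add: F_def del: fact_Suc)
  qed
  ultimately show ?case by simp
next
  case (Suc B)
  \<comment> \<open>One more factor 1 - r^2 is the difference of the integrals for n and n + 1, so
    only powers ever need an antiderivative.\<close>
  have "((\<lambda>r. 2 * r * r ^ (2 * n) * (1 - r\<^sup>2) ^ B - 2 * r * r ^ (2 * Suc n) * (1 - r\<^sup>2) ^ B) has_integral
      (fact n * fact B / fact (n + B + 1) - fact (Suc n) * fact B / fact (Suc n + B + 1) :: real)) {0..1}"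
    by (intro has_integral_diff Suc.IH)
  moreover have "(\<lambda>r. 2 * r * r ^ (2 * n) * (1 - r\<^sup>2) ^ B - 2 * r * r ^ (2 * Suc n) * (1 - r\<^sup>2) ^ B)
      = (\<lambda>r::real. 2 * r * r ^ (2 * n) * (1 - r\<^sup>2) ^ Suc B)"
    by (simp add: fun_eq_iff algebra_simps power2_eq_square)
  moreover have "(fact n * fact B / fact (n + B + 1) - fact (Suc n) * fact B / fact (Suc n + B + 1) :: real)
      = fact n * fact (Suc B) / fact (n + Suc B + 1)"
  proof -
    define u where "u = (fact (n + B + 1) :: real)"
    have u0: "u \<noteq> 0" unfolding u_def by (rule fact_nonzero)
    have u: "fact (Suc n + B + 1) = (real n + real B + 2) * u" "fact (n + Suc B + 1) = (real n + real B + 2) * u"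
      by (auto simp: u_def algebra_simps)
    have v: "(fact (Suc n) :: real) = (real n + 1) * fact n" "(fact (Suc B) :: real) = (real B + 1) * fact B"
      by (auto simp: algebra_simps)
    have w: "real n + real B + 2 \<noteq> 0" by linarith
    show ?thesis unfolding u v u_def[symmetric]
      using u0 w by (simp add: divide_simps) (simp add: algebra_simps)
  qed
  ultimately show ?case by (simp only:)
qed

text \<open>These are at once the Taylor coefficients of (1 - y)^(-(B + 2)) and the reciprocals of
  the moments of the radial weight (B + 1) 2 r (1 - r^2)^B; this coincidence makes
  \<open>disc_kernel\<close> reproducing.\<close>

definition kernel_coeff :: "nat \<Rightarrow> nat \<Rightarrow> real" where
  "kernel_coeff B n = real ((n + B + 1) choose n)"

lemma beta_integral_coeff:
  "((\<lambda>r. (real B + 1) * (2 * r * (1 - r\<^sup>2) ^ B) * (kernel_coeff B n * r ^ (2 * n))) has_integral 1) {0..1}"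
proof -
  have c: "kernel_coeff B n = fact (n + B + 1) / (fact n * fact (B + 1))"
    unfolding kernel_coeff_def by (subst binomial_fact) auto
  have "(real B + 1) * (fact (n + B + 1) / (fact n * fact (B + 1))) * (fact n * fact B / fact (n + B + 1)) = (1::real)"
    by (simp add: field_simps del: fact_Suc) (simp add: algebra_simps)
  then have one: "(real B + 1) * kernel_coeff B n * (fact n * fact B / fact (n + B + 1)) = 1"
    by (simp only: c)
  have "((\<lambda>r. (real B + 1) * kernel_coeff B n * (2 * r * r ^ (2 * n) * (1 - r\<^sup>2) ^ B)) has_integral
     (real B + 1) * kernel_coeff B n * (fact n * fact B / fact (n + B + 1))) {0..1}"
    by (intro has_integral_mult_right beta_integral)
  then show ?thesis unfolding one by (simp only: mult_ac)
qed

lemma kernel_series: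
  assumes y: "norm y < 1"
  shows "(\<lambda>n. of_real (kernel_coeff B n) * y ^ n) sums (1 / (1 - y) ^ (B + 2) :: complex)"
proof -
  have "(\<lambda>n. ((- of_nat (B + 2)) gchoose n) * (- y) ^ n) sums (1 + (- y)) powr (- of_nat (B + 2))"
    using y by (intro gen_binomial_complex) auto
  also have "(\<lambda>n. ((- of_nat (B + 2)) gchoose n) * (- y) ^ n) = (\<lambda>n. of_real (kernel_coeff B n) * y ^ n)"
  proof
    fix n
    have "((- of_nat (B + 2) :: complex) gchoose n) = (- 1) ^ n * ((of_nat n - (- of_nat (B + 2)) - 1) gchoose n)"
      by (rule gbinomial_negated_upper)
    also have "(of_nat n - (- of_nat (B + 2)) - 1 :: complex) = of_nat (n + B + 1)" by simp
    also have "(of_nat (n + B + 1) gchoose n :: complex) = of_real (kernel_coeff B n)"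
      by (simp add: binomial_gbinomial[symmetric] kernel_coeff_def del: of_nat_add of_nat_Suc)
    finally have g: "((- of_nat (B + 2) :: complex) gchoose n) = (- 1) ^ n * of_real (kernel_coeff B n)" .
    have "(- y) ^ n = (- 1) ^ n * y ^ n" by (rule power_minus)
    moreover have "(- 1 :: complex) ^ n * (- 1) ^ n = 1" by (simp flip: power_mult_distrib)
    ultimately show "((- of_nat (B + 2)) gchoose n) * (- y) ^ n = of_real (kernel_coeff B n) * y ^ n"
      unfolding g by (simp add: mult_ac)
  qed
  also have "(1 + (- y)) powr (- of_nat (B + 2)) = 1 / (1 - y) ^ (B + 2)"
  proof -
    have "1 - y \<noteq> 0" using y by auto
    then have "(1 - y) powr of_nat (B + 2) = (1 - y) ^ (B + 2)"
      using powr_nat[of "1 - y" "B + 2"] by (simp only: if_False)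
    then show ?thesis
      unfolding powr_minus_divide by simp
  qed
  finally show ?thesis .
qed

text \<open>On the circle 1 / |1 - y z|^2 is 1 / (1 - y z) times the Cauchy kernel at cnj y, so
  Cauchy's formula evaluates the mean. It amounts to the Poisson kernel having mass 1.\<close>

lemma cmean_inverse_square:
  assumes y: "norm y < 1"
  shows "cmean (\<lambda>z. 1 / (norm (1 - y * z))\<^sup>2) = 1 / (1 - (norm y)\<^sup>2)"
proof -
  have ne: "1 - y * z \<noteq> 0" if "norm y * norm z < 1" for z
    using that by (metis eq_iff_diff_eq_0 less_irrefl norm_mult norm_one)
  obtain R where R: "1 < R" "norm y * R < 1"
  proof (cases "y = 0")
    case False
    then have "1 < 1 / norm y" using y by simp
    then obtain R where "1 < R" "R < 1 / norm y" using dense by blast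
    then show thesis using False by (intro that[of R]) (auto simp: field_simps)
  next
    case True
    show thesis by (rule that[of 2]) (auto simp: True)
  qed
  have ne': "1 - y * z \<noteq> 0" if "norm z < R" for z
  proof (rule ne)
    have "norm y * norm z \<le> norm y * R" using that by (intro mult_left_mono) auto
    then show "norm y * norm z < 1" using R by simp
  qed
  have h: "(\<lambda>z. 1 / (1 - y * z)) holomorphic_on ball 0 R"
    using ne' by (intro holomorphic_intros) auto
  have c: "continuous_on (sphere 0 1) (\<lambda>z. 1 / (1 - y * z) / (1 - cnj y * cnj z))"
  proof -
    have "1 - cnj y * cnj z \<noteq> 0" if "norm z < R" for z
    proof -
      have "cnj (1 - y * z) \<noteq> 0" using ne'[OF that] by (simp only: complex_cnj_zero_iff not_False_eq_True)
      then show ?thesis by simp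
    qed
    then have "1 - cnj y * cnj z \<noteq> 0" "1 - y * z \<noteq> 0" if "z \<in> sphere 0 1" for z
      using that R(1) ne'[of z] by auto
    then show ?thesis by (intro continuous_on_divide continuous_intros) auto
  qed
  have "cmean (\<lambda>z. 1 / (norm (1 - y * z))\<^sup>2) = cmean (\<lambda>z. Re (1 / (1 - y * z) / (1 - cnj y * cnj z)))"
  proof (rule cmean_cong)
    fix z
    have "1 / (1 - y * z) / (1 - cnj y * cnj z) = 1 / ((1 - y * z) * cnj (1 - y * z))" by simp
    also have "\<dots> = of_real (1 / (norm (1 - y * z))\<^sup>2)"
      by (simp only: complex_norm_square[symmetric] of_real_divide of_real_1)
    finally show "1 / (norm (1 - y * z))\<^sup>2 = Re (1 / (1 - y * z) / (1 - cnj y * cnj z))" by (simp only: Re_complex_of_real)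
  qed
  also have "\<dots> = Re (cmean (\<lambda>z. 1 / (1 - y * z) / (1 - cnj y * cnj z)))"
    by (rule cmean_Re[OF c])
  also have "cmean (\<lambda>z. 1 / (1 - y * z) / (1 - cnj y * cnj z)) = 1 / (1 - y * cnj y)"
    by (rule cmean_Cauchy[OF h R(1)]) (simp add: y)
  also have "1 / (1 - y * cnj y) = of_real (1 / (1 - (norm y)\<^sup>2))"
    by (simp only: complex_norm_square[symmetric] of_real_divide of_real_1 of_real_diff)
  finally show ?thesis by (simp only: Re_complex_of_real)
qed

text \<open>As a function of \<open>w\<close>, the reproducing kernel of the Bergman space with
  weight (1 - |z|^2)^B, up to the normalisation of that weight.\<close>

definition disc_kernel :: "nat \<Rightarrow> complex \<Rightarrow> complex \<Rightarrow> complex" where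
  "disc_kernel B z w = (if norm z < 1 \<and> norm w < 1 then 1 / (1 - cnj z * w) ^ (B + 2) else 0)"

text \<open>The power of \<open>1 - |z|\<close> normalises the kernel at \<open>z\<close> to have \<open>H_p\<close> norm at most 1.\<close>

definition kernel_pair :: "real \<Rightarrow> nat \<Rightarrow> ((complex \<Rightarrow> complex) \<Rightarrow> complex) \<Rightarrow> real \<times> real \<Rightarrow> real" where
  "kernel_pair p B \<phi> x = norm (\<phi> (disc_kernel B (disc_point x))) * (1 - fst x) powr (real (B + 2) - 1 / p)"

context
  fixes p :: real and B :: nat
  assumes p: "0 < p" "p < 1" and B: "2 \<le> real (B + 2) * p"
begin

text \<open>As (B + 2) p >= 2, the p-th power of the kernel on a circle is |1 - y \<zeta>|^(-2),
  whose mean is known, times a factor of at most (1 - |z|)^(2 - (B + 2) p). This is why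
  \<open>B\<close> has to be large.\<close>

lemma kernel_hardy:
  assumes z: "norm z < 1"
  shows "disc_kernel B z \<in> hardy p" and "hardy_norm p (disc_kernel B z) \<le> (1 - norm z) powr (1 / p - real (B + 2))"
proof -
  have lb: "1 - norm z \<le> norm (1 - cnj z * w)" if "norm w \<le> 1" for w
  proof -
    have "norm (cnj z * w) \<le> norm z" using that by (simp add: norm_mult mult_left_le)
    then show ?thesis using norm_triangle_ineq2[of 1 "cnj z * w"] by simp
  qed
  have ne: "1 - cnj z * w \<noteq> 0" if "norm w \<le> 1" for w using lb[OF that] z by auto
  have h: "disc_kernel B z holomorphic_on ball 0 1"
    by (rule holomorphic_transform[of "\<lambda>w. 1 / (1 - cnj z * w) ^ (B + 2)"])
       (use ne z in \<open>auto intro!: holomorphic_intros simp: disc_kernel_def\<close>)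
  define b where "b = real (B + 2)"
  have bp: "2 \<le> b * p" using B by (simp add: b_def)
  have bound: "pmean p (disc_kernel B z) r \<le> ((1 - norm z) powr (1 / p - b)) powr p" if r: "0 < r" "r < 1" for r
  proof -
    define y where "y = cnj z * of_real r"
    have ny: "norm y = norm z * r" using r by (simp add: y_def norm_mult)
    have y: "norm y \<le> norm z" "norm y < 1" using r z by (auto simp: ny mult_left_le intro: le_less_trans[OF mult_left_le])
    have lb': "1 - norm z \<le> norm (1 - y * \<zeta>)" if "norm \<zeta> = 1" for \<zeta>
      using lb[of "of_real r * \<zeta>"] that r by (simp add: y_def norm_mult mult.assoc)
    have cont: "continuous_on (sphere 0 1) (\<lambda>\<zeta>. 1 / (norm (1 - y * \<zeta>))\<^sup>2)"
      using lb' z by (intro continuous_intros) force+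
    have "pmean p (disc_kernel B z) r \<le> cmean (\<lambda>\<zeta>. (1 - norm z) powr (2 - b * p) * (1 / (norm (1 - y * \<zeta>))\<^sup>2))"
      unfolding pmean_def
    proof (rule cmean_mono)
      show "continuous_on (sphere 0 1) (\<lambda>\<zeta>. cmod (disc_kernel B z (of_real r * \<zeta>)) powr p)"
        using r p by (intro continuous_on_dilation_powr[OF h exponent_bounds[OF p]]) auto
      show "continuous_on (sphere 0 1) (\<lambda>\<zeta>. (1 - norm z) powr (2 - b * p) * (1 / (norm (1 - y * \<zeta>))\<^sup>2))"
        by (intro continuous_on_mult continuous_on_const cont)
      fix \<zeta> :: complex assume \<zeta>: "norm \<zeta> = 1"
      define n where "n = norm (1 - y * \<zeta>)"
      have n: "0 < n" "1 - norm z \<le> n" using lb'[OF \<zeta>] z by (auto simp: n_def)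
      have "norm (disc_kernel B z (of_real r * \<zeta>)) = 1 / n ^ (B + 2)"
        using r z \<zeta> by (simp add: disc_kernel_def norm_mult norm_divide norm_power y_def n_def mult.assoc)
      also have "\<dots> = n powr (- b)" by (simp only: powr_minus_divide b_def powr_realpow[OF n(1)])
      finally have "norm (disc_kernel B z (of_real r * \<zeta>)) powr p = n powr (- b * p)" by (simp add: powr_powr)
      also have "\<dots> = n powr (2 - b * p) * (1 / n\<^sup>2)"
        using n by (simp add: powr_diff powr_minus_divide)
      also have "\<dots> \<le> (1 - norm z) powr (2 - b * p) * (1 / n\<^sup>2)"
        using n z bp by (intro mult_right_mono powr_mono2') auto
      finally show "norm (disc_kernel B z (of_real r * \<zeta>)) powr p \<le> (1 - norm z) powr (2 - b * p) * (1 / (norm (1 - y * \<zeta>))\<^sup>2)"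
        by (simp add: n_def)
    qed
    also have "\<dots> = (1 - norm z) powr (2 - b * p) * (1 / (1 - (norm y)\<^sup>2))"
      unfolding cmean_mult_left cmean_inverse_square[OF y(2)] ..
    also have "\<dots> \<le> (1 - norm z) powr (2 - b * p) * (1 / (1 - norm z))"
    proof (intro mult_left_mono divide_left_mono)
      have "(norm y)\<^sup>2 \<le> norm y * 1" unfolding power2_eq_square using y by (intro mult_left_mono) auto
      then show "1 - norm z \<le> 1 - (norm y)\<^sup>2" "0 < (1 - (norm y)\<^sup>2) * (1 - norm z)" using y z by auto
    qed auto
    also have "\<dots> = (1 - norm z) powr (1 - b * p)"
    proof -
      have "(1 - norm z) powr (1 - b * p) = (1 - norm z) powr ((2 - b * p) - 1)" by (rule arg_cong) simp
      also have "\<dots> = (1 - norm z) powr (2 - b * p) / (1 - norm z)" using z by (subst powr_diff) simp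
      finally show ?thesis by simp
    qed
    also have "\<dots> = ((1 - norm z) powr (1 / p - b)) powr p"
      using p by (simp add: powr_powr algebra_simps)
    finally show ?thesis .
  qed
  have out: "disc_kernel B z w = 0" if "1 \<le> norm w" for w using that by (simp add: disc_kernel_def)
  show "disc_kernel B z \<in> hardy p" "hardy_norm p (disc_kernel B z) \<le> (1 - norm z) powr (1 / p - real (B + 2))"
    using hardyI[OF exponent_bounds[OF p] h out _ bound] by (auto simp: b_def)
qed

section \<open>Bounded functionals on monomials and kernels\<close>

context
  fixes \<phi> :: "(complex \<Rightarrow> complex) \<Rightarrow> complex" and M :: real
  assumes lin: "linear_on (*) (hardy p) \<phi>"
    and bdd: "\<And>f. f \<in> hardy p \<Longrightarrow> norm (\<phi> f) \<le> M * hardy_norm p f" and M: "0 \<le> M"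
begin

lemma functional_add: "f \<in> hardy p \<Longrightarrow> g \<in> hardy p \<Longrightarrow> \<phi> (f + g) = \<phi> f + \<phi> g"
  and functional_scale: "f \<in> hardy p \<Longrightarrow> \<phi> (fscale c f) = c * \<phi> f"
  using lin by (auto simp: linear_on_def)

lemma functional_zero: "\<phi> 0 = 0"
  using bdd[OF hardy_zero(1)[OF exponent_bounds[OF p]]] by (simp add: hardy_zero[OF exponent_bounds[OF p]])

lemma functional_diff:
  assumes "f \<in> hardy p" "g \<in> hardy p" shows "\<phi> (f - g) = \<phi> f - \<phi> g"
proof -
  have "\<phi> f = \<phi> ((f - g) + g)" by simp
  also have "\<dots> = \<phi> (f - g) + \<phi> g" by (intro functional_add hardy_diff exponent_bounds[OF p] assms)
  finally show ?thesis by simp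
qed

lemma functional_polynomial:
  "\<phi> (\<Sum>i<n. fscale (a i) (disc_monom i)) = (\<Sum>i<n. a i * \<phi> (disc_monom i))"
proof (induction n)
  case 0
  then show ?case by (simp add: functional_zero[unfolded zero_fun_def] zero_fun_def)
next
  case (Suc n)
  have "\<phi> (\<Sum>i<Suc n. fscale (a i) (disc_monom i)) = \<phi> ((\<Sum>i<n. fscale (a i) (disc_monom i)) + fscale (a n) (disc_monom n))"
    by simp
  also have "\<dots> = \<phi> (\<Sum>i<n. fscale (a i) (disc_monom i)) + \<phi> (fscale (a n) (disc_monom n))"
    by (intro functional_add hardy_sum hardy_scale_le disc_monom_hardy exponent_bounds[OF p])
  also have "\<phi> (fscale (a n) (disc_monom n)) = a n * \<phi> (disc_monom n)"
    by (intro functional_scale disc_monom_hardy exponent_bounds[OF p])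
  finally show ?case using Suc by simp
qed

lemma functional_monom_le: "norm (\<phi> (disc_monom n)) \<le> M"
  using bdd[OF disc_monom_hardy(1)[OF exponent_bounds[OF p]], of n] mult_left_mono[OF disc_monom_hardy(2)[OF exponent_bounds[OF p], of n] M] by simp

lemma summable_kernel_coeff:
  assumes "norm z < 1"
  shows "summable (\<lambda>n. norm (of_real (kernel_coeff B n) * (z::complex) ^ n))"
proof -
  have "summable (\<lambda>n. of_real (kernel_coeff B n) * (of_real (norm z) :: complex) ^ n)"
    using kernel_series[of "of_real (norm z)" B] assms by (auto simp: sums_iff)
  then have "summable (\<lambda>n. complex_of_real (kernel_coeff B n * norm z ^ n))" by simp
  then have "summable (\<lambda>n. kernel_coeff B n * norm z ^ n)" by (simp only: summable_complex_of_real)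
  then show ?thesis by (simp add: norm_mult norm_power kernel_coeff_def)
qed

text \<open>The Taylor series of the kernel converges uniformly on the disc, hence in H_p, so a
  bounded functional acts term by term; the tail costs at most \<open>M\<close> times the tail of
  the coefficients.\<close>

lemma functional_kernel:
  assumes z: "norm z < 1"
  shows "(\<lambda>n. of_real (kernel_coeff B n) * cnj z ^ n * \<phi> (disc_monom n)) sums \<phi> (disc_kernel B z)"
  unfolding sums_def
proof (rule tendstoI)
  fix e :: real assume e: "0 < e"
  define a where "a n = of_real (kernel_coeff B n) * cnj z ^ n" for n
  have summ_a: "summable (\<lambda>n. norm (a n))"
    unfolding a_def using summable_kernel_coeff[of "cnj z"] z by simp
  have M1: "0 < e / (M + 1)" using e M by simp
  obtain N where N: "\<And>n. n \<ge> N \<Longrightarrow> norm (\<Sum>i. norm (a (i + n))) < e / (M + 1)"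
    using suminf_exist_split[OF M1 summ_a] by blast
  show "\<forall>\<^sub>F n in sequentially. dist (\<Sum>i<n. of_real (kernel_coeff B i) * cnj z ^ i * \<phi> (disc_monom i)) (\<phi> (disc_kernel B z)) < e"
    using eventually_ge_at_top[of N]
  proof eventually_elim
    case (elim n)
    define q where "q = (\<Sum>i<n. fscale (a i) (disc_monom i))"
    have q: "q \<in> hardy p" unfolding q_def by (intro hardy_sum hardy_scale_le disc_monom_hardy exponent_bounds[OF p])
    have m: "disc_kernel B z - q \<in> hardy p" by (intro hardy_diff kernel_hardy exponent_bounds[OF p] z q)
    define t where "t = (\<Sum>i. norm (a (i + n)))"
    have t0: "0 \<le> t" unfolding t_def by (intro suminf_nonneg summable_ignore_initial_segment summ_a) auto
    have "norm ((disc_kernel B z - q) w) \<le> t" if w: "norm w < 1" for w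
    proof -
      have zw: "norm (cnj z * w) < 1"
        using z w mult_strict_mono[of "norm z" 1 "norm w" 1] by (simp add: norm_mult)
      have "(\<lambda>i. a i * w ^ i) sums disc_kernel B z w"
        using kernel_series[OF zw, of B] z w by (simp add: a_def disc_kernel_def power_mult_distrib mult.assoc)
      then have sm: "summable (\<lambda>i. a i * w ^ i)" "disc_kernel B z w = (\<Sum>i. a i * w ^ i)" by (auto simp: sums_iff)
      have le: "norm (a i * w ^ i) \<le> norm (a i)" for i
        using w by (simp add: norm_mult norm_power mult_left_le power_le_one)
      have "disc_kernel B z w = (\<Sum>i. a (i + n) * w ^ (i + n)) + (\<Sum>i<n. a i * w ^ i)"
        unfolding sm(2) by (rule suminf_split_initial_segment[OF sm(1)])
      then have "(disc_kernel B z - q) w = (\<Sum>i. a (i + n) * w ^ (i + n))"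
        using w by (simp add: q_def sum_fun_apply fscale_def disc_monom_def)
      also have "norm \<dots> \<le> t" unfolding t_def
        by (rule norm_suminf_le[OF le summable_ignore_initial_segment[OF summ_a]])
      finally show ?thesis .
    qed
    from hardy_bounded(2)[of p "disc_kernel B z - q" t, OF exponent_bounds[OF p] hardy_holomorphic[OF exponent_bounds[OF p] m] hardy_outside[OF exponent_bounds[OF p] m] t0 this]
    have "hardy_norm p (disc_kernel B z - q) \<le> t" .
    then have "norm (\<phi> (disc_kernel B z - q)) \<le> M * t"
      using bdd[OF m] M by (meson order_trans mult_left_mono)
    also have "M * t \<le> M * (e / (M + 1))"
      using N[OF elim] M t0 by (intro mult_left_mono) (auto simp: t_def)
    also have "\<dots> < e" using e M by (simp add: field_simps)
    finally have "norm (\<phi> (disc_kernel B z) - \<phi> q) < e"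
      using functional_diff[OF kernel_hardy(1)[OF z] q] by simp
    then show ?case
      unfolding q_def functional_polynomial by (simp add: dist_norm norm_minus_commute a_def)
  qed
qed

text \<open>The function is antiholomorphic in \<open>z\<close>: conjugating the variable turns its
  series into a power series.\<close>

lemma continuous_functional_kernel: "continuous_on (ball 0 1) (\<lambda>z. \<phi> (disc_kernel B z))"
proof -
  define b where "b n = of_real (kernel_coeff B n) * \<phi> (disc_monom n)" for n
  have s: "(\<lambda>n. b n * cnj z ^ n) sums \<phi> (disc_kernel B z)" if "norm z < 1" for z
    using functional_kernel[OF that] by (simp add: b_def mult_ac)
  have "(\<lambda>w. \<phi> (disc_kernel B (cnj w))) holomorphic_on ball 0 1"
  proof (rule power_series_holomorphic)
    fix w :: complex assume "w \<in> ball 0 1"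
    then show "(\<lambda>n. b n * (w - 0) ^ n) sums \<phi> (disc_kernel B (cnj w))"
      using s[of "cnj w"] by simp
  qed
  then have c: "continuous_on (ball 0 1) (\<lambda>w. \<phi> (disc_kernel B (cnj w)))"
    by (rule holomorphic_on_imp_continuous_on)
  have "continuous_on (ball 0 1) (\<lambda>z. \<phi> (disc_kernel B (cnj (cnj z))))"
    by (rule continuous_on_compose2[OF c]) (auto intro!: continuous_intros)
  then show ?thesis by simp
qed

lemma measurable_kernel_pair: "kernel_pair p B \<phi> \<in> borel_measurable borel"
proof -
  have "(\<lambda>z. indicator (ball 0 1) z *\<^sub>R \<phi> (disc_kernel B z)) \<in> borel_measurable borel"
    by (rule borel_measurable_continuous_on_indicator) (auto intro: continuous_functional_kernel)
  also have "(\<lambda>z. indicator (ball 0 1) z *\<^sub>R \<phi> (disc_kernel B z)) = (\<lambda>z. \<phi> (disc_kernel B z))"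
  proof
    fix z
    have "disc_kernel B z = 0" if "1 \<le> norm z" using that by (auto simp: disc_kernel_def)
    then show "indicator (ball 0 1) z *\<^sub>R \<phi> (disc_kernel B z) = \<phi> (disc_kernel B z)"
      by (auto simp: indicator_def functional_zero)
  qed
  finally have [measurable]: "(\<lambda>z. \<phi> (disc_kernel B z)) \<in> borel_measurable borel" .
  show ?thesis unfolding kernel_pair_def[abs_def] by measurable
qed

lemma kernel_pair_le:
  assumes "0 < fst x" "fst x < 1"
  shows "kernel_pair p B \<phi> x \<le> M"
proof -
  have n: "norm (disc_point x) = fst x" using assms by (simp add: disc_point_def norm_mult)
  have "norm (\<phi> (disc_kernel B (disc_point x))) \<le> M * hardy_norm p (disc_kernel B (disc_point x))"
    using assms n by (intro bdd kernel_hardy) auto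
  also have "\<dots> \<le> M * (1 - fst x) powr (1 / p - real (B + 2))"
    using kernel_hardy(2)[of "disc_point x"] n assms M by (intro mult_left_mono) auto
  finally have "kernel_pair p B \<phi> x \<le> M * (1 - fst x) powr (1 / p - real (B + 2)) * (1 - fst x) powr (real (B + 2) - 1 / p)"
    unfolding kernel_pair_def by (intro mult_right_mono) auto
  also have "\<dots> = M" using assms by (simp add: mult.assoc powr_add[symmetric])
  finally show ?thesis .
qed

end

end

text \<open>Collects B + 1 from the weight, 2^(B + 1) from 2 r (1 - r^2)^B <= 2^(B + 1) (1 - r)^B,
  and 1 / (2 pi) from the normalisation of \<open>cmean\<close>.\<close>

definition rep_const :: "nat \<Rightarrow> real" where
  "rep_const B = (real B + 1) * 2 ^ (B + 1) / (2 * pi)"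

lemma rep_const_pos: "0 < rep_const B"
  by (simp add: rep_const_def add_pos_nonneg)

context
  fixes p :: real and B :: nat and \<phi> :: "(complex \<Rightarrow> complex) \<Rightarrow> complex" and M :: real
  assumes p: "0 < p" "p < 1" and B: "2 \<le> real (B + 2) * p"
    and lin: "linear_on (*) (hardy p) \<phi>"
    and bdd: "\<And>f. f \<in> hardy p \<Longrightarrow> norm (\<phi> f) \<le> M * hardy_norm p f" and M: "0 \<le> M"
begin

text \<open>For a polynomial the value of the functional is a finite sum over coefficients, which
  equals exactly a weighted area integral of q z times \<open>\<phi>\<close> at the kernel of z.
  Absolute values are taken only after this identity.\<close>

lemma functional_representation_polynomial:
  fixes a :: "nat \<Rightarrow> complex" and m :: nat
  defines "q \<equiv> \<Sum>i<m. fscale (a i) (disc_monom i)"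
  shows "ennreal (norm (\<phi> q)) \<le> ennreal (rep_const B) *
    (\<integral>\<^sup>+x. ennreal (hyp_size p q x * kernel_pair p B \<phi> x) \<partial>hyp_measure)"
proof -
  have p': "0 < p" "p \<le> 1" using p by auto
  have q: "q \<in> hardy p" unfolding q_def by (intro hardy_sum hardy_scale_le disc_monom_hardy p')
  note [measurable] = measurable_hyp_size[OF p q] measurable_kernel_pair[OF p B lin bdd M]
  define \<psi> where "\<psi> n = \<phi> (disc_monom n)" for n
  define c where "c = kernel_coeff B"
  define w where "w r = (real B + 1) * (2 * r * (1 - r\<^sup>2) ^ B)" for r :: real
  \<comment> \<open>The circle mean at radius \<open>r\<close> of \<open>q\<close> times
    \<open>\<phi>\<close> at the kernel, as orthogonality of the powers will show.\<close>
  define J where "J r = (\<Sum>i<m. a i * \<psi> i * of_real (c i * r ^ (2 * i)))" for r :: real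
  have cJ: "continuous_on UNIV J" unfolding J_def by (intro continuous_intros)
  have cw: "continuous_on UNIV w" unfolding w_def by (intro continuous_intros)
  have w0: "0 \<le> w r" if "r \<in> {0..1}" for r
    using that by (auto simp: w_def power_le_one intro!: mult_nonneg_nonneg)
  have phi_q: "\<phi> q = (\<Sum>i<m. a i * \<psi> i)"
    unfolding q_def \<psi>_def by (rule functional_polynomial[OF p B lin bdd M])
  have "((\<lambda>r. \<Sum>i<m. a i * \<psi> i * of_real (w r * (c i * r ^ (2 * i)))) has_integral (\<Sum>i<m. a i * \<psi> i * of_real 1)) {0..1}"
  proof (intro has_integral_sum finite_lessThan has_integral_mult_right)
    fix i
    have "((\<lambda>r. w r * (c i * r ^ (2 * i))) has_integral 1) {0..1}"
      unfolding w_def c_def by (rule beta_integral_coeff)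
    from has_integral_linear[OF this bounded_linear_of_real]
    show "((\<lambda>r. complex_of_real (w r * (c i * r ^ (2 * i)))) has_integral of_real 1) {0..1}"
      by (simp only: o_def)
  qed
  moreover have "(\<Sum>i<m. a i * \<psi> i * of_real (w r * (c i * r ^ (2 * i)))) = of_real (w r) * J r" for r
    by (simp add: J_def sum_distrib_left mult_ac)
  ultimately have int: "((\<lambda>r. of_real (w r) * J r) has_integral \<phi> q) {0..1}"
    by (simp add: phi_q)
  have "norm (\<phi> q) \<le> integral {0..1} (\<lambda>r. w r * norm (J r))"
  proof -
    have "norm (integral {0..1} (\<lambda>r. of_real (w r) * J r)) \<le> integral {0..1} (\<lambda>r. w r * norm (J r))"
    proof (rule integral_norm_bound_integral)
      show "(\<lambda>r. of_real (w r) * J r) integrable_on {0..1}" using int by blast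
      show "(\<lambda>r. w r * norm (J r)) integrable_on {0..1}"
        by (intro integrable_continuous_interval continuous_intros continuous_on_subset[OF cw] continuous_on_subset[OF cJ]) auto
      show "norm (of_real (w r) * J r) \<le> w r * norm (J r)" if "r \<in> {0..1}" for r
        using w0[OF that] by (simp add: norm_mult)
    qed
    then show ?thesis using integral_unique[OF int] by simp
  qed
  then have "ennreal (norm (\<phi> q)) \<le> ennreal (integral {0..1} (\<lambda>r. w r * norm (J r)))"
    by (rule ennreal_leI)
  also have "\<dots> = (\<integral>\<^sup>+r. ennreal (w r * norm (J r)) * indicator {0..1} r \<partial>lborel)"
    by (rule nn_integral_continuous_interval[symmetric])
       (auto intro!: continuous_intros cw cJ mult_nonneg_nonneg w0)
  also have "\<dots> \<le> (\<integral>\<^sup>+r. ennreal (rep_const B) *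
     (\<integral>\<^sup>+t. ennreal (hyp_weight (r, t)) * ennreal (hyp_size p q (r, t) * kernel_pair p B \<phi> (r, t)) \<partial>lborel) \<partial>lborel)"
  proof (rule nn_integral_mono_AE)
    have ne: "AE r in lborel. r \<noteq> (0::real)" "AE r in lborel. r \<noteq> (1::real)" by (rule AE_lborel_singleton)+
    show "AE r in lborel. ennreal (w r * norm (J r)) * indicator {0..1} r \<le> ennreal (rep_const B) *
     (\<integral>\<^sup>+t. ennreal (hyp_weight (r, t)) * ennreal (hyp_size p q (r, t) * kernel_pair p B \<phi> (r, t)) \<partial>lborel)"
      using ne
    proof eventually_elim
      case (elim r)
      show ?case
      proof (cases "r \<in> {0..1}")
        case True
        with elim have r: "0 < r" "r < 1" by auto
        define F where "F \<zeta> = norm (q (of_real r * \<zeta>)) * norm (\<phi> (disc_kernel B (of_real r * \<zeta>)))" for \<zeta>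
        have c1: "continuous_on (sphere 0 1) (\<lambda>\<zeta>. q (of_real r * \<zeta>))"
          using r by (intro continuous_on_subset[OF continuous_on_dilation[OF hardy_holomorphic[OF p' q] p']]) auto
        have c2: "continuous_on (sphere 0 1) (\<lambda>\<zeta>. \<phi> (disc_kernel B (of_real r * \<zeta>)))"
          by (rule continuous_on_compose2[OF continuous_functional_kernel[OF p B lin bdd M]])
             (use r in \<open>auto intro!: continuous_intros simp: norm_mult\<close>)
        have cF: "continuous_on (sphere 0 1) F" unfolding F_def by (intro continuous_intros c1 c2)
        define d where "d n = of_real (c n) * of_real r ^ n * \<psi> n" for n
        have summ_d: "summable (\<lambda>n. norm (d n))"
        proof (rule summable_comparison_test')
          have "summable (\<lambda>n. norm (of_real (c n) * (of_real r :: complex) ^ n))"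
            unfolding c_def by (rule summable_kernel_coeff[OF p B lin bdd M]) (use r in auto)
          then show "summable (\<lambda>n. norm (of_real (c n) * (of_real r :: complex) ^ n) * M)"
            by (rule summable_mult2)
          show "norm (norm (d n)) \<le> norm (of_real (c n) * (of_real r :: complex) ^ n) * M" for n
            using functional_monom_le[OF p B lin bdd M, of n]
            by (simp add: d_def \<psi>_def norm_mult mult_left_mono)
        qed
        have ser: "\<phi> (disc_kernel B (of_real r * \<zeta>)) = (\<Sum>n. d n * cnj \<zeta> ^ n)" if "norm \<zeta> = 1" for \<zeta>
          using functional_kernel[OF p B lin bdd M, of "of_real r * \<zeta>"] r that
          by (simp add: sums_iff d_def c_def \<psi>_def norm_mult power_mult_distrib mult_ac)
        have cS: "continuous_on (sphere 0 1) (\<lambda>\<zeta>. \<Sum>n. d n * cnj \<zeta> ^ n)"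
          using c2 by (rule continuous_on_eq) (simp add: ser)
        have "cmean (\<lambda>\<zeta>. q (of_real r * \<zeta>) * \<phi> (disc_kernel B (of_real r * \<zeta>)))
            = cmean (\<lambda>\<zeta>. \<Sum>i<m. a i * of_real r ^ i * (\<zeta> ^ i * (\<Sum>n. d n * cnj \<zeta> ^ n)))"
        proof (rule cmean_cong)
          fix \<zeta> :: complex assume \<zeta>: "norm \<zeta> = 1"
          have "q (of_real r * \<zeta>) = (\<Sum>i<m. a i * of_real r ^ i * \<zeta> ^ i)"
            using r \<zeta> by (simp add: q_def sum_fun_apply fscale_def disc_monom_def norm_mult power_mult_distrib mult_ac)
          then show "q (of_real r * \<zeta>) * \<phi> (disc_kernel B (of_real r * \<zeta>))
              = (\<Sum>i<m. a i * of_real r ^ i * (\<zeta> ^ i * (\<Sum>n. d n * cnj \<zeta> ^ n)))"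
            by (simp add: ser[OF \<zeta>] sum_distrib_right mult.assoc)
        qed
        also have "\<dots> = (\<Sum>i<m. cmean (\<lambda>\<zeta>. a i * of_real r ^ i * (\<zeta> ^ i * (\<Sum>n. d n * cnj \<zeta> ^ n))))"
          by (rule cmean_sum) (intro continuous_intros cS)
        also have "\<dots> = (\<Sum>i<m. a i * of_real r ^ i * d i)"
          by (simp only: cmean_mult_left cmean_coefficient[OF summ_d])
        also have "\<dots> = J r"
          unfolding J_def d_def by (intro sum.cong) (simp_all add: power_mult power2_eq_square power_mult_distrib mult_ac)
        finally have "norm (J r) \<le> cmean F"
          using norm_cmean_le[OF continuous_on_mult[OF c1 c2]] by (simp add: F_def[abs_def] norm_mult)
        have cF0: "0 \<le> cmean F" by (rule cmean_nonneg[OF cF]) (simp add: F_def)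
        have wr: "w r \<le> (real B + 1) * 2 ^ (B + 1) * (1 - r) ^ B"
        proof -
          have "(1 - r\<^sup>2) ^ B = (1 - r) ^ B * (1 + r) ^ B"
            by (simp add: power2_eq_square algebra_simps flip: power_mult_distrib)
          also have "\<dots> \<le> (1 - r) ^ B * 2 ^ B"
            using r by (intro mult_left_mono power_mono) auto
          finally have "2 * r * (1 - r\<^sup>2) ^ B \<le> 2 * 1 * ((1 - r) ^ B * 2 ^ B)"
            using r by (intro mult_mono) (auto simp: power_le_one)
          then have "(real B + 1) * (2 * r * (1 - r\<^sup>2) ^ B) \<le> (real B + 1) * (2 * 1 * ((1 - r) ^ B * 2 ^ B))"
            by (intro mult_left_mono) auto
          then show ?thesis by (simp add: w_def mult_ac)
        qed
        have "w r * norm (J r) \<le> ((real B + 1) * 2 ^ (B + 1) * (1 - r) ^ B) * cmean F"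
          using wr \<open>norm (J r) \<le> cmean F\<close> r w0[OF True] by (intro mult_mono) auto
        also have "\<dots> = rep_const B * (2 * pi * cmean (\<lambda>\<zeta>. (1 - r) ^ B * F \<zeta>))"
          by (simp add: rep_const_def cmean_mult_left)
        finally have "ennreal (w r * norm (J r)) \<le> ennreal (rep_const B * (2 * pi * cmean (\<lambda>\<zeta>. (1 - r) ^ B * F \<zeta>)))"
          by (rule ennreal_leI)
        also have "\<dots> = ennreal (rep_const B) * ennreal (2 * pi * cmean (\<lambda>\<zeta>. (1 - r) ^ B * F \<zeta>))"
          using rep_const_pos[of B] r cF0 by (intro ennreal_mult) (auto simp: cmean_mult_left)
        also have "ennreal (2 * pi * cmean (\<lambda>\<zeta>. (1 - r) ^ B * F \<zeta>))
            = (\<integral>\<^sup>+t. ennreal ((1 - r) ^ B * F (cis t)) * indicator {0..2*pi} t \<partial>lborel)"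
          using r by (intro nn_integral_cis[symmetric] continuous_intros cF) (auto simp: F_def)
        also have "\<dots> = (\<integral>\<^sup>+t. ennreal (hyp_weight (r, t)) * ennreal (hyp_size p q (r, t) * kernel_pair p B \<phi> (r, t)) \<partial>lborel)"
        proof (rule nn_integral_cong)
          fix t
          \<comment> \<open>The exponents of the density, of \<open>hyp_size\<close> and of
            \<open>kernel_pair\<close> add up to -2 + 1/p + (B + 2 - 1/p) = B, the power that the
            weight leaves.\<close>
          have "(1 - r) powr (-2) * ((1 - r) powr (1 / p) * (1 - r) powr (real (B + 2) - 1 / p)) = (1 - r) ^ B"
            using r by (simp add: powr_add[symmetric] flip: powr_realpow)
          then have "(1 - r) ^ B * F (cis t) =
              (1 - r) powr (-2) * ((1 - r) powr (1 / p) * (1 - r) powr (real (B + 2) - 1 / p)) * F (cis t)"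
            by (simp only:)
          also have "\<dots> = (1 - r) powr (-2) * (hyp_size p q (r, t) * kernel_pair p B \<phi> (r, t))"
            by (simp add: hyp_size_def kernel_pair_def F_def disc_point_def mult_ac)
          finally have e: "(1 - r) ^ B * F (cis t) = (1 - r) powr (-2) * (hyp_size p q (r, t) * kernel_pair p B \<phi> (r, t))" .
          show "ennreal ((1 - r) ^ B * F (cis t)) * indicator {0..2*pi} t
              = ennreal (hyp_weight (r, t)) * ennreal (hyp_size p q (r, t) * kernel_pair p B \<phi> (r, t))"
            unfolding e using r
            by (auto simp: hyp_weight_def hyp_size_def kernel_pair_def ennreal_mult split: split_indicator)
        qed
        finally show ?thesis using True by simp
      qed simp
    qed
  qed
  also have "\<dots> = ennreal (rep_const B) * (\<integral>\<^sup>+r. \<integral>\<^sup>+t. ennreal (hyp_weight (r, t)) *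
      ennreal (hyp_size p q (r, t) * kernel_pair p B \<phi> (r, t)) \<partial>lborel \<partial>lborel)"
    by (rule nn_integral_cmult, rule lborel.borel_measurable_nn_integral) (simp add: lborel_prod, measurable)
  also have "(\<integral>\<^sup>+r. \<integral>\<^sup>+t. ennreal (hyp_weight (r, t)) *
      ennreal (hyp_size p q (r, t) * kernel_pair p B \<phi> (r, t)) \<partial>lborel \<partial>lborel)
      = (\<integral>\<^sup>+x. ennreal (hyp_size p q x * kernel_pair p B \<phi> x) \<partial>hyp_measure)"
    by (rule nn_integral_hyp_measure[symmetric]) measurable
  finally show ?thesis .
qed

text \<open>Approximation by a polynomial q: the left side changes by at most \<open>M\<close> times
  the norm of f - q. So does the integral up to a constant, because \<open>kernel_pair\<close> is at
  most \<open>M\<close> and \<open>hyp_size\<close> of f - q is integrable with a bound by its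
  norm.\<close>

lemma functional_representation:
  assumes f: "f \<in> hardy p"
  shows "ennreal (norm (\<phi> f)) \<le> ennreal (rep_const B) *
    (\<integral>\<^sup>+x. ennreal (hyp_size p f x * kernel_pair p B \<phi> x) \<partial>hyp_measure)"
proof -
  have p': "0 < p" "p \<le> 1" using p by auto
  obtain C where C: "C > 0" "\<And>f. f \<in> hardy p \<Longrightarrow> (\<integral>\<^sup>+x. ennreal (hyp_size p f x) \<partial>hyp_measure) \<le> ennreal (C * hardy_norm p f)"
    using hyp_total_bound[OF p] by blast
  define X where "X = (\<integral>\<^sup>+x. ennreal (hyp_size p f x * kernel_pair p B \<phi> x) \<partial>hyp_measure)"
  define K where "K = rep_const B"
  have K: "0 < K" unfolding K_def by (rule rep_const_pos)
  \<comment> \<open>When q is within t = e / L of \<open>f\<close>, the two errors together are (L -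
    1) t; the added 1 keeps \<open>L\<close> positive.\<close>
  define L where "L = M + K * (M * C) + 1"
  have L: "0 < L" using M K C by (auto simp: L_def intro!: add_nonneg_pos add_nonneg_nonneg)
  have eps: "ennreal (norm (\<phi> f)) \<le> ennreal K * X + ennreal e" if e: "0 < e" for e
  proof -
    define t where "t = e / L"
    have t: "0 < t" "L * t = e" using e L by (auto simp: t_def)
    obtain a m where am: "hardy_norm p (f - (\<Sum>i<m. fscale (a i) (disc_monom i))) \<le> t"
      using polynomials_dense[OF p' f, of t] t by auto
    define q where "q = (\<Sum>i<m. fscale (a i) (disc_monom i))"
    have q: "q \<in> hardy p" unfolding q_def by (intro hardy_sum hardy_scale_le disc_monom_hardy p')
    have fq: "f - q \<in> hardy p" by (rule hardy_diff[OF p' f q])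
    have nfq: "hardy_norm p (f - q) \<le> t" using am by (simp add: q_def)
    note [measurable] = measurable_hyp_size[OF p q] measurable_hyp_size[OF p f] measurable_hyp_size[OF p fq]
      measurable_kernel_pair[OF p B lin bdd M]
    have "norm (\<phi> f) \<le> norm (\<phi> (f - q)) + norm (\<phi> q)"
      using functional_diff[OF p B lin bdd M f q] norm_triangle_ineq[of "\<phi> f - \<phi> q" "\<phi> q"] by simp
    also have "norm (\<phi> (f - q)) \<le> M * t"
      using bdd[OF fq] nfq M by (meson order_trans mult_left_mono)
    finally have "ennreal (norm (\<phi> f)) \<le> ennreal (M * t + norm (\<phi> q))"
      by (rule ennreal_leI) simp
    also have "\<dots> = ennreal (M * t) + ennreal (norm (\<phi> q))"
      by (rule ennreal_plus) (use M t in auto)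
    also have "ennreal (norm (\<phi> q)) \<le> ennreal K * (\<integral>\<^sup>+x. ennreal (hyp_size p q x * kernel_pair p B \<phi> x) \<partial>hyp_measure)"
      unfolding q_def K_def by (rule functional_representation_polynomial)
    also have "(\<integral>\<^sup>+x. ennreal (hyp_size p q x * kernel_pair p B \<phi> x) \<partial>hyp_measure)
        \<le> (\<integral>\<^sup>+x. ennreal (hyp_size p f x * kernel_pair p B \<phi> x) + ennreal M * ennreal (hyp_size p (f - q) x) \<partial>hyp_measure)"
    proof (rule nn_integral_mono_AE)
      show "AE x in hyp_measure. ennreal (hyp_size p q x * kernel_pair p B \<phi> x)
          \<le> ennreal (hyp_size p f x * kernel_pair p B \<phi> x) + ennreal M * ennreal (hyp_size p (f - q) x)"
        using AE_hyp_measure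
      proof eventually_elim
        case (elim x)
        have kp: "0 \<le> kernel_pair p B \<phi> x" "kernel_pair p B \<phi> x \<le> M"
          using kernel_pair_le[OF p B lin bdd M] elim by (auto simp: kernel_pair_def)
        have "norm (q (disc_point x)) \<le> norm (f (disc_point x)) + norm ((f - q) (disc_point x))"
          using norm_triangle_ineq4[of "f (disc_point x)" "(f - q) (disc_point x)"] by simp
        then have "hyp_size p q x \<le> hyp_size p f x + hyp_size p (f - q) x"
          unfolding hyp_size_def by (simp only: distrib_right[symmetric]) (intro mult_right_mono, auto)
        then have "hyp_size p q x * kernel_pair p B \<phi> x \<le> (hyp_size p f x + hyp_size p (f - q) x) * kernel_pair p B \<phi> x"
          using kp by (intro mult_right_mono) auto
        also have "\<dots> \<le> hyp_size p f x * kernel_pair p B \<phi> x + M * hyp_size p (f - q) x"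
          using kp(2) mult_left_mono[OF kp(2), of "hyp_size p (f - q) x"] by (simp add: algebra_simps hyp_size_def)
        finally have "ennreal (hyp_size p q x * kernel_pair p B \<phi> x) \<le> ennreal (hyp_size p f x * kernel_pair p B \<phi> x + M * hyp_size p (f - q) x)"
          by (rule ennreal_leI)
        also have "\<dots> = ennreal (hyp_size p f x * kernel_pair p B \<phi> x) + ennreal M * ennreal (hyp_size p (f - q) x)"
          using M kp by (subst ennreal_plus) (auto simp: hyp_size_def ennreal_mult)
        finally show ?case .
      qed
    qed
    also have "\<dots> = X + ennreal M * (\<integral>\<^sup>+x. ennreal (hyp_size p (f - q) x) \<partial>hyp_measure)"
      unfolding X_def by (subst nn_integral_add) (auto simp: nn_integral_cmult)
    also have "(\<integral>\<^sup>+x. ennreal (hyp_size p (f - q) x) \<partial>hyp_measure) \<le> ennreal (C * t)"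
      using C(2)[OF fq] C(1) nfq by (meson order_trans ennreal_leI mult_left_mono less_imp_le)
    finally have "ennreal (norm (\<phi> f)) \<le> ennreal (M * t) + ennreal K * (X + ennreal M * ennreal (C * t))"
      by (simp add: add_left_mono mult_left_mono)
    also have "\<dots> = ennreal K * X + ennreal (M * t + K * (M * (C * t)))"
      using M K C(1) t by (simp add: distrib_left ennreal_mult[symmetric] add_ac)
    also have "\<dots> \<le> ennreal K * X + ennreal e"
    proof (intro add_left_mono ennreal_leI)
      have "M * t + K * (M * (C * t)) = (L - 1) * t"
        by (simp add: L_def algebra_simps)
      also have "\<dots> \<le> L * t" using t by (intro mult_right_mono) auto
      finally show "M * t + K * (M * (C * t)) \<le> e" using t by simp
    qed
    finally show ?thesis .
  qed
  show ?thesis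
    unfolding X_def[symmetric] K_def[symmetric]
  proof (rule ennreal_le_epsilon)
    fix e :: real assume "0 < e"
    then show "ennreal (norm (\<phi> f)) \<le> ennreal K * X + ennreal e" by (rule eps)
  qed
qed

end

text \<open>The constants are uniform in \<open>\<phi>\<close> and \<open>f\<close>, so one pair
  serves a whole basis with its dual. In the representation of 1, the regions where one factor is at
  most \<open>d\<close> contribute at most half, by the total and the layer bound; on the remaining
  set the integrand is at most M^2.\<close>

lemma functional_hyp_density:
  fixes p M :: real and B :: nat
  assumes p: "0 < p" "p < 1" and B: "2 \<le> real (B + 2) * p" and M: "0 < M"
  shows "\<exists>d>0. \<exists>c>0. \<forall>\<phi> f. linear_on (*) (hardy p) \<phi> \<longrightarrow> (\<forall>g\<in>hardy p. norm (\<phi> g) \<le> M * hardy_norm p g) \<longrightarrow>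
    f \<in> hardy p \<longrightarrow> hardy_norm p f \<le> M \<longrightarrow> \<phi> f = 1 \<longrightarrow>
    ennreal c \<le> emeasure hyp_measure {x. d < hyp_size p f x \<and> d < kernel_pair p B \<phi> x}"
proof -
  have p': "0 < p" "p \<le> 1" using p by auto
  obtain C1 where C1: "C1 > 0" "\<And>f. f \<in> hardy p \<Longrightarrow> (\<integral>\<^sup>+x. ennreal (hyp_size p f x) \<partial>hyp_measure) \<le> ennreal (C1 * hardy_norm p f)"
    using hyp_total_bound[OF p] by blast
  obtain C2 where C2: "C2 > 0" "\<And>f d. f \<in> hardy p \<Longrightarrow> 0 < d \<Longrightarrow>
    (\<integral>\<^sup>+x. ennreal (hyp_size p f x * indicator {x. hyp_size p f x \<le> d} x) \<partial>hyp_measure)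
      \<le> ennreal (C2 * d powr (1 - p) * hardy_norm p f powr p)"
    using hyp_layer_bound[OF p] by blast
  define K where "K = rep_const B"
  have K: "0 < K" unfolding K_def by (rule rep_const_pos)
  define a where "a = K * C1 * M"
  define b where "b = K * (M * (C2 * M powr p))"
  have ab: "0 < a" "0 < b" using K C1 C2 M by (auto simp: a_def b_def)
  \<comment> \<open>Makes a d <= 1/4, for the region of small kernel factor, and b d^(1 - p) <= 1/4,
    for the region where the function is small.\<close>
  define d where "d = min (1 / (4 * a)) ((1 / (4 * b)) powr (1 / (1 - p)))"
  have d: "0 < d" using ab by (auto simp: d_def)
  have da: "a * d \<le> 1 / 4"
  proof -
    have "a * d \<le> a * (1 / (4 * a))" using ab by (intro mult_left_mono) (auto simp: d_def)
    then show ?thesis using ab by simp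
  qed
  have db: "b * d powr (1 - p) \<le> 1 / 4"
  proof -
    have "d powr (1 - p) \<le> ((1 / (4 * b)) powr (1 / (1 - p))) powr (1 - p)"
      using d p by (intro powr_mono2) (auto simp: d_def)
    also have "\<dots> = 1 / (4 * b)" using p ab by (simp add: powr_powr)
    finally have "b * d powr (1 - p) \<le> b * (1 / (4 * b))" using ab by (intro mult_left_mono) auto
    then show ?thesis using ab by simp
  qed
  \<comment> \<open>The remaining half divided by the bound K M^2 per unit of area.\<close>
  define c where "c = 1 / (2 * (K * (M * M)))"
  have c: "0 < c" using K M by (simp add: c_def)
  have main: "ennreal c \<le> emeasure hyp_measure {x. d < hyp_size p f x \<and> d < kernel_pair p B \<phi> x}"
    if lin: "linear_on (*) (hardy p) \<phi>" and bdd: "\<And>g. g \<in> hardy p \<Longrightarrow> norm (\<phi> g) \<le> M * hardy_norm p g"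
      and f: "f \<in> hardy p" "hardy_norm p f \<le> M" and one: "\<phi> f = 1" for \<phi> f
  proof -
    have M0: "0 \<le> M" using M by simp
    note [measurable] = measurable_hyp_size[OF p f(1)] measurable_kernel_pair[OF p B lin bdd M0]
    define E where "E = {x. d < hyp_size p f x \<and> d < kernel_pair p B \<phi> x}"
    have [measurable]: "E \<in> sets borel" unfolding E_def by measurable
    define s where "s x = hyp_size p f x" for x
    have [measurable]: "s \<in> borel_measurable borel" unfolding s_def[abs_def] by measurable
    have s0: "0 \<le> s x" for x by (simp add: s_def hyp_size_def)
    have "ennreal 1 \<le> ennreal K * (\<integral>\<^sup>+x. ennreal (s x * kernel_pair p B \<phi> x) \<partial>hyp_measure)"
      using functional_representation[OF p B lin bdd M0 f(1)] by (simp add: one K_def s_def)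
    also have "(\<integral>\<^sup>+x. ennreal (s x * kernel_pair p B \<phi> x) \<partial>hyp_measure) \<le>
       (\<integral>\<^sup>+x. (ennreal d * ennreal (s x) + ennreal M * ennreal (s x * indicator {x. s x \<le> d} x)) + ennreal (M * M) * indicator E x \<partial>hyp_measure)"
    proof (rule nn_integral_mono_AE)
      show "AE x in hyp_measure. ennreal (s x * kernel_pair p B \<phi> x) \<le>
          (ennreal d * ennreal (s x) + ennreal M * ennreal (s x * indicator {x. s x \<le> d} x)) + ennreal (M * M) * indicator E x"
        using AE_hyp_measure
      proof eventually_elim
        case (elim x)
        have kp: "0 \<le> kernel_pair p B \<phi> x" "kernel_pair p B \<phi> x \<le> M"
          using kernel_pair_le[OF p B lin bdd M0] elim by (auto simp: kernel_pair_def)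
        have sM: "s x \<le> M" using hyp_size_le[OF p f(1)] elim f(2) unfolding s_def by fastforce
        have "s x * kernel_pair p B \<phi> x \<le> (d * s x + M * (s x * indicator {x. s x \<le> d} x)) + M * M * indicator E x"
        proof (cases "x \<in> E")
          case True
          have "s x * kernel_pair p B \<phi> x \<le> M * M" using kp sM s0[of x] M by (intro mult_mono) auto
          moreover have "0 \<le> d * s x + M * (s x * indicator {x. s x \<le> d} x)"
            using d M s0[of x] by (intro add_nonneg_nonneg mult_nonneg_nonneg) auto
          ultimately show ?thesis using True by simp
        next
          case False
          then consider "s x \<le> d" | "kernel_pair p B \<phi> x \<le> d" by (auto simp: E_def s_def)
          then show ?thesis
          proof cases
            case 1
            have "s x * kernel_pair p B \<phi> x \<le> M * s x"
              using mult_left_mono[OF kp(2) s0[of x]] by (simp add: mult.commute)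
            moreover have "0 \<le> d * s x" using d s0[of x] by simp
            ultimately show ?thesis using 1 False by simp
          next
            case 2
            have "s x * kernel_pair p B \<phi> x \<le> d * s x"
              using mult_left_mono[OF 2 s0[of x]] by (simp add: mult.commute)
            moreover have "0 \<le> M * (s x * indicator {x. s x \<le> d} x)" using M s0[of x] by simp
            ultimately show ?thesis using False by simp
          qed
        qed
        then have "ennreal (s x * kernel_pair p B \<phi> x) \<le> ennreal ((d * s x + M * (s x * indicator {x. s x \<le> d} x)) + M * M * indicator E x)"
          by (rule ennreal_leI)
        also have "\<dots> = (ennreal d * ennreal (s x) + ennreal M * ennreal (s x * indicator {x. s x \<le> d} x)) + ennreal (M * M) * indicator E x"
        proof -
          have nn: "0 \<le> d * s x" "0 \<le> M * (s x * indicator {x. s x \<le> d} x)" "0 \<le> M * M * indicator E x"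
            using d M s0[of x] by auto
          have "ennreal (M * M * indicator E x) = ennreal (M * M) * indicator E x"
            by (auto split: split_indicator)
          then show ?thesis
            using nn d M s0[of x] by (simp only: ennreal_plus add_nonneg_nonneg) (simp add: ennreal_mult)
        qed
        finally show ?case .
      qed
    qed
    also have "\<dots> = (ennreal d * (\<integral>\<^sup>+x. ennreal (s x) \<partial>hyp_measure)
        + ennreal M * (\<integral>\<^sup>+x. ennreal (s x * indicator {x. s x \<le> d} x) \<partial>hyp_measure)) + ennreal (M * M) * emeasure hyp_measure E"
      by (simp add: nn_integral_add nn_integral_cmult)
    also have "\<dots> \<le> (ennreal d * ennreal (C1 * M) + ennreal M * ennreal (C2 * d powr (1 - p) * M powr p)) + ennreal (M * M) * emeasure hyp_measure E"
    proof (intro add_mono mult_left_mono order_refl)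
      have "(\<integral>\<^sup>+x. ennreal (s x) \<partial>hyp_measure) \<le> ennreal (C1 * hardy_norm p f)"
        unfolding s_def by (rule C1(2)[OF f(1)])
      also have "\<dots> \<le> ennreal (C1 * M)" using f C1 by (intro ennreal_leI mult_left_mono) auto
      finally show "(\<integral>\<^sup>+x. ennreal (s x) \<partial>hyp_measure) \<le> ennreal (C1 * M)" .
      have "(\<integral>\<^sup>+x. ennreal (s x * indicator {x. s x \<le> d} x) \<partial>hyp_measure) \<le> ennreal (C2 * d powr (1 - p) * hardy_norm p f powr p)"
        unfolding s_def by (rule C2(2)[OF f(1) d])
      also have "\<dots> \<le> ennreal (C2 * d powr (1 - p) * M powr p)"
        using f C2 p by (intro ennreal_leI mult_left_mono powr_mono2 hardy_norm_nonneg[OF p']) auto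
      finally show "(\<integral>\<^sup>+x. ennreal (s x * indicator {x. s x \<le> d} x) \<partial>hyp_measure) \<le> ennreal (C2 * d powr (1 - p) * M powr p)" .
    qed auto
    finally have le: "ennreal 1 \<le> ennreal K * ((ennreal d * ennreal (C1 * M) + ennreal M * ennreal (C2 * d powr (1 - p) * M powr p)) + ennreal (M * M) * emeasure hyp_measure E)"
      by (simp add: mult_left_mono)
    show ?thesis
    proof (cases "emeasure hyp_measure E")
      case (real e)
      have nn: "0 \<le> d * (C1 * M)" "0 \<le> M * (C2 * d powr (1 - p) * M powr p)" "0 \<le> M * M * e"
        using d C1(1) C2(1) M real(1) by auto
      have "ennreal K * ((ennreal d * ennreal (C1 * M) + ennreal M * ennreal (C2 * d powr (1 - p) * M powr p)) + ennreal (M * M) * emeasure hyp_measure E)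
          = ennreal (K * ((d * (C1 * M) + M * (C2 * d powr (1 - p) * M powr p)) + M * M * e))"
        using nn d C1(1) C2(1) M K real
        by (simp only: ennreal_mult ennreal_plus add_nonneg_nonneg less_imp_le mult_nonneg_nonneg powr_ge_zero real(2))
      with le have "ennreal 1 \<le> ennreal (K * ((d * (C1 * M) + M * (C2 * d powr (1 - p) * M powr p)) + M * M * e))"
        by (simp only:)
      moreover have "0 \<le> K * ((d * (C1 * M) + M * (C2 * d powr (1 - p) * M powr p)) + M * M * e)"
        by (rule mult_nonneg_nonneg[OF less_imp_le[OF K] add_nonneg_nonneg[OF add_nonneg_nonneg[OF nn(1,2)] nn(3)]])
      ultimately have "1 \<le> K * ((d * (C1 * M) + M * (C2 * d powr (1 - p) * M powr p)) + M * M * e)"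
        by (simp only: ennreal_le_iff)
      also have "\<dots> = a * d + b * d powr (1 - p) + K * (M * M) * e"
        by (simp add: a_def b_def algebra_simps)
      finally have "1 / 2 \<le> K * (M * M) * e" using da db by linarith
      then have "c \<le> e" using K M by (simp add: c_def field_simps)
      then show ?thesis using real by (simp add: E_def[symmetric] ennreal_leI)
    next
      case top
      then show ?thesis by (simp add: E_def[symmetric])
    qed
  qed
  show ?thesis
    by (rule exI[of _ d], rule conjI[OF d], rule exI[of _ c], rule conjI[OF c]) (simp add: main)
qed

text \<open>The subsets of \<open>A\<close> pair up as S and insert n S. Their sums differ by
  \<open>v n\<close>, so at least one of the two exceeds d / 2; choosing it gives an injection from
  the subsets without \<open>n\<close>.\<close>

lemma card_large_subset_sums:
  fixes v :: "nat \<Rightarrow> complex"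
  assumes A: "finite A" "n \<in> A" and "d < norm (v n)"
  shows "2 ^ card A \<le> 2 * card {S \<in> Pow A. d / 2 < norm (\<Sum>i\<in>S. v i)}"
proof -
  define P where "P S \<longleftrightarrow> d / 2 < norm (\<Sum>i\<in>S. v i)" for S
  define g where "g S = (if P S then S else insert n S)" for S
  have "card (Pow (A - {n})) \<le> card {S \<in> Pow A. P S}"
  proof (rule card_inj_on_le)
    show "inj_on g (Pow (A - {n}))"
    proof (rule inj_on_inverseI)
      fix S assume "S \<in> Pow (A - {n})"
      then show "g S - {n} = S" by (auto simp: g_def)
    qed
    show "g ` Pow (A - {n}) \<subseteq> {S \<in> Pow A. P S}"
    proof safe
      fix S assume S: "S \<subseteq> A - {n}"
      show "P (g S)"
      proof (cases "P S")
        case False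
        have "finite S" "n \<notin> S" using S A finite_subset by auto
        then have "v n = (\<Sum>i\<in>insert n S. v i) - (\<Sum>i\<in>S. v i)" by simp
        then have "norm (v n) \<le> norm (\<Sum>i\<in>insert n S. v i) + norm (\<Sum>i\<in>S. v i)"
          using norm_triangle_ineq4 by metis
        then show ?thesis using False assms(3) by (auto simp: P_def g_def)
      qed (simp add: g_def)
      fix i assume "i \<in> g S"
      then show "i \<in> A" using S A by (auto simp: g_def split: if_splits)
    qed
    show "finite {S \<in> Pow A. P S}" using A by auto
  qed
  moreover have "card (Pow (A - {n})) = 2 ^ (card A - 1)" using A by (simp add: card_Pow)
  moreover have "(2::nat) ^ card A = 2 * 2 ^ (card A - 1)"
    using A by (metis card_gt_0_iff empty_iff power_eq_if mult.commute neq0_conv)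
  ultimately show ?thesis unfolding P_def by simp
qed

text \<open>
  Averaging over all subsets \<open>S\<close> of \<open>A\<close> plays the role of Khintchine's inequality: wherever some
  \<open>y n\<close> is large, at least half of the sums over \<open>S\<close> are at least half as large.
\<close>

lemma card_bound_of_hyp_density:
  fixes p d c L :: real and k :: nat and A :: "nat set"
  assumes p: "0 < p" "p < 1" and A: "finite A" and y: "\<And>n. n \<in> A \<Longrightarrow> y n \<in> hardy p"
    and d: "0 < d" and c: "0 < c" and L: "0 \<le> L"
    and E: "\<And>n. n \<in> A \<Longrightarrow> E n \<in> sets borel" "\<And>n. n \<in> A \<Longrightarrow> ennreal c \<le> emeasure hyp_measure (E n)"
      "\<And>n x. n \<in> A \<Longrightarrow> x \<in> E n \<Longrightarrow> d < hyp_size p (y n) x"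
    and overlap: "\<And>x. 0 < fst x \<Longrightarrow> fst x < 1 \<Longrightarrow> card {n \<in> A. x \<in> E n} \<le> k"
    and sub: "\<And>S. S \<subseteq> A \<Longrightarrow> hardy_norm p (\<Sum>n\<in>S. y n) \<le> L"
  shows "c * real (card A) \<le> 2 * real k * (16 * pi * L powr p / (d / 2) powr p)"
proof -
  have p': "0 < p" "p \<le> 1" using p by auto
  define f where "f S = (\<Sum>n\<in>S. y n)" for S
  have f: "f S \<in> hardy p" if "S \<subseteq> A" for S
    unfolding f_def using that y by (intro hardy_sum[OF p']) auto
  define T where "T S = {x. d / 2 < hyp_size p (f S) x}" for S
  have T: "T S \<in> sets borel" if "S \<subseteq> A" for S
    using measurable_hyp_size[OF p f[OF that]] unfolding T_def by measurable
  define X where "X = 16 * pi * L powr p / (d / 2) powr p"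
  have X: "0 \<le> X" by (simp add: X_def)
  have TX: "emeasure hyp_measure (T S) \<le> ennreal X" if S: "S \<subseteq> A" for S
  proof -
    have "emeasure hyp_measure (T S) \<le> ennreal (16 * pi * hardy_norm p (f S) powr p / (d / 2) powr p)"
      unfolding T_def using d by (intro hyp_weak_type[OF p f[OF S]]) auto
    also have "\<dots> \<le> ennreal X"
      unfolding X_def using sub[OF S] p hardy_norm_nonneg[OF p' f[OF S]]
      by (intro ennreal_leI divide_right_mono mult_left_mono powr_mono2) (auto simp: f_def)
    finally show ?thesis .
  qed
  define N where "N = (2::nat) ^ card A"
  have N: "0 < N" by (simp add: N_def)
  have pt: "AE x in hyp_measure. (\<Sum>n\<in>A. of_nat N * indicator (E n) x) \<le> (\<Sum>S\<in>Pow A. ennreal (2 * real k) * indicator (T S) x)"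
    using AE_hyp_measure
  proof eventually_elim
    case (elim x)
    define e where "e = card {n \<in> A. x \<in> E n}"
    have l: "(\<Sum>n\<in>A. of_nat N * indicator (E n) x) = (of_nat (N * e) :: ennreal)"
    proof -
      have "(\<Sum>n\<in>A. indicator (E n) x) = (of_nat e :: ennreal)"
        unfolding e_def using A by (simp add: indicator_def sum.If_cases Int_def)
      then show ?thesis by (simp add: sum_distrib_left[symmetric])
    qed
    have r: "(\<Sum>S\<in>Pow A. ennreal (2 * real k) * indicator (T S) x) = of_nat (2 * k * card {S \<in> Pow A. x \<in> T S})"
    proof -
      have "(\<Sum>S\<in>Pow A. indicator (T S) x) = (of_nat (card {S \<in> Pow A. x \<in> T S}) :: ennreal)"
        using A by (simp add: indicator_def sum.If_cases Int_def)
      moreover have "ennreal (2 * real k) = of_nat (2 * k)"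
        by (metis ennreal_of_nat_eq_real_of_nat of_nat_mult of_nat_numeral)
      ultimately show ?thesis by (simp add: sum_distrib_left[symmetric])
    qed
    \<comment> \<open>At a point of some \<open>E n\<close> at least half of the N subset sums are
      large, while at most \<open>k\<close> of the sets contain the point.\<close>
    have "N * e \<le> 2 * k * card {S \<in> Pow A. x \<in> T S}"
    proof (cases "e = 0")
      case False
      then obtain n where n: "n \<in> A" "x \<in> E n" by (auto simp: e_def card_gt_0_iff)
      define v where "v i = y i (disc_point x) * of_real ((1 - fst x) powr (1 / p))" for i
      have v: "hyp_size p (f S) x = norm (\<Sum>i\<in>S. v i)" for S
        by (simp add: hyp_size_def f_def sum_fun_apply v_def norm_mult flip: sum_distrib_right)
      have "d < norm (v n)" using E(3)[OF n] by (simp add: hyp_size_def v_def norm_mult)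
      from card_large_subset_sums[of A n d v, OF A n(1) this]
      have "N \<le> 2 * card {S \<in> Pow A. x \<in> T S}" by (simp add: N_def T_def v)
      moreover have "e \<le> k" unfolding e_def using elim by (intro overlap) auto
      ultimately have "N * e \<le> (2 * card {S \<in> Pow A. x \<in> T S}) * k" by (intro mult_mono) auto
      then show ?thesis by (simp add: mult_ac)
    qed simp
    then show ?case unfolding l r by (simp only: of_nat_le_iff)
  qed
  have "ennreal (real N * (c * real (card A))) = of_nat N * (\<Sum>n\<in>A. ennreal c)"
    using c by (simp add: ennreal_mult ennreal_of_nat_eq_real_of_nat mult.commute)
  also have "\<dots> \<le> of_nat N * (\<Sum>n\<in>A. emeasure hyp_measure (E n))"
    by (intro mult_left_mono sum_mono E) auto
  also have "\<dots> = (\<Sum>n\<in>A. \<integral>\<^sup>+x. of_nat N * indicator (E n) x \<partial>hyp_measure)"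
    unfolding sum_distrib_left using E(1) by (intro sum.cong) (auto simp: nn_integral_cmult_indicator)
  also have "\<dots> = (\<integral>\<^sup>+x. (\<Sum>n\<in>A. of_nat N * indicator (E n) x) \<partial>hyp_measure)"
    using E(1) by (intro nn_integral_sum[symmetric]) auto
  also have "\<dots> \<le> (\<integral>\<^sup>+x. (\<Sum>S\<in>Pow A. ennreal (2 * real k) * indicator (T S) x) \<partial>hyp_measure)"
    by (rule nn_integral_mono_AE[OF pt])
  also have "\<dots> = (\<Sum>S\<in>Pow A. \<integral>\<^sup>+x. ennreal (2 * real k) * indicator (T S) x \<partial>hyp_measure)"
    using T by (intro nn_integral_sum) auto
  also have "\<dots> = (\<Sum>S\<in>Pow A. ennreal (2 * real k) * emeasure hyp_measure (T S))"
    using T by (intro sum.cong) (auto simp: nn_integral_cmult_indicator)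
  also have "\<dots> \<le> (\<Sum>S\<in>Pow A. ennreal (2 * real k) * ennreal X)"
    by (intro sum_mono mult_left_mono TX) auto
  also have "\<dots> = ennreal (real N * (2 * real k * X))"
    using X A by (simp add: N_def card_Pow ennreal_mult ennreal_of_nat_eq_real_of_nat)
  finally have "real N * (c * real (card A)) \<le> real N * (2 * real k * X)"
    using X by (subst (asm) ennreal_le_iff) auto
  then show ?thesis
    unfolding X_def[symmetric] using N by (simp only: mult_le_cancel_left_pos of_nat_0_less_iff)
qed

section \<open>Greedy-type bases\<close>

lemma powr_le_imp_le_root:
  fixes a b C p :: real
  assumes "a powr p \<le> C * b powr p" "0 \<le> a" "0 \<le> b" "0 \<le> C" "0 < p"
  shows "a \<le> C powr (1 / p) * b"
proof -
  have "(a powr p) powr (1 / p) \<le> (C * b powr p) powr (1 / p)"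
    using assms by (intro powr_mono2) auto
  then show ?thesis using assms by (simp add: powr_powr powr_mult)
qed

text \<open>Otherwise the simplifier may turn \<open>N (f + g)\<close> into \<open>N (\<lambda>z. f z + g z)\<close>.\<close>

declare plus_fun_apply [simp del] zero_fun_apply [simp del] minus_apply [simp del]

locale p_normed_space =
  fixes X :: "('a \<Rightarrow> complex) set" and N :: "('a \<Rightarrow> complex) \<Rightarrow> real" and p :: real
  assumes p_pos: "0 < p" and p_le: "p \<le> 1"
    and zero_mem: "0 \<in> X"
    and add_mem: "f \<in> X \<Longrightarrow> g \<in> X \<Longrightarrow> f + g \<in> X"
    and scale_mem: "f \<in> X \<Longrightarrow> fscale c f \<in> X"
    and N_nonneg: "f \<in> X \<Longrightarrow> 0 \<le> N f"
    and N_add: "f \<in> X \<Longrightarrow> g \<in> X \<Longrightarrow> N (f + g) powr p \<le> N f powr p + N g powr p"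
    and N_scale: "f \<in> X \<Longrightarrow> N (fscale c f) = norm c * N f"
begin

lemma N_zero: "N 0 = 0"
proof -
  have "fscale 0 0 = (0 :: 'a \<Rightarrow> complex)" by (simp add: fscale_def zero_fun_def)
  then show ?thesis using N_scale[OF zero_mem, of 0] by simp
qed

lemma diff_conv: "f - g = f + fscale (- 1) g"
  by (simp add: fscale_def fun_eq_iff plus_fun_apply minus_apply)

lemma diff_mem: "f \<in> X \<Longrightarrow> g \<in> X \<Longrightarrow> f - g \<in> X"
  unfolding diff_conv by (intro add_mem scale_mem)

lemma N_diff: "f \<in> X \<Longrightarrow> g \<in> X \<Longrightarrow> N (f - g) powr p \<le> N f powr p + N g powr p"
  using N_add[OF _ scale_mem, of f g "- 1"] N_scale[of g "- 1"] unfolding diff_conv by simp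

lemma sum_mem: "(\<And>i. i \<in> A \<Longrightarrow> F i \<in> X) \<Longrightarrow> (\<Sum>i\<in>A. F i) \<in> X"
  by (induction A rule: infinite_finite_induct) (auto intro: zero_mem add_mem)

lemma N_sum:
  assumes "finite A" "\<And>i. i \<in> A \<Longrightarrow> F i \<in> X"
  shows "N (\<Sum>i\<in>A. F i) powr p \<le> (\<Sum>i\<in>A. N (F i) powr p)"
  using assms
proof (induction A rule: finite_induct)
  case (insert x A)
  have "N (F x + (\<Sum>i\<in>A. F i)) powr p \<le> N (F x) powr p + N (\<Sum>i\<in>A. F i) powr p"
    using insert.prems by (intro N_add sum_mem) auto
  also have "\<dots> \<le> N (F x) powr p + (\<Sum>i\<in>A. N (F i) powr p)"
    using insert by (intro add_left_mono) auto
  finally show ?case using insert by simp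
qed (simp add: N_zero)

lemma N_scale_powr: "f \<in> X \<Longrightarrow> N (fscale c f) powr p = norm c powr p * N f powr p"
  using N_scale N_nonneg by (simp add: powr_mult)

end

text \<open>The property whose unique solution of a given size is \<open>greedy_set\<close>: a set
  can then be exhibited instead of unfolding a definite description.\<close>

definition is_greedy :: "(nat \<Rightarrow> ('a \<Rightarrow> complex) \<Rightarrow> complex) \<Rightarrow> ('a \<Rightarrow> complex) \<Rightarrow> nat set \<Rightarrow> bool" where
  "is_greedy xs f A \<longleftrightarrow> finite A \<and> (\<forall>i\<in>A. \<forall>j. j \<notin> A \<longrightarrow>
     cmod (xs i f) > cmod (xs j f) \<or> (cmod (xs i f) = cmod (xs j f) \<and> i < j))"

text \<open>Two different sets of equal finite size each contain an index missing from the other,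
  and each of these two indices would have to precede the other.\<close>

lemma greedy_set_eq:
  assumes "is_greedy xs f A"
  shows "greedy_set xs (card A) f = A"
  unfolding greedy_set_def
proof (rule the_equality)
  show "finite A \<and> card A = card A \<and> (\<forall>i\<in>A. \<forall>j. j \<notin> A \<longrightarrow>
      cmod (xs j f) < cmod (xs i f) \<or> cmod (xs i f) = cmod (xs j f) \<and> i < j)"
    using assms by (auto simp: is_greedy_def)
  fix B assume B: "finite B \<and> card B = card A \<and> (\<forall>i\<in>B. \<forall>j. j \<notin> B \<longrightarrow>
      cmod (xs j f) < cmod (xs i f) \<or> cmod (xs i f) = cmod (xs j f) \<and> i < j)"
  show "B = A"
  proof (rule ccontr)
    assume ne: "B \<noteq> A"
    have fin: "finite A" "finite B" "card B = card A" using assms B by (auto simp: is_greedy_def)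
    have "\<not> B \<subseteq> A" using card_subset_eq[of A B] fin ne by auto
    moreover have "\<not> A \<subseteq> B" using card_subset_eq[of B A] fin ne by auto
    ultimately obtain i j where ij: "i \<in> A" "i \<notin> B" "j \<in> B" "j \<notin> A" by blast
    have "cmod (xs i f) > cmod (xs j f) \<or> (cmod (xs i f) = cmod (xs j f) \<and> i < j)"
      using assms ij by (auto simp: is_greedy_def)
    moreover have "cmod (xs j f) > cmod (xs i f) \<or> (cmod (xs j f) = cmod (xs i f) \<and> j < i)"
      using B ij by blast
    ultimately show False by auto
  qed
qed

section \<open>Bases, their coefficients and greedy sets\<close>

locale p_normed_basis = p_normed_space Y N p
  for Y :: "('a \<Rightarrow> complex) set" and N p +
  fixes y :: "nat \<Rightarrow> 'a \<Rightarrow> complex" and ys :: "nat \<Rightarrow> ('a \<Rightarrow> complex) \<Rightarrow> complex"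
  assumes basis: "basis_dual N Y y ys"
begin

lemma y_mem: "y n \<in> Y"
  using basis by (auto simp: basis_dual_def)

lemma ys_add: "f \<in> Y \<Longrightarrow> g \<in> Y \<Longrightarrow> ys n (f + g) = ys n f + ys n g"
  and ys_scale: "f \<in> Y \<Longrightarrow> ys n (fscale c f) = c * ys n f"
  using basis by (auto simp: basis_dual_def linear_on_def)

lemma ys_y: "ys n (y k) = (if n = k then 1 else 0)"
  using basis by (auto simp: basis_dual_def)

lemma ys_zero: "ys n 0 = 0"
proof -
  have "fscale 0 0 = (0 :: 'a \<Rightarrow> complex)" by (simp add: fscale_def zero_fun_def)
  then show ?thesis using ys_scale[OF zero_mem, of n 0] by simp
qed

lemma ys_diff: "f \<in> Y \<Longrightarrow> g \<in> Y \<Longrightarrow> ys n (f - g) = ys n f - ys n g"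
  unfolding diff_conv by (simp add: ys_add scale_mem ys_scale)

definition vec :: "(nat \<Rightarrow> complex) \<Rightarrow> nat set \<Rightarrow> 'a \<Rightarrow> complex" where
  "vec c A = (\<Sum>n\<in>A. fscale (c n) (y n))"

lemma vec_apply: "vec c A z = (\<Sum>n\<in>A. c n * y n z)"
  by (simp add: vec_def sum_fun_apply fscale_def)

lemma vec_mem: "vec c A \<in> Y"
  unfolding vec_def by (intro sum_mem scale_mem y_mem)

lemma vec_add: "vec c A + vec d A = vec (\<lambda>n. c n + d n) A"
  by (simp add: fun_eq_iff vec_apply plus_fun_apply sum.distrib distrib_right)

lemma vec_scale: "fscale a (vec c A) = vec (\<lambda>n. a * c n) A"
  by (simp add: fun_eq_iff vec_apply fscale_def sum_distrib_left mult.assoc)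

lemma vec_union: "finite A \<Longrightarrow> finite B \<Longrightarrow> A \<inter> B = {} \<Longrightarrow> vec c (A \<union> B) = vec c A + vec c B"
  by (simp add: vec_def sum.union_disjoint)

lemma vec_restrict: "finite A \<Longrightarrow> S \<subseteq> A \<Longrightarrow> vec (\<lambda>n. if n \<in> S then c n else 0) A = vec c S"
  unfolding fun_eq_iff vec_apply
  by (auto intro!: sum.mono_neutral_cong_right)

lemma vec_cong: "(\<And>n. n \<in> A \<Longrightarrow> c n = d n) \<Longrightarrow> vec c A = vec d A"
  by (simp add: vec_def)

lemma vec_one: "vec (\<lambda>_. 1) A = (\<Sum>n\<in>A. y n)"
  by (simp add: fun_eq_iff vec_apply sum_fun_apply)

lemma coord_proj_eq: "coord_proj y ys A f = vec (\<lambda>n. ys n f) A"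
  by (simp add: coord_proj_def vec_def)

lemma ys_vec: "finite A \<Longrightarrow> ys k (vec c A) = (if k \<in> A then c k else 0)"
proof (induction A rule: finite_induct)
  case empty
  have "vec c {} = 0" by (simp add: vec_def)
  then show ?case by (simp add: ys_zero)
next
  case (insert n A)
  have "vec c (insert n A) = fscale (c n) (y n) + vec c A"
    using insert by (simp add: vec_def)
  then show ?case
    using insert by (simp add: ys_add scale_mem y_mem vec_mem ys_scale ys_y)
qed

text \<open>The coefficients of a vector tend to 0: it is close to a finite combination
  \<open>g\<close>, and outside the support of \<open>g\<close> the uniform bound on the dual
  functionals makes its coefficients small.\<close>

lemma finite_large_coeffs:
  assumes f: "f \<in> Y" and e: "0 < e"
  shows "finite {n. e \<le> norm (ys n f)}"
proof -
  interpret vs: vector_space fscale by (rule vector_space_fscale)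
  obtain C where C: "\<And>n f. f \<in> Y \<Longrightarrow> norm (ys n f) \<le> C * N f"
    using basis unfolding basis_dual_def by blast
  define C' where "C' = \<bar>C\<bar> + 1"
  have C': "0 < C'" "norm (ys n f) \<le> C' * N f" if "f \<in> Y" for n f
  proof -
    show "0 < C'" by (simp add: C'_def)
    have "C * N f \<le> C' * N f" using N_nonneg[OF that] by (intro mult_right_mono) (auto simp: C'_def)
    then show "norm (ys n f) \<le> C' * N f" using C[OF that, of n] by linarith
  qed
  have "f \<in> closed_span N Y (range y)" using f basis by (simp add: basis_dual_def)
  moreover have "0 < e / C'" using e C'(1)[OF f] by simp
  ultimately obtain g where g: "g \<in> vs.span (range y)" "N (f - g) < e / C'"
    unfolding closed_span_def by blast
  have "g \<in> Y \<and> finite {n. ys n g \<noteq> 0}"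
    using g(1)
  proof (induction rule: vs.span_induct_alt)
    case base
    then show ?case by (simp add: zero_mem ys_zero)
  next
    case (step c x g)
    then obtain k where k: "x = y k" by auto
    have "{n. ys n (fscale c x + g) \<noteq> 0} \<subseteq> insert k {n. ys n g \<noteq> 0}"
      using step by (auto simp: k ys_add scale_mem y_mem ys_scale ys_y)
    then show ?case
      using step by (auto simp: k add_mem scale_mem y_mem intro: finite_subset)
  qed
  then have gY: "g \<in> Y" and fin: "finite {n. ys n g \<noteq> 0}" by auto
  have "{n. e \<le> norm (ys n f)} \<subseteq> {n. ys n g \<noteq> 0}"
  proof safe
    fix n assume n: "e \<le> norm (ys n f)" "ys n g = 0"
    have "norm (ys n f) = norm (ys n (f - g))" using n f gY by (simp add: ys_diff)
    also have "\<dots> \<le> C' * N (f - g)" using f gY by (intro C' diff_mem)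
    also have "\<dots> < C' * (e / C')" using g(2) C'(1)[OF f] by (intro mult_strict_left_mono) auto
    also have "\<dots> = e" using C'(1)[OF f] by simp
    finally show False using n by simp
  qed
  then show ?thesis using fin finite_subset by blast
qed

lemma greedy_level_set:
  assumes "f \<in> Y" "0 < e"
  shows "is_greedy ys f {n. e \<le> norm (ys n f)}"
  using finite_large_coeffs[OF assms] by (auto simp: is_greedy_def)

lemma greedy_exists:
  assumes f: "f \<in> Y"
  shows "\<exists>A. is_greedy ys f A \<and> card A = m"
proof (induction m)
  case 0
  show ?case by (rule exI[of _ "{}"]) (simp add: is_greedy_def)
next
  case (Suc m)
  then obtain A where A: "is_greedy ys f A" "card A = m" by blast
  define a where "a n = norm (ys n f)" for n
  have fin: "finite A" using A by (simp add: is_greedy_def)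
  \<comment> \<open>A largest remaining coefficient exists: either one of them is positive, and only
    finitely many are as large, or all vanish.\<close>
  have "\<exists>j. j \<notin> A \<and> (\<forall>k. k \<notin> A \<longrightarrow> a k \<le> a j)"
  proof (cases "\<exists>j. j \<notin> A \<and> a j > 0")
    case True
    then obtain j0 where j0: "j0 \<notin> A" "a j0 > 0" by blast
    define S where "S = {n. a j0 \<le> a n} - A"
    have S: "finite S" "S \<noteq> {}" using finite_large_coeffs[OF f j0(2)] j0 by (auto simp: S_def a_def)
    obtain j where j: "j \<in> S" "\<And>k. k \<in> S \<Longrightarrow> a k \<le> a j"
      using Max_in[of "a ` S"] Max_ge[of "a ` S"] S by fastforce
    have "a k \<le> a j" if "k \<notin> A" for k
      using j(2)[of k] j(1) that by (cases "a j0 \<le> a k") (auto simp: S_def)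
    then show ?thesis using j by (auto simp: S_def)
  next
    case False
    obtain j where "j \<notin> A" using ex_new_if_finite[OF infinite_UNIV_nat fin] by blast
    moreover have "a k = 0" if "k \<notin> A" for k
      using False that by (force simp: a_def)
    ultimately show ?thesis by (intro exI[of _ j]) (auto simp: a_def)
  qed
  then obtain j0 where j0: "j0 \<notin> A" "\<And>k. k \<notin> A \<Longrightarrow> a k \<le> a j0" by blast
  \<comment> \<open>Among the largest remaining coefficients the least index is taken, as the rule
    for ties demands.\<close>
  define P where "P j \<longleftrightarrow> j \<notin> A \<and> a j = a j0" for j
  define j where "j = (LEAST j. P j)"
  have P: "P j" unfolding j_def by (rule LeastI[of _ j0]) (use j0 in \<open>simp add: P_def\<close>)
  have least: "j \<le> k" if "P k" for k unfolding j_def by (rule Least_le[of P, OF that])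
  have "is_greedy ys f (insert j A)"
    unfolding is_greedy_def
  proof (intro conjI ballI allI impI)
    fix i k assume i: "i \<in> insert j A" and k: "k \<notin> insert j A"
    show "norm (ys k f) < norm (ys i f) \<or> norm (ys i f) = norm (ys k f) \<and> i < k"
    proof (cases "i = j")
      case False
      then show ?thesis using i k A(1) by (auto simp: is_greedy_def)
    next
      case True
      have "a k \<le> a j" using j0(2)[of k] k P by (auto simp: P_def)
      moreover have "j < k" if "a k = a j"
        using least[of k] k P that by (force simp: P_def)
      ultimately show ?thesis using True by (auto simp: a_def)
    qed
  qed (use fin in auto)
  moreover have "card (insert j A) = Suc m" using P fin A by (simp add: P_def)
  ultimately show ?case by blast
qed

text \<open>Unconditionality for constant coefficients, with complex signs. The constant refers to
  p-th powers, in which errors can be absorbed.\<close>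

definition ucc :: "real \<Rightarrow> bool" where
  "ucc K \<longleftrightarrow> (\<forall>\<epsilon> A S. (\<forall>n. norm (\<epsilon> n) = 1) \<longrightarrow> finite A \<longrightarrow> S \<subseteq> A \<longrightarrow>
     N (vec \<epsilon> S) powr p \<le> K * N (vec \<epsilon> A) powr p)"

text \<open>
  Enlarging the coefficients on \<open>S\<close> by a factor \<open>1 + d\<close> makes \<open>S\<close> the greedy set; a small but
  fixed \<open>d\<close> suffices, as the error is absorbed.
\<close>

lemma ucc_of_perturbation:
  assumes C: "0 \<le> C"
    and pert: "\<And>\<epsilon> A S d. (\<And>n. norm (\<epsilon> n) = 1) \<Longrightarrow> finite A \<Longrightarrow> S \<subseteq> A \<Longrightarrow> 0 < d \<Longrightarrow>
      is_greedy ys (vec (\<lambda>n. if n \<in> S then of_real (1 + d) * \<epsilon> n else \<epsilon> n) A) S \<Longrightarrow>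
      N (vec \<epsilon> S) \<le> C * N (vec (\<lambda>n. if n \<in> S then of_real (1 + d) * \<epsilon> n else \<epsilon> n) A)"
  shows "ucc (2 * C powr p)"
  unfolding ucc_def
proof (intro allI impI)
  fix \<epsilon> :: "nat \<Rightarrow> complex" and A S :: "nat set"
  assume eps: "\<forall>n. norm (\<epsilon> n) = 1" and A: "finite A" "S \<subseteq> A"
  \<comment> \<open>Ensures C^p d^p <= 1/2, so that the term with \<open>vec \<epsilon> S\<close>
    can be absorbed on the left.\<close>
  define d where "d = (1 / (2 * (C powr p + 1))) powr (1 / p)"
  have q: "0 < C powr p + 1" by (simp add: add_nonneg_pos)
  have d: "0 < d" "d powr p = 1 / (2 * (C powr p + 1))"
    using p_pos q by (auto simp: d_def powr_powr less_imp_neq[OF q, symmetric])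
  define f where "f = vec (\<lambda>n. if n \<in> S then of_real (1 + d) * \<epsilon> n else \<epsilon> n) A"
  have co: "ys k f = (if k \<in> A then if k \<in> S then of_real (1 + d) * \<epsilon> k else \<epsilon> k else 0)" for k
    unfolding f_def by (rule ys_vec[OF A(1)])
  have nd: "norm (of_real (1 + d) * \<epsilon> k) = 1 + d" for k
    using eps d by (simp add: norm_mult del: of_real_add)
  have "is_greedy ys f S"
    using A eps d finite_subset by (auto simp: is_greedy_def co nd simp del: of_real_add)
  then have le: "N (vec \<epsilon> S) \<le> C * N f"
    unfolding f_def using eps A d by (intro pert) auto
  have "f = vec \<epsilon> A + vec (\<lambda>n. if n \<in> S then of_real d * \<epsilon> n else 0) A"
    unfolding f_def vec_add by (rule vec_cong) (simp add: algebra_simps)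
  also have "vec (\<lambda>n. if n \<in> S then of_real d * \<epsilon> n else 0) A = fscale (of_real d) (vec \<epsilon> S)"
    using A by (simp add: vec_restrict vec_scale)
  finally have "N f powr p \<le> N (vec \<epsilon> A) powr p + N (fscale (of_real d) (vec \<epsilon> S)) powr p"
    by (simp add: N_add vec_mem scale_mem)
  also have "N (fscale (of_real d) (vec \<epsilon> S)) powr p = d powr p * N (vec \<epsilon> S) powr p"
    using d by (simp add: N_scale_powr vec_mem)
  finally have f: "N f powr p \<le> N (vec \<epsilon> A) powr p + d powr p * N (vec \<epsilon> S) powr p" .
  have "N (vec \<epsilon> S) powr p \<le> (C * N f) powr p"
    using p_pos N_nonneg[OF vec_mem] by (intro powr_mono2 le) auto
  also have "\<dots> = C powr p * N f powr p"
    using C N_nonneg[OF vec_mem] by (simp add: powr_mult f_def)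
  also have "\<dots> \<le> C powr p * (N (vec \<epsilon> A) powr p + d powr p * N (vec \<epsilon> S) powr p)"
    by (intro mult_left_mono f) auto
  also have "\<dots> = C powr p * N (vec \<epsilon> A) powr p + (C powr p * d powr p) * N (vec \<epsilon> S) powr p"
    by (simp add: algebra_simps)
  also have "\<dots> \<le> C powr p * N (vec \<epsilon> A) powr p + (1 / 2) * N (vec \<epsilon> S) powr p"
    unfolding d(2) using q by (intro add_left_mono mult_right_mono) (auto simp: field_simps)
  finally show "N (vec \<epsilon> S) powr p \<le> 2 * C powr p * N (vec \<epsilon> A) powr p" by simp
qed

text \<open>
  In a \<open>p\<close>-convex space the supremum \<open>W\<close> over all \<open>c\<close> with values in the unit interval satisfies
  \<open>W \<le> 2^(-p) (K N_A + W)\<close>, because \<open>c = (b + c') / 2\<close> with \<open>b\<close> an indicator function.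
\<close>

lemma ucc_lattice_real:
  assumes K: "ucc K" "0 \<le> K" and A: "finite A" and eps: "\<And>n. norm (\<epsilon> n) = 1"
    and c: "\<And>n. 0 \<le> c n \<and> c n \<le> 1"
  shows "N (vec (\<lambda>n. of_real (c n) * \<epsilon> n) A) powr p \<le> K / (2 powr p - 1) * N (vec \<epsilon> A) powr p"
proof -
  define I where "I = {c :: nat \<Rightarrow> real. \<forall>n. 0 \<le> c n \<and> c n \<le> 1}"
  define v where "v c = N (vec (\<lambda>n. of_real (c n) * \<epsilon> n) A) powr p" for c
  \<comment> \<open>The self-referential estimate bounds the supremum only once it is known to be
    finite; the sum of the norms is a crude bound.\<close>
  have bdd: "bdd_above (v ` I)"
  proof (rule bdd_aboveI2)
    fix c assume c: "c \<in> I"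
    have "v c \<le> (\<Sum>n\<in>A. N (fscale (of_real (c n) * \<epsilon> n) (y n)) powr p)"
      unfolding v_def vec_def by (intro N_sum A scale_mem y_mem)
    also have "\<dots> \<le> (\<Sum>n\<in>A. N (y n) powr p)"
    proof (rule sum_mono)
      fix n
      have "N (fscale (of_real (c n) * \<epsilon> n) (y n)) = c n * N (y n)"
        using c eps by (simp add: N_scale y_mem norm_mult I_def)
      also have "\<dots> \<le> N (y n)" using c N_nonneg[OF y_mem] by (intro mult_left_le_one_le) (auto simp: I_def)
      finally show "N (fscale (of_real (c n) * \<epsilon> n) (y n)) powr p \<le> N (y n) powr p"
        using p_pos N_nonneg scale_mem y_mem by (intro powr_mono2) auto
    qed
    finally show "v c \<le> (\<Sum>n\<in>A. N (y n) powr p)" .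
  qed
  define W where "W = (SUP c\<in>I. v c)"
  have ne: "I \<noteq> {}" unfolding I_def by (auto intro!: exI[of _ "\<lambda>_. 0"])
  define N0 where "N0 = K * N (vec \<epsilon> A) powr p"
  have half: "v c \<le> (N0 + W) / 2 powr p" if c: "c \<in> I" for c
  proof -
    \<comment> \<open>\<open>S\<close> records the first binary digit of the coefficients, and
      \<open>c'\<close> is what remains after doubling and removing that digit.\<close>
    define S where "S = {n \<in> A. 1 / 2 \<le> c n}"
    define c' where "c' n = (if 1 / 2 \<le> c n then 2 * c n - 1 else 2 * c n)" for n
    have c': "c' \<in> I" using c by (auto simp: I_def c'_def)
    have "vec (\<lambda>n. of_real (c n) * \<epsilon> n) A
        = fscale (1 / 2) (vec (\<lambda>n. if n \<in> S then \<epsilon> n else 0) A + vec (\<lambda>n. of_real (c' n) * \<epsilon> n) A)"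
      unfolding vec_add vec_scale
      by (rule vec_cong) (auto simp: S_def c'_def field_simps)
    also have "vec (\<lambda>n. if n \<in> S then \<epsilon> n else 0) A = vec \<epsilon> S"
      using A by (intro vec_restrict) (auto simp: S_def)
    finally have "v c = (1 / 2) powr p * N (vec \<epsilon> S + vec (\<lambda>n. of_real (c' n) * \<epsilon> n) A) powr p"
      unfolding v_def by (simp add: N_scale_powr add_mem vec_mem norm_divide)
    also have "\<dots> \<le> (1 / 2) powr p * (N (vec \<epsilon> S) powr p + v c')"
      unfolding v_def by (intro mult_left_mono N_add vec_mem) auto
    also have "\<dots> \<le> (1 / 2) powr p * (N0 + W)"
    proof (intro mult_left_mono add_mono)
      show "N (vec \<epsilon> S) powr p \<le> N0"
        using K eps A unfolding ucc_def N0_def S_def by auto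
      show "v c' \<le> W" unfolding W_def by (rule cSUP_upper[OF c' bdd])
    qed auto
    finally show ?thesis by (simp add: powr_divide)
  qed
  have two: "1 < (2::real) powr p" using p_pos by simp
  have "W \<le> (N0 + W) / 2 powr p"
    unfolding W_def by (rule cSUP_least[OF ne]) (use half in \<open>simp add: W_def\<close>)
  then have "W * (2 powr p - 1) \<le> N0" using two by (simp add: field_simps)
  then have "W \<le> N0 / (2 powr p - 1)" using two by (simp add: pos_le_divide_eq)
  moreover have "v c \<le> W" unfolding W_def using c by (intro cSUP_upper bdd) (auto simp: I_def)
  ultimately show ?thesis by (simp add: v_def N0_def)
qed

text \<open>The quotient c / \<epsilon> is split into the positive and negative parts of its real
  and imaginary parts, each with values in the unit interval; hence the factor 4.\<close>

lemma ucc_lattice: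
  assumes K: "ucc K" "0 \<le> K" and A: "finite A" and eps: "\<And>n. norm (\<epsilon> n) = 1"
    and c: "\<And>n. n \<in> A \<Longrightarrow> norm (c n) \<le> 1"
  shows "N (vec c A) powr p \<le> 4 * (K / (2 powr p - 1)) * N (vec \<epsilon> A) powr p"
proof -
  define d where "d n = (if n \<in> A then c n / \<epsilon> n else 0)" for n
  have nd: "norm (d n) \<le> 1" for n using c eps by (auto simp: d_def norm_divide)
  define F where "F s = vec (\<lambda>n. of_real (max 0 (s (d n))) * \<epsilon> n) A" for s
  have F: "F s \<in> Y" for s unfolding F_def by (rule vec_mem)
  have NF: "N (F s) powr p \<le> K / (2 powr p - 1) * N (vec \<epsilon> A) powr p"
    if "\<And>z. \<bar>s z\<bar> \<le> norm z" for s
    unfolding F_def using order_trans[OF that nd] by (intro ucc_lattice_real K A eps) (auto simp: abs_le_iff)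
  have e0: "\<epsilon> n \<noteq> 0" for n using eps[of n] by auto
  have "vec c A = (F Re - F (\<lambda>z. - Re z)) + fscale \<i> (F Im - F (\<lambda>z. - Im z))"
  proof
    fix z
    have "c n = (of_real (max 0 (Re (d n))) - of_real (max 0 (- Re (d n)))
        + \<i> * (of_real (max 0 (Im (d n))) - of_real (max 0 (- Im (d n))))) * \<epsilon> n" if n: "n \<in> A" for n
    proof -
      have "of_real (max 0 (Re (d n))) - of_real (max 0 (- Re (d n)))
        + \<i> * (of_real (max 0 (Im (d n))) - of_real (max 0 (- Im (d n)))) = d n"
        by (auto simp: complex_eq_iff max_def)
      then show ?thesis using n e0 by (simp add: d_def)
    qed
    then have "vec c A z = (\<Sum>n\<in>A. (of_real (max 0 (Re (d n))) - of_real (max 0 (- Re (d n)))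
        + \<i> * (of_real (max 0 (Im (d n))) - of_real (max 0 (- Im (d n))))) * \<epsilon> n * y n z)"
      unfolding vec_apply by (intro sum.cong) auto
    also have "\<dots> = ((F Re - F (\<lambda>z. - Re z)) + fscale \<i> (F Im - F (\<lambda>z. - Im z))) z"
      unfolding F_def
      by (simp add: vec_apply plus_fun_apply minus_apply fscale_def sum_subtractf[symmetric] sum_distrib_left sum.distrib[symmetric] algebra_simps)
    finally show "vec c A z = ((F Re - F (\<lambda>z. - Re z)) + fscale \<i> (F Im - F (\<lambda>z. - Im z))) z" .
  qed
  then have "N (vec c A) powr p \<le> N (F Re - F (\<lambda>z. - Re z)) powr p + N (fscale \<i> (F Im - F (\<lambda>z. - Im z))) powr p"
    by (simp only: N_add diff_mem scale_mem F)
  also have "N (fscale \<i> (F Im - F (\<lambda>z. - Im z))) powr p = N (F Im - F (\<lambda>z. - Im z)) powr p"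
    by (simp add: N_scale diff_mem F)
  also have "N (F Re - F (\<lambda>z. - Re z)) powr p + N (F Im - F (\<lambda>z. - Im z)) powr p
      \<le> (N (F Re) powr p + N (F (\<lambda>z. - Re z)) powr p) + (N (F Im) powr p + N (F (\<lambda>z. - Im z)) powr p)"
    by (intro add_mono N_diff F)
  also have "\<dots> \<le> (K / (2 powr p - 1) * N (vec \<epsilon> A) powr p + K / (2 powr p - 1) * N (vec \<epsilon> A) powr p)
      + (K / (2 powr p - 1) * N (vec \<epsilon> A) powr p + K / (2 powr p - 1) * N (vec \<epsilon> A) powr p)"
    by (intro add_mono NF) (simp_all add: abs_Re_le_cmod abs_Im_le_cmod)
  finally show ?thesis by simp
qed

end

section \<open>Truncations and greedy projections\<close>

lemma norm_sign1 [simp]: "norm (sign1 a) = 1"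
  by (simp add: sign1_def norm_divide)

lemma sign1_mult: "of_real (norm a) * sign1 a = a"
  by (simp add: sign1_def)

text \<open>For real parts, the sum of absolute values is the sum over the nonnegative ones minus
  the sum over the others, hence at most 2 Q; imaginary parts cost the same.\<close>

lemma sum_norm_le_subset_sums:
  fixes v :: "nat \<Rightarrow> complex"
  assumes A: "finite A" and Q: "\<And>S. S \<subseteq> A \<Longrightarrow> norm (\<Sum>n\<in>S. v n) \<le> Q"
  shows "(\<Sum>n\<in>A. norm (v n)) \<le> 4 * Q"
proof -
  have part: "(\<Sum>n\<in>A. \<bar>s (v n)\<bar>) \<le> 2 * Q"
    if s: "\<And>S. s (\<Sum>n\<in>S. v n) = (\<Sum>n\<in>S. s (v n))" "\<And>z. \<bar>s z\<bar> \<le> norm z" for s :: "complex \<Rightarrow> real"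
  proof -
    define S where "S = {n \<in> A. 0 \<le> s (v n)}"
    have "(\<Sum>n\<in>A. \<bar>s (v n)\<bar>) = (\<Sum>n\<in>S. \<bar>s (v n)\<bar>) + (\<Sum>n\<in>A - S. \<bar>s (v n)\<bar>)"
      using A by (subst sum.subset_diff[of S A]) (auto simp: S_def)
    also have "(\<Sum>n\<in>S. \<bar>s (v n)\<bar>) = s (\<Sum>n\<in>S. v n)"
      unfolding s(1) by (rule sum.cong) (auto simp: S_def)
    also have "(\<Sum>n\<in>A - S. \<bar>s (v n)\<bar>) = - s (\<Sum>n\<in>A - S. v n)"
      unfolding s(1) sum_negf[symmetric] by (rule sum.cong) (auto simp: S_def)
    also have "s (\<Sum>n\<in>S. v n) \<le> norm (\<Sum>n\<in>S. v n)" using s(2) abs_le_D1 by blast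
    also have "- s (\<Sum>n\<in>A - S. v n) \<le> norm (\<Sum>n\<in>A - S. v n)" using s(2) abs_le_D2 by blast
    also have "norm (\<Sum>n\<in>S. v n) \<le> Q" by (rule Q) (auto simp: S_def)
    also have "norm (\<Sum>n\<in>A - S. v n) \<le> Q" by (rule Q) auto
    finally show ?thesis by simp
  qed
  have "(\<Sum>n\<in>A. norm (v n)) \<le> (\<Sum>n\<in>A. \<bar>Re (v n)\<bar> + \<bar>Im (v n)\<bar>)"
    by (intro sum_mono cmod_le)
  also have "\<dots> \<le> 2 * Q + 2 * Q"
    unfolding sum.distrib by (intro add_mono part) (simp_all add: abs_Re_le_cmod abs_Im_le_cmod)
  finally show ?thesis by simp
qed

context p_normed_basis
begin

text \<open>A threshold \<open>t\<close> below the minimum replaces the minimum itself, so that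
  level sets can be used directly and the empty set needs no convention.\<close>

definition trunc_bound :: "real \<Rightarrow> bool" where
  "trunc_bound C \<longleftrightarrow> 0 \<le> C \<and> (\<forall>f\<in>Y. \<forall>A t. is_greedy ys f A \<longrightarrow> 0 < t \<longrightarrow> (\<forall>n\<in>A. t \<le> norm (ys n f)) \<longrightarrow>
     t * N (vec (\<lambda>n. sign1 (ys n f)) A) \<le> C * N f)"

definition greedy_bound :: "real \<Rightarrow> bool" where
  "greedy_bound C \<longleftrightarrow> 0 \<le> C \<and> (\<forall>f\<in>Y. \<forall>A. is_greedy ys f A \<longrightarrow> N (vec (\<lambda>n. ys n f) A) \<le> C * N f)"

lemma nonneg_bound:
  assumes "g \<in> Y" "a \<le> C * N g"
  shows "a \<le> max 0 C * N g"
  using assms N_nonneg[OF assms(1)] mult_right_mono[of C "max 0 C" "N g"] by linarith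

lemma trunc_bound_of_truncation_quasi_greedy:
  assumes "truncation_quasi_greedy N Y y ys"
  shows "\<exists>C. trunc_bound C"
proof -
  obtain C where C: "\<And>f m. f \<in> Y \<Longrightarrow> N (restricted_trunc_op y ys m f) \<le> C * N f"
    using assms by (auto simp: truncation_quasi_greedy_def)
  have "t * N (vec (\<lambda>n. sign1 (ys n f)) A) \<le> max 0 C * N f"
    if f: "f \<in> Y" and A: "is_greedy ys f A" and t: "0 < t" "\<forall>n\<in>A. t \<le> norm (ys n f)" for f A t
  proof (cases "A = {}")
    case True
    then show ?thesis using N_zero N_nonneg[OF f] by (simp add: vec_def)
  next
    case False
    have fin: "finite A" using A by (simp add: is_greedy_def)
    define M where "M = Min ((\<lambda>n. norm (ys n f)) ` A)"
    have M: "t \<le> M" unfolding M_def using fin False t by (subst Min_ge_iff) auto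
    have "restricted_trunc_op y ys (card A) f = fscale (of_real M) (vec (\<lambda>n. sign1 (ys n f)) A)"
      by (simp add: restricted_trunc_op_def greedy_set_eq[OF A] M_def vec_def)
    then have "M * N (vec (\<lambda>n. sign1 (ys n f)) A) \<le> C * N f"
      using C[OF f, of "card A"] M t by (simp add: N_scale vec_mem)
    moreover have "t * N (vec (\<lambda>n. sign1 (ys n f)) A) \<le> M * N (vec (\<lambda>n. sign1 (ys n f)) A)"
      by (intro mult_right_mono M N_nonneg vec_mem)
    ultimately have "t * N (vec (\<lambda>n. sign1 (ys n f)) A) \<le> C * N f" by linarith
    then show ?thesis by (rule nonneg_bound[OF f])
  qed
  then show ?thesis unfolding trunc_bound_def by (intro exI[of _ "max 0 C"]) auto
qed

lemma greedy_bound_of_quasi_greedy: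
  assumes "quasi_greedy N Y y ys"
  shows "\<exists>C. greedy_bound C"
proof -
  obtain C where C: "\<And>f m. f \<in> Y \<Longrightarrow> N (greedy_op y ys m f) \<le> C * N f"
    using assms by (auto simp: quasi_greedy_def)
  have "N (vec (\<lambda>n. ys n f) A) \<le> max 0 C * N f" if f: "f \<in> Y" and A: "is_greedy ys f A" for f A
    using nonneg_bound[OF f C[OF f, of "card A"]] by (simp add: greedy_op_def greedy_set_eq[OF A] coord_proj_eq)
  then show ?thesis unfolding greedy_bound_def by (intro exI[of _ "max 0 C"]) auto
qed

lemma ucc_of_trunc_bound:
  assumes C: "trunc_bound C"
  shows "ucc (2 * C powr p)"
proof (rule ucc_of_perturbation)
  show "0 \<le> C" using C by (simp add: trunc_bound_def)
  fix \<epsilon> :: "nat \<Rightarrow> complex" and A S :: "nat set" and d :: real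
  assume eps: "\<And>n. norm (\<epsilon> n) = 1" and A: "finite A" "S \<subseteq> A" and d: "0 < d"
  define f where "f = vec (\<lambda>n. if n \<in> S then of_real (1 + d) * \<epsilon> n else \<epsilon> n) A"
  assume "is_greedy ys (vec (\<lambda>n. if n \<in> S then of_real (1 + d) * \<epsilon> n else \<epsilon> n) A) S"
  then have gr: "is_greedy ys f S" by (simp only: f_def)
  have f: "f \<in> Y" unfolding f_def by (rule vec_mem)
  have co: "ys n f = of_real (1 + d) * \<epsilon> n" if "n \<in> S" for n
    using that A unfolding f_def by (subst ys_vec) auto
  have nd: "norm (of_real (1 + d) * \<epsilon> n) = 1 + d" for n
    using eps d by (simp add: norm_mult del: of_real_add)
  have "sign1 (ys n f) = \<epsilon> n" if "n \<in> S" for n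
  proof -
    have "of_real (1 + d) * \<epsilon> n \<noteq> 0" using nd[of n] d by (metis add_pos_pos less_irrefl norm_zero zero_less_one)
    then show ?thesis using that d by (simp add: co sign1_def nd del: of_real_add)
  qed
  then have v: "vec (\<lambda>n. sign1 (ys n f)) S = vec \<epsilon> S" by (rule vec_cong)
  have "(1 + d) * N (vec (\<lambda>n. sign1 (ys n f)) S) \<le> C * N f"
    using C f gr d by (auto simp: trunc_bound_def co nd simp del: of_real_add)
  then have "(1 + d) * N (vec \<epsilon> S) \<le> C * N f" by (simp only: v)
  moreover have "1 * N (vec \<epsilon> S) \<le> (1 + d) * N (vec \<epsilon> S)"
    using d N_nonneg[OF vec_mem] by (intro mult_right_mono) auto
  ultimately show "N (vec \<epsilon> S) \<le> C * N (vec (\<lambda>n. if n \<in> S then of_real (1 + d) * \<epsilon> n else \<epsilon> n) A)"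
    by (simp add: f_def)
qed

lemma ucc_of_greedy_bound:
  assumes C: "greedy_bound C"
  shows "ucc (2 * C powr p)"
proof (rule ucc_of_perturbation)
  show "0 \<le> C" using C by (simp add: greedy_bound_def)
  fix \<epsilon> :: "nat \<Rightarrow> complex" and A S :: "nat set" and d :: real
  assume A: "finite A" "S \<subseteq> A" and d: "0 < d"
  define f where "f = vec (\<lambda>n. if n \<in> S then of_real (1 + d) * \<epsilon> n else \<epsilon> n) A"
  assume "is_greedy ys (vec (\<lambda>n. if n \<in> S then of_real (1 + d) * \<epsilon> n else \<epsilon> n) A) S"
  then have gr: "is_greedy ys f S" by (simp only: f_def)
  have f: "f \<in> Y" unfolding f_def by (rule vec_mem)
  have co: "ys n f = of_real (1 + d) * \<epsilon> n" if "n \<in> S" for n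
    using that A unfolding f_def by (subst ys_vec) auto
  have "vec (\<lambda>n. ys n f) S = fscale (of_real (1 + d)) (vec \<epsilon> S)"
    unfolding vec_scale by (rule vec_cong) (rule co)
  then have "N (vec (\<lambda>n. ys n f) S) = (1 + d) * N (vec \<epsilon> S)"
    using d by (simp add: N_scale vec_mem del: of_real_add)
  moreover have "N (vec (\<lambda>n. ys n f) S) \<le> C * N f"
    using C f gr by (auto simp: greedy_bound_def)
  ultimately have "(1 + d) * N (vec \<epsilon> S) \<le> C * N f" by (simp only:)
  moreover have "1 * N (vec \<epsilon> S) \<le> (1 + d) * N (vec \<epsilon> S)"
    using d N_nonneg[OF vec_mem] by (intro mult_right_mono) auto
  ultimately show "N (vec \<epsilon> S) \<le> C * N (vec (\<lambda>n. if n \<in> S then of_real (1 + d) * \<epsilon> n else \<epsilon> n) A)"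
    by (simp add: f_def)
qed

text \<open>The full level set is greedy, so truncation bounds its signed sum; unconditionality for
  constant coefficients passes from it to any subset.\<close>

lemma large_coeff_sum_bound:
  assumes C: "trunc_bound C" and g: "g \<in> Y" and d: "0 < d" and S: "S \<subseteq> {n. d \<le> norm (ys n g)}"
  shows "N (vec (\<lambda>n. sign1 (ys n g)) S) \<le> (2 * C powr p) powr (1 / p) * (C * N g / d)"
proof -
  define A where "A = {n. d \<le> norm (ys n g)}"
  have A: "finite A" unfolding A_def by (rule finite_large_coeffs[OF g d])
  have "d * N (vec (\<lambda>n. sign1 (ys n g)) A) \<le> C * N g"
    using C g d greedy_level_set[OF g d] by (auto simp: trunc_bound_def A_def)
  then have le: "N (vec (\<lambda>n. sign1 (ys n g)) A) \<le> C * N g / d"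
    using d by (simp add: field_simps)
  have "N (vec (\<lambda>n. sign1 (ys n g)) S) powr p \<le> 2 * C powr p * N (vec (\<lambda>n. sign1 (ys n g)) A) powr p"
    using ucc_of_trunc_bound[OF C] A S by (auto simp: ucc_def A_def)
  from powr_le_imp_le_root[OF this N_nonneg[OF vec_mem] N_nonneg[OF vec_mem] _ p_pos]
  have "N (vec (\<lambda>n. sign1 (ys n g)) S) \<le> (2 * C powr p) powr (1 / p) * N (vec (\<lambda>n. sign1 (ys n g)) A)" by simp
  also have "\<dots> \<le> (2 * C powr p) powr (1 / p) * (C * N g / d)"
    by (intro mult_left_mono le) auto
  finally show ?thesis .
qed

text \<open>
  The levels \<open>|a n| \<in> [(1 + \<eta>)^k t, (1 + \<eta>)^(k + 1) t)\<close> are differences of greedy sets; on each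
  of them replacing the coefficients by their signs costs an error that is absorbed for small
  \<open>\<eta>\<close>, and the levels add up geometrically. The induction peels off the lowest level.
\<close>

lemma trunc_bound_of_greedy_bound:
  assumes C: "greedy_bound C"
  shows "\<exists>C'. trunc_bound C'"
proof -
  have C0: "0 \<le> C" using C by (simp add: greedy_bound_def)
  define K where "K = 2 * C powr p"
  have K: "ucc K" "0 \<le> K" using ucc_of_greedy_bound[OF C] by (auto simp: K_def)
  have two: "1 < (2::real) powr p" using p_pos by simp
  define K' where "K' = K / (2 powr p - 1)"
  have K': "0 \<le> K'" using K two by (simp add: K'_def)
  \<comment> \<open>Small enough for \<eta>^p K' <= 1/2, which absorbs the error of replacing the
    coefficients of one level by their signs.\<close>
  define \<eta> where "\<eta> = (1 / (2 * (K' + 1))) powr (1 / p)"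
  have \<eta>: "0 < \<eta>" "\<eta> powr p = 1 / (2 * (K' + 1))" using K' p_pos by (auto simp: \<eta>_def powr_powr)
  define q where "q = (1 + \<eta>) powr (- p)"
  have "(1 + \<eta>) powr (- p) < (1 + \<eta>) powr 0" using \<eta> p_pos by (intro powr_less_mono) auto
  then have q: "0 < q" "q < 1" using \<eta> by (auto simp: q_def)
  \<comment> \<open>The fixed point of D = 4 C^p + q D: a new lowest level costs 4 C^p, and the
    higher ones, whose threshold is larger by the factor 1 + \<eta>, contribute q times their own
    bound.\<close>
  define D where "D = 4 * C powr p / (1 - q)"
  have D: "0 \<le> D" "4 * C powr p + q * D = D" using q by (auto simp: D_def field_simps)
  have main: "t powr p * N (vec (\<lambda>n. sign1 (ys n f)) A) powr p \<le> D * N f powr p"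
    if f: "f \<in> Y" and "is_greedy ys f A" "0 < t" "\<forall>n\<in>A. t \<le> norm (ys n f)" for f A t
    using that(2-)
  proof (induction "card A" arbitrary: A t rule: less_induct)
    case less
    have fin: "finite A" using less.prems by (simp add: is_greedy_def)
    define \<epsilon> where "\<epsilon> n = sign1 (ys n f)" for n
    show ?case
    proof (cases "A = {}")
      case True
      then show ?thesis using D N_zero by (simp add: vec_def)
    next
      case False
      define s where "s = Min ((\<lambda>n. norm (ys n f)) ` A)"
      have ts: "t \<le> s" unfolding s_def using less.prems fin False by (subst Min_ge_iff) auto
      have s: "0 < s" "\<And>n. n \<in> A \<Longrightarrow> s \<le> norm (ys n f)" using ts less.prems fin by (auto simp: s_def)
      obtain n0 where n0: "n0 \<in> A" "norm (ys n0 f) = s"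
      proof -
        have "s \<in> (\<lambda>n. norm (ys n f)) ` A" unfolding s_def using fin False by (intro Min_in) auto
        then show ?thesis using that by blast
      qed
      define B where "B = {n \<in> A. (1 + \<eta>) * s \<le> norm (ys n f)}"
      define A0 where "A0 = A - B"
      have AB: "A = A0 \<union> B" "A0 \<inter> B = {}" "finite A0" "finite B" using fin by (auto simp: A0_def B_def)
      have grB: "is_greedy ys f B"
        using less.prems fin by (auto simp: is_greedy_def B_def)
      have "n0 \<notin> B" using n0 s \<eta> by (auto simp: B_def)
      then have "card B < card A" using fin n0 by (intro psubset_card_mono) (auto simp: B_def)
      then have IH: "((1 + \<eta>) * s) powr p * N (vec \<epsilon> B) powr p \<le> D * N f powr p"
        unfolding \<epsilon>_def using grB s \<eta> by (intro less.hyps) (auto simp: B_def)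
      have "vec (\<lambda>n. ys n f) A0 = vec (\<lambda>n. ys n f) A - vec (\<lambda>n. ys n f) B"
        unfolding AB(1) using AB by (simp add: vec_union)
      then have "N (vec (\<lambda>n. ys n f) A0) powr p \<le> N (vec (\<lambda>n. ys n f) A) powr p + N (vec (\<lambda>n. ys n f) B) powr p"
        by (simp add: N_diff vec_mem)
      also have "\<dots> \<le> (C * N f) powr p + (C * N f) powr p"
        using C f less.prems(1) grB p_pos
        by (intro add_mono powr_mono2 N_nonneg vec_mem) (auto simp: greedy_bound_def)
      finally have 1: "N (vec (\<lambda>n. ys n f) A0) powr p \<le> 2 * C powr p * N f powr p"
        using C0 N_nonneg[OF f] by (simp add: powr_mult)
      \<comment> \<open>The position of the modulus between s and (1 + \<eta>) s, rescaled to the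
        unit interval.\<close>
      define c where "c n = (if n \<in> A0 then (norm (ys n f) - s) / (\<eta> * s) else 0)" for n
      have c: "0 \<le> c n \<and> c n \<le> 1" for n
        using s \<eta> by (auto simp: c_def A0_def B_def field_simps)
      have "fscale (of_real s) (vec \<epsilon> A0) = vec (\<lambda>n. ys n f) A0 - fscale (of_real (\<eta> * s)) (vec (\<lambda>n. of_real (c n) * \<epsilon> n) A0)"
      proof -
        have "vec (\<lambda>n. ys n f) A0 = vec (\<lambda>n. of_real s * \<epsilon> n + of_real (\<eta> * s) * (of_real (c n) * \<epsilon> n)) A0"
        proof (rule vec_cong)
          fix n assume n: "n \<in> A0"
          have "s + \<eta> * s * c n = norm (ys n f)" using n s \<eta> by (simp add: c_def)
          then have "ys n f = of_real (s + \<eta> * s * c n) * \<epsilon> n"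
            unfolding \<epsilon>_def by (simp only: sign1_mult)
          then show "ys n f = of_real s * \<epsilon> n + of_real (\<eta> * s) * (of_real (c n) * \<epsilon> n)"
            by (simp add: algebra_simps)
        qed
        also have "\<dots> = fscale (of_real s) (vec \<epsilon> A0) + fscale (of_real (\<eta> * s)) (vec (\<lambda>n. of_real (c n) * \<epsilon> n) A0)"
          unfolding vec_scale vec_add ..
        finally show ?thesis by simp
      qed
      then have "N (fscale (of_real s) (vec \<epsilon> A0)) powr p
          \<le> N (vec (\<lambda>n. ys n f) A0) powr p + N (fscale (of_real (\<eta> * s)) (vec (\<lambda>n. of_real (c n) * \<epsilon> n) A0)) powr p"
        by (simp only: N_diff vec_mem scale_mem)
      also have "N (fscale (of_real s) (vec \<epsilon> A0)) powr p = s powr p * N (vec \<epsilon> A0) powr p"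
        using s by (simp add: N_scale_powr vec_mem)
      also have "N (fscale (of_real (\<eta> * s)) (vec (\<lambda>n. of_real (c n) * \<epsilon> n) A0)) powr p
          = \<eta> powr p * s powr p * N (vec (\<lambda>n. of_real (c n) * \<epsilon> n) A0) powr p"
        using s \<eta> by (simp add: N_scale_powr vec_mem powr_mult norm_mult)
      also have "N (vec (\<lambda>n. of_real (c n) * \<epsilon> n) A0) powr p \<le> K' * N (vec \<epsilon> A0) powr p"
        unfolding K'_def using AB c by (intro ucc_lattice_real K) (auto simp: \<epsilon>_def)
      finally have "s powr p * N (vec \<epsilon> A0) powr p
          \<le> N (vec (\<lambda>n. ys n f) A0) powr p + \<eta> powr p * s powr p * (K' * N (vec \<epsilon> A0) powr p)"
        by (simp add: mult_left_mono)
      also have "\<eta> powr p * s powr p * (K' * N (vec \<epsilon> A0) powr p) = (\<eta> powr p * K') * (s powr p * N (vec \<epsilon> A0) powr p)"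
        by (simp add: mult_ac)
      also have "\<dots> \<le> 1 / 2 * (s powr p * N (vec \<epsilon> A0) powr p)"
        unfolding \<eta>(2) using K' by (intro mult_right_mono) (auto simp: field_simps)
      finally have 2: "s powr p * N (vec \<epsilon> A0) powr p \<le> 4 * C powr p * N f powr p"
        using 1 by simp
      have 3: "s powr p * N (vec \<epsilon> B) powr p \<le> q * D * N f powr p"
      proof -
        have "s powr p * N (vec \<epsilon> B) powr p = q * (((1 + \<eta>) * s) powr p * N (vec \<epsilon> B) powr p)"
        proof -
          have "((1 + \<eta>) * s) powr p = (1 + \<eta>) powr p * s powr p"
            by (rule powr_mult)
          moreover have "q * (1 + \<eta>) powr p = 1"
            using \<eta>(1) by (simp add: q_def flip: powr_add)
          ultimately show ?thesis by (simp add: mult.assoc[symmetric])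
        qed
        also have "\<dots> \<le> q * (D * N f powr p)" using q by (intro mult_left_mono IH) auto
        finally show ?thesis by (simp add: mult.assoc)
      qed
      have "vec \<epsilon> A = vec \<epsilon> A0 + vec \<epsilon> B" unfolding AB(1) using AB by (simp add: vec_union)
      then have "N (vec \<epsilon> A) powr p \<le> N (vec \<epsilon> A0) powr p + N (vec \<epsilon> B) powr p"
        by (simp only: N_add vec_mem)
      then have "s powr p * N (vec \<epsilon> A) powr p \<le> s powr p * (N (vec \<epsilon> A0) powr p + N (vec \<epsilon> B) powr p)"
        by (intro mult_left_mono) auto
      also have "\<dots> \<le> 4 * C powr p * N f powr p + q * D * N f powr p"
        unfolding distrib_left by (intro add_mono 2 3)
      also have "\<dots> = (4 * C powr p + q * D) * N f powr p" by (simp add: algebra_simps)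
      also have "\<dots> = D * N f powr p" by (simp only: D(2))
      finally have "s powr p * N (vec \<epsilon> A) powr p \<le> D * N f powr p" .
      moreover have "t powr p * N (vec \<epsilon> A) powr p \<le> s powr p * N (vec \<epsilon> A) powr p"
        using ts less.prems p_pos by (intro mult_right_mono powr_mono2) auto
      ultimately show ?thesis by (simp add: \<epsilon>_def[abs_def])
    qed
  qed
  have "t * N (vec (\<lambda>n. sign1 (ys n f)) A) \<le> D powr (1 / p) * N f"
    if "f \<in> Y" "is_greedy ys f A" "0 < t" "\<forall>n\<in>A. t \<le> norm (ys n f)" for f A t
  proof (rule powr_le_imp_le_root)
    show "(t * N (vec (\<lambda>n. sign1 (ys n f)) A)) powr p \<le> D * N f powr p"
      using main[OF that] that N_nonneg[OF vec_mem] by (simp add: powr_mult)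
  qed (use that D p_pos N_nonneg vec_mem in auto)
  then show ?thesis unfolding trunc_bound_def by (intro exI[of _ "D powr (1 / p)"]) auto
qed

text \<open>With \<open>P\<close> the coordinate projections, g = f - P A and \<open>B\<close> the
  greedy set, f - P B = g + P (A - B) - P (B - A). The last term is a greedy projection of
  \<open>g\<close>. Coefficients on A - B are at most those on B - A, so democracy and the lattice
  estimate compare P (A - B) with a truncation of \<open>g\<close>.\<close>

lemma almost_greedy_of_democratic:
  assumes G: "greedy_bound C0" and T: "trunc_bound C"
    and D: "0 \<le> D" "\<And>A B. finite A \<Longrightarrow> finite B \<Longrightarrow> card A \<le> card B \<Longrightarrow>
      N (vec (\<lambda>_. 1) A) powr p \<le> D * N (vec (\<lambda>_. 1) B) powr p"
  shows "almost_greedy N Y y ys"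
proof -
  have C0: "0 \<le> C0" and C: "0 \<le> C" using G T by (auto simp: greedy_bound_def trunc_bound_def)
  define K where "K = 4 * (2 * C powr p / (2 powr p - 1))"
  have two: "1 < (2::real) powr p" using p_pos by simp
  have K: "0 \<le> K" using two by (simp add: K_def)
  have lat: "N (vec c A) powr p \<le> K * N (vec \<epsilon> A) powr p"
    if "finite A" "\<And>n. norm (\<epsilon> n) = 1" "\<And>n. n \<in> A \<Longrightarrow> norm (c n) \<le> 1" for c \<epsilon> A
    unfolding K_def using that by (intro ucc_lattice ucc_of_trunc_bound T) auto
  \<comment> \<open>One summand each for g, P (B - A) and P (A - B); in the last one
    \<open>D\<close> is democracy, between two changes of coefficients that cost \<open>K\<close>
    each.\<close>
  define L where "L = 1 + C0 powr p + K * D * K * C powr p"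
  have L: "1 \<le> L" using K D by (simp add: L_def)
  have main: "N (f - greedy_op y ys m f) \<le> L powr (1 / p) * N (f - coord_proj y ys A f)"
    if f: "f \<in> Y" and A: "finite A" "card A \<le> m" for f m A
  proof -
    obtain B where B: "is_greedy ys f B" "card B = m" using greedy_exists[OF f] by blast
    have fB: "finite B" using B by (simp add: is_greedy_def)
    define P where "P S = vec (\<lambda>n. ys n f) S" for S
    have P: "P S \<in> Y" for S unfolding P_def by (rule vec_mem)
    define g where "g = f - P A"
    have g: "g \<in> Y" unfolding g_def by (intro diff_mem f P)
    have cg: "ys n g = (if n \<in> A then 0 else ys n f)" for n
      unfolding g_def using A by (simp add: ys_diff f P) (simp add: P_def ys_vec)
    \<comment> \<open>Indices with coefficient 0 are dropped: against those in \<open>A\<close>,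
      where \<open>g\<close> has coefficient 0 as well, they would have to win by their
      index.\<close>
    define B' where "B' = {n \<in> B - A. ys n f \<noteq> 0}"
    have fin: "finite B'" "finite (B - A)" "finite (A - B)" using fB A by (auto simp: B'_def)
    have gr: "is_greedy ys g B'"
      unfolding is_greedy_def
    proof (intro conjI ballI allI impI fin)
      fix i j assume i: "i \<in> B'" and j: "j \<notin> B'"
      show "norm (ys j g) < norm (ys i g) \<or> norm (ys i g) = norm (ys j g) \<and> i < j"
      proof (cases "j \<in> A \<or> ys j f = 0")
        case True
        then show ?thesis using i by (auto simp: cg B'_def)
      next
        case False
        then have "j \<notin> B" using j by (auto simp: B'_def)
        then show ?thesis using B(1) i False by (auto simp: is_greedy_def B'_def cg)
      qed
    qed
    have PBA: "P (B - A) = vec (\<lambda>n. ys n g) B'"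
    proof -
      have "P (B - A) = vec (\<lambda>n. if n \<in> B' then ys n g else 0) (B - A)"
        unfolding P_def by (rule vec_cong) (auto simp: B'_def cg)
      moreover have "B' \<subseteq> B - A" by (auto simp: B'_def)
      ultimately show ?thesis using vec_restrict[OF fin(2), of B' "\<lambda>n. ys n g"] by (simp only:)
    qed
    have 1: "N (P (B - A)) powr p \<le> C0 powr p * N g powr p"
    proof -
      have "N (P (B - A)) \<le> C0 * N g" using G g gr by (auto simp: PBA greedy_bound_def)
      then have "N (P (B - A)) powr p \<le> (C0 * N g) powr p" using p_pos by (intro powr_mono2 N_nonneg P) auto
      then show ?thesis using C0 N_nonneg[OF g] by (simp add: powr_mult)
    qed
    have 2: "N (P (A - B)) powr p \<le> K * D * K * C powr p * N g powr p"
    proof (cases "A - B = {}")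
      case True
      have "P (A - B) = 0" unfolding True P_def vec_def by simp
      then show ?thesis using N_zero K D by simp
    next
      case False
      have cards: "card (A - B) \<le> card (B - A)"
      proof -
        have "card (A - B) + card (A \<inter> B) = card A" "card (B - A) + card (A \<inter> B) = card B"
          using A fB by (metis card_Diff_subset_Int card_mono finite_Int inf_le1 le_add_diff_inverse2,
            metis card_Diff_subset_Int card_mono finite_Int inf_le2 inf_commute le_add_diff_inverse2)
        then show ?thesis using A B by linarith
      qed
      then have ne: "B - A \<noteq> {}" using False fin by (metis card_0_eq le_zero_eq card.empty)
      define t where "t = Min ((\<lambda>n. norm (ys n f)) ` (B - A))"
      have t: "t \<le> norm (ys n f)" if "n \<in> B - A" for n
        unfolding t_def using that fin by (intro Min_le) auto
      obtain n0 where n0: "n0 \<in> B - A" "norm (ys n0 f) = t"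
      proof -
        have "t \<in> (\<lambda>n. norm (ys n f)) ` (B - A)" unfolding t_def using fin ne by (intro Min_in) auto
        then show ?thesis using that by blast
      qed
      have le_t: "norm (ys n f) \<le> t" if "n \<in> A - B" for n
      proof -
        have "norm (ys n f) < norm (ys n0 f) \<or> (norm (ys n0 f) = norm (ys n f) \<and> n0 < n)"
          using B(1) n0(1) that unfolding is_greedy_def by blast
        then show ?thesis unfolding n0(2) by linarith
      qed
      show ?thesis
      proof (cases "t = 0")
        case True
        then have "P (A - B) = vec (\<lambda>_. 0) (A - B)" unfolding P_def using le_t by (intro vec_cong) auto
        also have "\<dots> = 0" by (simp add: fun_eq_iff vec_apply zero_fun_apply)
        finally show ?thesis using N_zero K D by simp
      next
        case False
        then have t0: "0 < t" using n0 by (metis norm_ge_zero order_le_less)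
        have B'eq: "B' = B - A" using t t0 by (force simp: B'_def)
        define \<epsilon> where "\<epsilon> n = sign1 (ys n g)" for n
        have tb: "t * N (vec \<epsilon> (B - A)) \<le> C * N g"
          using T g gr t0 t unfolding \<epsilon>_def by (auto simp: trunc_bound_def B'eq cg)
        have "P (A - B) = fscale (of_real t) (vec (\<lambda>n. ys n f / of_real t) (A - B))"
          unfolding P_def vec_scale using t0 by (intro vec_cong) auto
        then have "N (P (A - B)) powr p = t powr p * N (vec (\<lambda>n. ys n f / of_real t) (A - B)) powr p"
          using t0 by (simp add: N_scale_powr vec_mem)
        also have "\<dots> \<le> t powr p * (K * N (vec (\<lambda>_. 1) (A - B)) powr p)"
          using fin le_t t0 by (intro mult_left_mono lat) (auto simp: norm_divide)
        also have "\<dots> \<le> t powr p * (K * (D * N (vec (\<lambda>_. 1) (B - A)) powr p))"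
          using K by (intro mult_left_mono D(2) fin cards) auto
        also have "\<dots> \<le> t powr p * (K * (D * (K * N (vec \<epsilon> (B - A)) powr p)))"
          using K D(1) fin by (intro mult_left_mono lat) (auto simp: \<epsilon>_def)
        also have "\<dots> = K * D * K * (t * N (vec \<epsilon> (B - A))) powr p"
          using t0 N_nonneg[OF vec_mem] by (simp add: powr_mult mult_ac)
        also have "\<dots> \<le> K * D * K * (C * N g) powr p"
          using K D(1) p_pos t0 N_nonneg[OF vec_mem] by (intro mult_left_mono powr_mono2 tb) auto
        finally show ?thesis using C N_nonneg[OF g] by (simp add: powr_mult mult.assoc)
      qed
    qed
    have "P A = P (A - B) + P (A \<inter> B)" "P B = P (B - A) + P (A \<inter> B)"
      unfolding P_def using A fB
      by (subst vec_union[symmetric]; auto intro!: arg_cong[where f = "vec _"])+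
    then have "f - P B = (g + P (A - B)) - P (B - A)" by (simp add: g_def algebra_simps)
    then have "N (f - P B) powr p \<le> N (g + P (A - B)) powr p + N (P (B - A)) powr p"
      by (simp only: N_diff add_mem g P)
    also have "N (g + P (A - B)) powr p \<le> N g powr p + N (P (A - B)) powr p"
      by (intro N_add g P)
    finally have "N (f - P B) powr p \<le> L * N g powr p"
      using 1 2 by (simp add: L_def algebra_simps)
    then have "N (f - P B) \<le> L powr (1 / p) * N g"
      using L by (intro powr_le_imp_le_root[OF _ N_nonneg N_nonneg _ p_pos] diff_mem f P g) auto
    moreover have "greedy_op y ys m f = P B"
      using greedy_set_eq[OF B(1)] B(2) by (simp add: greedy_op_def coord_proj_eq P_def)
    ultimately show ?thesis by (simp add: g_def coord_proj_eq P_def)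
  qed
  show ?thesis
    unfolding almost_greedy_def
  proof (rule exI[of _ "L powr (1 / p)"], intro ballI allI)
    fix f m assume f: "f \<in> Y"
    have Lp: "0 < L powr (1 / p)" using L by simp
    have "N (f - greedy_op y ys m f) / L powr (1 / p) \<le> (INF A\<in>{A. finite A \<and> card A \<le> m}. N (f - coord_proj y ys A f))"
    proof (rule cINF_greatest)
      show "{A. finite A \<and> card A \<le> m} \<noteq> ({} :: nat set set)" by (auto intro!: exI[of _ "{}"])
      fix A :: "nat set" assume "A \<in> {A. finite A \<and> card A \<le> m}"
      then show "N (f - greedy_op y ys m f) / L powr (1 / p) \<le> N (f - coord_proj y ys A f)"
        using main[OF f, of A m] Lp by (simp add: pos_divide_le_eq mult.commute)
    qed
    then show "N (f - greedy_op y ys m f) \<le> L powr (1 / p) * (INF A\<in>{A. finite A \<and> card A \<le> m}. N (f - coord_proj y ys A f))"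
      using Lp by (simp add: pos_divide_le_eq mult.commute)
  qed
qed

end

section \<open>Democracy of bases of complemented subspaces\<close>

lemma p_normed_space_hardy:
  assumes "0 < p" "p \<le> 1"
  shows "p_normed_space (hardy p) (hardy_norm p) p"
  by unfold_locales
     (use assms hardy_zero hardy_add hardy_scale_le hardy_norm_nonneg hardy_norm_scale in auto)

locale hardy_basis = p_normed_basis Y "hardy_norm p" p y ys for Y p y ys +
  assumes p_less_1: "p < 1" and sub: "Y \<subseteq> hardy p"
begin

text \<open>The overlap is bounded as follows. If a point lies in E n for all n in S, the projected
  normalised kernel has bounded norm and coefficients above d on S. So the sums of the suitably
  signed y n over all subsets of S are bounded in norm, and hence in size at the point. Numbers with
  bounded subset sums have bounded total modulus, while each term exceeds d; so S is small,
  uniformly in the point.\<close>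

lemma democracy_lower_bound:
  assumes P: "linear_on fscale (hardy p) P" "\<And>f. f \<in> hardy p \<Longrightarrow> hardy_norm p (P f) \<le> CP * hardy_norm p f"
      "\<And>f. f \<in> hardy p \<Longrightarrow> P f \<in> Y" "\<And>n. P (y n) = y n"
    and C: "trunc_bound C"
  shows "\<exists>K>0. \<forall>A. finite A \<longrightarrow> real (card A) \<le> K * hardy_norm p (\<Sum>n\<in>A. y n) powr p"
proof -
  note p = p_pos p_less_1
  have p': "0 < p" "p \<le> 1" using p by auto
  obtain B :: nat where "real B > 2 / p" using reals_Archimedean2 by blast
  then have "2 < real B * p" using p by (simp add: field_simps)
  then have B: "2 \<le> real (B + 2) * p" using p by (simp add: algebra_simps)
  obtain C1 where C1: "\<And>n. hardy_norm p (y n) \<le> C1" using basis unfolding basis_dual_def by blast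
  obtain C2 where C2: "\<And>n f. f \<in> Y \<Longrightarrow> norm (ys n f) \<le> C2 * hardy_norm p f" using basis unfolding basis_dual_def by blast
  define C2' where "C2' = max 0 C2"
  define CP' where "CP' = max 0 CP"
  \<comment> \<open>One constant for the norms of the basis vectors, of the functionals composed
    with the projection, and of the projected kernels.\<close>
  define M where "M = max (max C1 (C2' * CP')) (max CP' 1)"
  have M: "0 < M" "C1 \<le> M" "C2' * CP' \<le> M" "CP' \<le> M" by (auto simp: M_def)
  define \<phi> where "\<phi> n f = ys n (P f)" for n f
  have NP: "hardy_norm p (P f) \<le> CP' * hardy_norm p f" if "f \<in> hardy p" for f
    using P(2)[OF that] mult_right_mono[of CP CP' "hardy_norm p f"] hardy_norm_nonneg[OF p' that]
    by (simp add: CP'_def)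
  have lin: "linear_on (*) (hardy p) (\<phi> n)" for n
    using P(1,3) by (auto simp: linear_on_def \<phi>_def ys_add ys_scale)
  have bdd: "norm (\<phi> n f) \<le> M * hardy_norm p f" if f: "f \<in> hardy p" for n f
  proof -
    have "norm (\<phi> n f) \<le> C2' * hardy_norm p (P f)"
      unfolding \<phi>_def C2'_def by (rule nonneg_bound[OF P(3)[OF f] C2[OF P(3)[OF f]]])
    also have "\<dots> \<le> C2' * (CP' * hardy_norm p f)" by (intro mult_left_mono NP f) (simp add: C2'_def)
    also have "\<dots> \<le> M * hardy_norm p f"
      using mult_right_mono[OF M(3), of "hardy_norm p f"] hardy_norm_nonneg[OF p' f] by (simp add: mult.assoc)
    finally show ?thesis by simp
  qed
  obtain d c where d: "0 < d" and c: "0 < c" and dens: "\<And>\<phi> f. linear_on (*) (hardy p) \<phi> \<Longrightarrow>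
      (\<forall>g\<in>hardy p. norm (\<phi> g) \<le> M * hardy_norm p g) \<Longrightarrow> f \<in> hardy p \<Longrightarrow> hardy_norm p f \<le> M \<Longrightarrow> \<phi> f = 1 \<Longrightarrow>
      ennreal c \<le> emeasure hyp_measure {x. d < hyp_size p f x \<and> d < kernel_pair p B \<phi> x}"
    using functional_hyp_density[OF p B M(1)] by blast
  define E where "E n = {x. d < hyp_size p (y n) x \<and> d < kernel_pair p B (\<phi> n) x}" for n
  have yh: "y n \<in> hardy p" for n using sub y_mem by blast
  have Em: "E n \<in> sets borel" for n
  proof -
    note [measurable] = measurable_hyp_size[OF p yh[of n]] measurable_kernel_pair[OF p B lin[of n] bdd less_imp_le[OF M(1)]]
    show ?thesis unfolding E_def by measurable
  qed
  have Ec: "ennreal c \<le> emeasure hyp_measure (E n)" for n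
    unfolding E_def
  proof (rule dens[OF lin])
    show "\<forall>g\<in>hardy p. norm (\<phi> n g) \<le> M * hardy_norm p g" using bdd by blast
    show "hardy_norm p (y n) \<le> M" using C1[of n] M by simp
    show "\<phi> n (y n) = 1" by (simp add: \<phi>_def P(4) ys_y)
  qed (rule yh)
  have C0: "0 \<le> C" using C by (simp add: trunc_bound_def)
  \<comment> \<open>\<open>k1\<close> is the cost of passing to subsets, \<open>Q\<close> bounds the
    signed sums at a point, and the 4 in \<open>k\<close> is that of the bound on total modulus by
    subset sums.\<close>
  define k1 where "k1 = (2 * C powr p) powr (1 / p)"
  define Q where "Q = k1 * (C * M / d)"
  define k where "k = nat \<lceil>4 * Q / d\<rceil>"
  have overlap: "card {n \<in> A. x \<in> E n} \<le> k" if A: "finite A" and x: "0 < fst x" "fst x < 1" for A x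
  proof -
    define z where "z = disc_point x"
    have z: "norm z = fst x" using x by (simp add: z_def disc_point_def norm_mult)
    define a where "a = (1 - fst x) powr (real (B + 2) - 1 / p)"
    define h where "h = fscale (of_real a) (disc_kernel B z)"
    have kh: "disc_kernel B z \<in> hardy p" using x z by (intro kernel_hardy[OF p B]) auto
    have h: "h \<in> hardy p" unfolding h_def by (rule hardy_scale_le(1)[OF p' kh])
    have "hardy_norm p h = a * hardy_norm p (disc_kernel B z)"
      unfolding h_def by (simp add: hardy_norm_scale[OF p' kh] a_def)
    also have "\<dots> \<le> a * (1 - fst x) powr (1 / p - real (B + 2))"
      using kernel_hardy(2)[OF p B, of z] x z by (intro mult_left_mono) (auto simp: a_def)
    also have "\<dots> = 1" using x by (simp add: a_def powr_add[symmetric])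
    finally have Nh: "hardy_norm p h \<le> 1" by simp
    define g where "g = P h"
    have g: "g \<in> Y" unfolding g_def by (rule P(3)[OF h])
    have "hardy_norm p g \<le> CP' * hardy_norm p h" unfolding g_def by (rule NP[OF h])
    also have "\<dots> \<le> CP' * 1" by (intro mult_left_mono Nh) (simp add: CP'_def)
    finally have Ng: "hardy_norm p g \<le> M" using M by simp
    \<comment> \<open>By linearity the coefficients of the projected kernel are the values measured
      by \<open>kernel_pair\<close>, so membership in \<open>E n\<close> bounds them from
      below.\<close>
    have coeff: "norm (ys n g) = kernel_pair p B (\<phi> n) x" for n
    proof -
      have "ys n g = \<phi> n h" by (simp add: g_def \<phi>_def)
      also have "\<dots> = of_real a * \<phi> n (disc_kernel B z)"
        unfolding h_def using lin[of n] kh by (auto simp: linear_on_def)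
      finally show ?thesis by (simp add: kernel_pair_def norm_mult a_def z_def)
    qed
    define S where "S = {n \<in> A. x \<in> E n}"
    have S: "finite S" "S \<subseteq> {n. d \<le> norm (ys n g)}" using A by (auto simp: S_def E_def coeff)
    define v where "v n = sign1 (ys n g) * y n z * of_real ((1 - fst x) powr (1 / p))" for n
    have "norm (\<Sum>n\<in>S'. v n) \<le> Q" if S': "S' \<subseteq> S" for S'
    proof -
      define w where "w = vec (\<lambda>n. sign1 (ys n g)) S'"
      have w: "w \<in> hardy p" using sub vec_mem by (auto simp: w_def)
      have "(\<Sum>n\<in>S'. v n) = w z * of_real ((1 - fst x) powr (1 / p))"
        by (simp add: w_def vec_apply v_def sum_distrib_right)
      then have "norm (\<Sum>n\<in>S'. v n) = hyp_size p w x" by (simp add: hyp_size_def norm_mult z_def)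
      also have "\<dots> \<le> hardy_norm p w" by (rule hyp_size_le[OF p w x])
      also have "\<dots> \<le> k1 * (C * hardy_norm p g / d)"
        unfolding w_def k1_def using S S' by (intro large_coeff_sum_bound C g d) auto
      also have "\<dots> \<le> Q"
        unfolding Q_def using C0 d Ng by (intro mult_left_mono divide_right_mono) (auto simp: k1_def)
      finally show ?thesis .
    qed
    from sum_norm_le_subset_sums[OF S(1) this] have le: "(\<Sum>n\<in>S. norm (v n)) \<le> 4 * Q" .
    have "norm (v n) = hyp_size p (y n) x" for n
      by (simp add: v_def norm_mult hyp_size_def z_def)
    then have "(\<Sum>n\<in>S. d) \<le> (\<Sum>n\<in>S. norm (v n))"
      by (intro sum_mono) (auto simp: S_def E_def)
    then have "real (card S) * d \<le> 4 * Q" using le by simp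
    then have "real (card S) \<le> 4 * Q / d" using d by (simp add: field_simps)
    then show ?thesis unfolding k_def S_def by linarith
  qed
  define G where "G = 2 * real k * (16 * pi * k1 powr p / (d / 2) powr p)"
  have G: "0 \<le> G" by (simp add: G_def)
  have main: "real (card A) \<le> (G / c + 1) * hardy_norm p (\<Sum>n\<in>A. y n) powr p" if A: "finite A" for A
  proof -
    define NA where "NA = hardy_norm p (\<Sum>n\<in>A. y n)"
    have NA: "0 \<le> NA" unfolding NA_def by (intro N_nonneg sum_mem y_mem)
    have "c * real (card A) \<le> 2 * real k * (16 * pi * (k1 * NA) powr p / (d / 2) powr p)"
    proof (rule card_bound_of_hyp_density[OF p A yh d c _ Em Ec])
      show "0 \<le> k1 * NA" using NA by (simp add: k1_def)
      show "d < hyp_size p (y n) x" if "x \<in> E n" for n x using that by (simp add: E_def)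
      show "card {n \<in> A. x \<in> E n} \<le> k" if "0 < fst x" "fst x < 1" for x by (rule overlap[OF A that])
      show "hardy_norm p (\<Sum>n\<in>S. y n) \<le> k1 * NA" if S: "S \<subseteq> A" for S
      proof -
        have "hardy_norm p (vec (\<lambda>_. 1) S) powr p \<le> 2 * C powr p * hardy_norm p (vec (\<lambda>_. 1) A) powr p"
          using ucc_of_trunc_bound[OF C] A S unfolding ucc_def by auto
        from powr_le_imp_le_root[OF this N_nonneg[OF vec_mem] N_nonneg[OF vec_mem] _ p_pos]
        show ?thesis by (simp add: k1_def NA_def vec_one)
      qed
    qed
    also have "\<dots> = G * NA powr p"
      using NA by (simp add: G_def powr_mult k1_def)
    finally have "real (card A) \<le> G / c * NA powr p" using c by (simp add: field_simps)
    also have "\<dots> \<le> (G / c + 1) * NA powr p" by (intro mult_right_mono) auto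
    finally show ?thesis by (simp add: NA_def)
  qed
  have "0 < G / c + 1" using G c by (simp add: add_nonneg_pos)
  then show ?thesis using main by blast
qed

end

section \<open>The upper bound and the conclusion\<close>

context p_normed_basis
begin

lemma democracy_upper_bound:
  "\<exists>M>0. \<forall>A. finite A \<longrightarrow> N (\<Sum>n\<in>A. y n) powr p \<le> real (card A) * M powr p"
proof -
  obtain C where C: "\<And>n. N (y n) \<le> C" using basis unfolding basis_dual_def by blast
  define M where "M = max C 1"
  have "N (\<Sum>n\<in>A. y n) powr p \<le> real (card A) * M powr p" if A: "finite A" for A
  proof -
    have "N (\<Sum>n\<in>A. y n) powr p \<le> (\<Sum>n\<in>A. N (y n) powr p)" by (intro N_sum A y_mem)
    also have "\<dots> \<le> (\<Sum>n\<in>A. M powr p)"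
      using C p_pos by (intro sum_mono powr_mono2 N_nonneg y_mem) (auto simp: M_def max.coboundedI1)
    finally show ?thesis by simp
  qed
  moreover have "0 < M" by (simp add: M_def)
  ultimately show ?thesis by blast
qed

text \<open>The two bounds make the p-th power of the norm of an indicator sum comparable to the
  number of its terms. The initial segment with exactly m indices is the witness for the lower bound
  on the supremum.\<close>

lemma democracy_estimates:
  assumes K: "0 < K" "\<And>A. finite A \<Longrightarrow> real (card A) \<le> K * N (\<Sum>n\<in>A. y n) powr p"
    and M: "0 < M" "\<And>A. finite A \<Longrightarrow> N (\<Sum>n\<in>A. y n) powr p \<le> real (card A) * M powr p"
  shows "finite A \<Longrightarrow> finite B \<Longrightarrow> card A \<le> card B \<Longrightarrow>
      N (\<Sum>n\<in>A. y n) powr p \<le> (M powr p * K) * N (\<Sum>n\<in>B. y n) powr p"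
    and "democratic N y"
    and "comparable (upper_democracy N y) (\<lambda>m. real m powr (1 / p))"
proof -
  have nn: "0 \<le> N (\<Sum>n\<in>A. y n)" for A by (intro N_nonneg sum_mem y_mem)
  have dem: "N (\<Sum>n\<in>A. y n) powr p \<le> (M powr p * K) * N (\<Sum>n\<in>B. y n) powr p"
    if "finite A" "finite B" "card A \<le> card B" for A B
  proof -
    have "N (\<Sum>n\<in>A. y n) powr p \<le> real (card A) * M powr p" by (rule M(2)[OF that(1)])
    also have "\<dots> \<le> (K * N (\<Sum>n\<in>B. y n) powr p) * M powr p"
      using K(2)[OF that(2)] that(3) by (intro mult_right_mono) auto
    finally show ?thesis by (simp add: mult_ac)
  qed
  then show "finite A \<Longrightarrow> finite B \<Longrightarrow> card A \<le> card B \<Longrightarrow>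
      N (\<Sum>n\<in>A. y n) powr p \<le> (M powr p * K) * N (\<Sum>n\<in>B. y n) powr p" .
  define D where "D = max 1 ((M powr p * K) powr (1 / p))"
  have "N (\<Sum>n\<in>A. y n) \<le> D * N (\<Sum>n\<in>B. y n)" if "finite A" "finite B" "card A \<le> card B" for A B
  proof -
    have "N (\<Sum>n\<in>A. y n) \<le> (M powr p * K) powr (1 / p) * N (\<Sum>n\<in>B. y n)"
      using K by (intro powr_le_imp_le_root[OF dem[OF that] nn nn _ p_pos]) auto
    also have "\<dots> \<le> D * N (\<Sum>n\<in>B. y n)" by (intro mult_right_mono nn) (simp add: D_def)
    finally show ?thesis .
  qed
  then show "democratic N y" unfolding democratic_def by (intro exI[of _ D]) (auto simp: D_def)
  have up: "N (\<Sum>n\<in>A. y n) \<le> M * real m powr (1 / p)" if "finite A" "card A \<le> m" for A m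
  proof -
    have "N (\<Sum>n\<in>A. y n) powr p \<le> real m * M powr p"
      using M(2)[OF that(1)] that(2) mult_right_mono[of "real (card A)" "real m" "M powr p"] by simp
    from powr_le_imp_le_root[OF this nn _ _ p_pos] show ?thesis using M by (simp add: mult.commute)
  qed
  define c where "c = (1 / K) powr (1 / p)"
  have c: "0 < c" using K by (simp add: c_def)
  have ne: "{A. finite A \<and> card A \<le> m} \<noteq> ({} :: nat set set)" for m by (auto intro!: exI[of _ "{}"])
  have bdd: "bdd_above ((\<lambda>A. N (\<Sum>n\<in>A. y n)) ` {A. finite A \<and> card A \<le> m})" for m
    by (rule bdd_aboveI2[of _ _ "M * real m powr (1 / p)"]) (use up in auto)
  have "upper_democracy N y m \<le> M * real m powr (1 / p)" for m
    unfolding upper_democracy_def by (rule cSUP_least[OF ne]) (use up in auto)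
  moreover have "c * real m powr (1 / p) \<le> upper_democracy N y m" for m
  proof -
    have "real m \<le> K * N (\<Sum>n\<in>{..<m}. y n) powr p" using K(2)[of "{..<m}"] by simp
    then have "real m / K \<le> N (\<Sum>n\<in>{..<m}. y n) powr p" using K by (simp add: field_simps)
    then have "(real m / K) powr (1 / p) \<le> (N (\<Sum>n\<in>{..<m}. y n) powr p) powr (1 / p)"
      using K p_pos by (intro powr_mono2) auto
    also have "\<dots> = N (\<Sum>n\<in>{..<m}. y n)" using nn p_pos by (simp add: powr_powr)
    also have "\<dots> \<le> upper_democracy N y m"
      unfolding upper_democracy_def by (rule cSUP_upper[OF _ bdd]) auto
    finally show ?thesis using K by (simp add: c_def powr_divide)
  qed
  moreover have "max c M * real m powr (1 / p) \<ge> M * real m powr (1 / p)" for m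
    by (intro mult_right_mono) auto
  ultimately show "comparable (upper_democracy N y) (\<lambda>m. real m powr (1 / p))"
    unfolding comparable_def using c
    by (intro exI[of _ c] exI[of _ "max c M"]) (auto intro: order_trans)
qed

end

theorem corollary4p3:
  fixes p :: real
  assumes "0 < p" and "p < 1"
  shows "(\<forall>Y y ys. complemented (hardy_norm p) (hardy p) Y \<and> infinite_dimensional Y \<and>
             basis_dual (hardy_norm p) Y y ys \<and> truncation_quasi_greedy (hardy_norm p) Y y ys \<longrightarrow>
             democratic (hardy_norm p) y \<and>
             comparable (upper_democracy (hardy_norm p) y) (\<lambda>m. real m powr (1 / p))) \<and>
         (\<forall>x xs. basis_dual (hardy_norm p) (hardy p) x xs \<and>
             quasi_greedy (hardy_norm p) (hardy p) x xs \<longrightarrow>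
             almost_greedy (hardy_norm p) (hardy p) x xs)"
proof (intro conjI allI impI)
  have p: "0 < p" "p \<le> 1" using assms by auto
  interpret H: p_normed_space "hardy p" "hardy_norm p" p by (rule p_normed_space_hardy[OF p])
  {
    fix Y y ys
    assume "complemented (hardy_norm p) (hardy p) Y \<and> infinite_dimensional Y \<and>
      basis_dual (hardy_norm p) Y y ys \<and> truncation_quasi_greedy (hardy_norm p) Y y ys"
    then have compl: "complemented (hardy_norm p) (hardy p) Y" and basis: "basis_dual (hardy_norm p) Y y ys"
      and tqg: "truncation_quasi_greedy (hardy_norm p) Y y ys" by auto
    obtain P CP where P: "linear_on fscale (hardy p) P" "\<And>f. f \<in> hardy p \<Longrightarrow> hardy_norm p (P f) \<le> CP * hardy_norm p f"
      "P ` hardy p \<subseteq> hardy p" "\<And>f. f \<in> hardy p \<Longrightarrow> P (P f) = P f" "P ` hardy p = Y"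
      using compl unfolding complemented_def by blast
    have sub: "Y \<subseteq> hardy p" using P by blast
    have PY: "P f \<in> Y" if "f \<in> hardy p" for f using P(5) that by blast
    have fix_Y: "P f = f" if "f \<in> Y" for f using that P(4,5) by blast
    have addP: "P (f + g) = P f + P g" if "f \<in> hardy p" "g \<in> hardy p" for f g
      using P(1) that by (auto simp: linear_on_def)
    have scaleP: "P (fscale c f) = fscale c (P f)" if "f \<in> hardy p" for c f
      using P(1) that by (auto simp: linear_on_def)
    \<comment> \<open>\<open>Y\<close> is a linear subspace because it consists of the fixed points
      of the linear projection.\<close>
    interpret hardy_basis Y p y ys
    proof unfold_locales
      show add: "f + g \<in> Y" if "f \<in> Y" "g \<in> Y" for f g
        using addP[of f g] PY[of "f + g"] that sub by (simp add: fix_Y subset_iff H.add_mem)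
      show scale: "fscale c f \<in> Y" if "f \<in> Y" for c f
        using scaleP[of f c] PY[of "fscale c f"] that sub by (simp add: fix_Y subset_iff H.scale_mem)
      have "fscale 0 (P 0) = 0" by (simp add: fscale_def zero_fun_def)
      then show "0 \<in> Y" using scale[OF PY[OF H.zero_mem], of 0] by simp
    qed (use assms p sub H.N_nonneg H.N_add H.N_scale basis in \<open>auto simp: subset_iff\<close>)
    obtain C where C: "trunc_bound C" using trunc_bound_of_truncation_quasi_greedy[OF tqg] by blast
    have Py: "P (y n) = y n" for n by (rule fix_Y[OF y_mem])
    obtain K where K: "0 < K" "\<And>A. finite A \<Longrightarrow> real (card A) \<le> K * hardy_norm p (\<Sum>n\<in>A. y n) powr p"
      using democracy_lower_bound[OF P(1,2) PY Py C] by blast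
    obtain M where M: "0 < M" "\<And>A. finite A \<Longrightarrow> hardy_norm p (\<Sum>n\<in>A. y n) powr p \<le> real (card A) * M powr p"
      using democracy_upper_bound by blast
    show "democratic (hardy_norm p) y" "comparable (upper_democracy (hardy_norm p) y) (\<lambda>m. real m powr (1 / p))"
      by (rule democracy_estimates(2,3)[OF K M]; assumption)+
  }
  fix x xs
  assume asm: "basis_dual (hardy_norm p) (hardy p) x xs \<and> quasi_greedy (hardy_norm p) (hardy p) x xs"
  then interpret hardy_basis "hardy p" p x xs
    using assms by unfold_locales auto
  obtain C0 where C0: "greedy_bound C0" using greedy_bound_of_quasi_greedy asm by blast
  obtain C where C: "trunc_bound C" using trunc_bound_of_greedy_bound[OF C0] by blast
  \<comment> \<open>For a basis of the whole space the identity serves as the projection, with bound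
    1.\<close>
  have id: "linear_on fscale (hardy p) (\<lambda>f. f)" by (simp add: linear_on_def)
  obtain K where K: "0 < K" "\<And>A. finite A \<Longrightarrow> real (card A) \<le> K * hardy_norm p (\<Sum>n\<in>A. x n) powr p"
    using democracy_lower_bound[OF id, of 1 C] C by auto
  obtain M where M: "0 < M" "\<And>A. finite A \<Longrightarrow> hardy_norm p (\<Sum>n\<in>A. x n) powr p \<le> real (card A) * M powr p"
    using democracy_upper_bound by blast
  show "almost_greedy (hardy_norm p) (hardy p) x xs"
  proof (rule almost_greedy_of_democratic[OF C0 C])
    show "0 \<le> M powr p * K" using K by simp
    show "hardy_norm p (vec (\<lambda>_. 1) A) powr p \<le> M powr p * K * hardy_norm p (vec (\<lambda>_. 1) B) powr p"
      if "finite A" "finite B" "card A \<le> card B" for A B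
      unfolding vec_one by (rule democracy_estimates(1)[OF K M that])
  qed
qed

end
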